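(* Let $\Omega\subset\mathbb{R}^2$ be a smooth domain, let $g:\Omega\times\Omega\to\mathbb{R}$ be symmetric and of class $C^2$, put $h(z):=g(z,z)$, and let $\Gamma_1,\dots,\Gamma_N\in\mathbb{R}\setminus\{0\}$. Let $Z(t)=e^{-\omega Jt}z$, with $|\omega|=1$ and $z\in\mathcal{F}_N(\mathbb{R}^2)$, be a nondegenerate ($2\pi$-periodic) relative equilibrium of $(HS_0)$, and let $a_0\in\Omega$ be a nondegenerate critical point of $h:\Omega\to\mathbb{R}$. If $\Gamma:=\Gamma_1+\dots+\Gamma_N\neq 0$, then there exists $r_0>0$ such that the following holds. (a) There exists a $C^1$-map $(0,r_0)\to H^1_{2\pi}$, $r\mapsto u^{(r)}$, with $u^{(r)}\to Z$ in $H^1_{2\pi}$ as $r\to0$, and such that for every $0<r<r_0$ the function $z^{(r)}(t):=a_0+r\,u^{(r)}(t/r^2)$ (i.e. $z^{(r)}_k(t)=a_0+r\,u^{(r)}_k(t/r^2)$ for $k=1,\dots,N$) is a periodic solution of $(HS)$. (b) There exists an $S^1$-invariant neighborhood $\mathcal{U}\subset H^1_{2\pi}$ of $S^1*Z=\{\theta*Z:\theta\in S^1\}$ such that if $u\in\mathcal{U}$ generates a solution $z(t)=a_0+r\,u(t/r^2)$ of $(HS)$ for some $0<r<r_0$, then $u=\theta*u^{(r)}$ for some $\theta\in S^1$.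
   Context: Let $J=\begin{pmatrix}0&1\\-1&0\end{pmatrix}$. For a set $A\subset\mathbb{R}^2$ let $\mathcal{F}_N(A)=\{z=(z_1,\dots,z_N)\in A^N: z_j\neq z_k\text{ for }j\neq k\}$. Define $$H_0(z)=-\frac1{2\pi}\sum_{j,k=1,\ j\neq k}^N\Gamma_j\Gamma_k\log|z_j-z_k|\quad (z\in\mathcal{F}_N(\mathbb{R}^2)),\qquad F(z)=\sum_{j,k=1}^N\Gamma_j\Gamma_k\,g(z_j,z_k)\quad(z\in\Omega^N),$$ and $H(z)=H_0(z)-F(z)$ for $z\in\mathcal{F}_N(\Omega)$. The system $(HS)$ is $\Gamma_k\dot z_k(t)=J\nabla_{z_k}H(z(t))$, $k=1,\dots,N$, for $z(t)\in\mathcal{F}_N(\Omega)$; the system $(HS_0)$ is $\Gamma_k\dot z_k(t)=J\nabla_{z_k}H_0(z(t))$, $k=1,\dots,N$, for $z(t)\in\mathcal{F}_N(\mathbb{R}^2)$. A periodic relative equilibrium (with center of vorticity at $0$) is a solution of $(HS_0)$ of the form $Z(t)=e^{-\omega Jt}z$ with $\omega\in\mathbb{R}\setminus\{0\}$ and $z\in\mathcal{F}_N(\mathbb{R}^2)$, where $e^{-\omega Jt}\in\mathbb{R}^{2\times2}$ acts on $z=(z_1,\dots,z_N)$ by multiplication on each component. It is called nondegenerate if the linearized system $M_\Gamma\dot w=J_N H_0''(Z(t))w$, $w(t)\in\mathbb{R}^{2N}$, has exactly three linearly independent $\frac{2\pi}{|\omega|}$-periodic solutions (i.e. the space of such solutions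 has dimension $3$). Here $M_\Gamma\in\mathbb{R}^{2N\times2N}$ is the block diagonal matrix with diagonal blocks $\Gamma_1E_2,\dots,\Gamma_NE_2$ ($E_2$ the $2\times 2$ identity), $J_N\in\mathbb{R}^{2N\times 2N}$ is the block diagonal matrix with $N$ diagonal blocks $J$, and $H_0''$ is the Hessian of $H_0$. A critical point of $h$ is nondegenerate if the Hessian of $h$ at this point is invertible. $H^1_{2\pi}$ is the Hilbert space of $2\pi$-periodic functions $\mathbb{R}\to\mathbb{R}^{2N}$ of class $H^1_{loc}$, with the standard $H^1$ scalar product over one period. The group $S^1=\mathbb{R}/2\pi\mathbb{Z}$ acts on it by $(\theta*u)(t):=u(t+\theta)$. *)

theory Defs
  imports "HOL-Analysis.Analysis"
begin

section \<open>The Hilbert space of \<open>2\<pi>\<close>-periodic \<open>H\<^sup>1\<close> functions\<close>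

text \<open>
  A function \<open>\<real> \<rightarrow> 'a\<close> is of class \<open>H\<^sup>1\<^sub>l\<^sub>o\<^sub>c\<close> iff (its continuous representative) is the integral
  of a locally square integrable function, its weak derivative.
\<close>

definition has_weak_deriv :: "(real \<Rightarrow> 'a::euclidean_space) \<Rightarrow> (real \<Rightarrow> 'a) \<Rightarrow> bool" where
  "has_weak_deriv u v \<longleftrightarrow>
     v \<in> borel_measurable borel \<and>
     (\<forall>a b. set_integrable lborel {a..b} (\<lambda>t. (norm (v t))\<^sup>2)) \<and>
     (\<forall>a b. a \<le> b \<longrightarrow> u b - u a = (LINT t:{a..b}|lborel. v t))"

lemma set_integrable_measurable_bound:
  fixes f :: "real \<Rightarrow> 'b::euclidean_space" and g :: "real \<Rightarrow> real"
  assumes "set_integrable lborel {a..b} g" "f \<in> borel_measurable borel" "\<And>t. norm (f t) \<le> g t"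
  shows "set_integrable lborel {a..b} f"
proof (rule set_integrable_bound[OF assms(1)])
  show "set_borel_measurable lborel {a..b} f"
    using assms(2) by (simp add: set_borel_measurable_def)
  show "AE x in lborel. x \<in> {a..b} \<longrightarrow> norm (f x) \<le> norm (g x)"
    using assms(3) by (auto intro!: AE_I2 order_trans[OF assms(3)])
qed

lemma set_integrable_const_Icc: "set_integrable lborel {a..b::real} (\<lambda>t. c::real)"
  by (intro borel_integrable_atLeastAtMost') auto

lemma has_weak_deriv_set_integrable:
  assumes "has_weak_deriv u v"
  shows "set_integrable lborel {a..b} v"
proof -
  have "set_integrable lborel {a..b} (\<lambda>t. 1 + (norm (v t))\<^sup>2)"
    using assms by (intro set_integral_add set_integrable_const_Icc) (auto simp: has_weak_deriv_def)
  moreover have "v \<in> borel_measurable borel"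
    using assms by (auto simp: has_weak_deriv_def)
  moreover have "norm (v t) \<le> 1 + (norm (v t))\<^sup>2" for t
  proof -
    have "0 \<le> (norm (v t) - 1/2)\<^sup>2" by simp
    then show ?thesis by (simp add: power2_eq_square algebra_simps)
  qed
  ultimately show ?thesis
    by (rule set_integrable_measurable_bound)
qed

lemma has_weak_deriv_zero: "has_weak_deriv (\<lambda>_. 0) (\<lambda>_. 0)"
  by (simp add: has_weak_deriv_def set_integrable_def set_lebesgue_integral_def)

lemma has_weak_deriv_scaleR:
  assumes "has_weak_deriv u v"
  shows "has_weak_deriv (\<lambda>t. c *\<^sub>R u t) (\<lambda>t. c *\<^sub>R v t)"
  using assms
  by (auto simp: has_weak_deriv_def power_mult_distrib scaleR_diff_right[symmetric]
      simp flip: set_integral_scaleR_right)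

lemma has_weak_deriv_add:
  assumes "has_weak_deriv u v" "has_weak_deriv u' v'"
  shows "has_weak_deriv (\<lambda>t. u t + u' t) (\<lambda>t. v t + v' t)"
  unfolding has_weak_deriv_def
proof (intro conjI allI impI)
  have [measurable]: "v \<in> borel_measurable borel" "v' \<in> borel_measurable borel"
    using assms by (auto simp: has_weak_deriv_def)
  show "(\<lambda>t. v t + v' t) \<in> borel_measurable borel" by measurable
  fix a b :: real
  have *: "set_integrable lborel {a..b} (\<lambda>t. 2 * (norm (v t))\<^sup>2 + 2 * (norm (v' t))\<^sup>2)"
    using assms by (intro set_integral_add set_integrable_mult_right) (auto simp: has_weak_deriv_def)
  show "set_integrable lborel {a..b} (\<lambda>t. (norm (v t + v' t))\<^sup>2)"
  proof (rule set_integrable_measurable_bound[OF *])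
    show "(\<lambda>t. (norm (v t + v' t))\<^sup>2) \<in> borel_measurable borel" by measurable
    fix t
    have "(norm (v t + v' t))\<^sup>2 \<le> (norm (v t) + norm (v' t))\<^sup>2"
      by (intro power_mono norm_triangle_ineq) auto
    also have "\<dots> \<le> 2 * (norm (v t))\<^sup>2 + 2 * (norm (v' t))\<^sup>2"
      using sum_squares_ge_zero[of "norm (v t) - norm (v' t)" 0]
      by (simp add: power2_eq_square algebra_simps)
    finally show "norm ((norm (v t + v' t))\<^sup>2) \<le> 2 * (norm (v t))\<^sup>2 + 2 * (norm (v' t))\<^sup>2" by simp
  qed
  assume "a \<le> b"
  then show "u b + u' b - (u a + u' a) = (LINT t:{a..b}|lborel. v t + v' t)"
    using assms has_weak_deriv_set_integrable[OF assms(1)] has_weak_deriv_set_integrable[OF assms(2)]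
    by (subst set_integral_add) (auto simp: has_weak_deriv_def algebra_simps)
qed

lemma set_integral_shift:
  fixes f :: "real \<Rightarrow> 'b::euclidean_space"
  shows "(LINT t:{a..b}|lborel. f (t + s)) = (LINT t:{a+s..b+s}|lborel. f t)"
proof -
  have "(LINT t:{a+s..b+s}|lborel. f t) =
        (LINT t|lborel. indicator {a+s..b+s} (s + 1 * t) *\<^sub>R f (s + 1 * t))"
    unfolding set_lebesgue_integral_def by (subst lborel_integral_real_affine[of 1 _ s]) auto
  also have "\<dots> = (LINT t:{a..b}|lborel. f (t + s))"
    unfolding set_lebesgue_integral_def
    by (intro Bochner_Integration.integral_cong) (auto simp: indicator_def algebra_simps)
  finally show ?thesis by simp
qed

lemma set_integrable_shift:
  fixes f :: "real \<Rightarrow> 'b::euclidean_space"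
  assumes "set_integrable lborel {a+s..b+s} f"
  shows "set_integrable lborel {a..b} (\<lambda>t. f (t + s))"
proof -
  have "integrable lborel (\<lambda>t. indicator {a+s..b+s} (s + 1 * t) *\<^sub>R f (s + 1 * t))"
    using lborel_integrable_real_affine[OF assms[unfolded set_integrable_def], of 1 s] by simp
  also have "(\<lambda>t. indicator {a+s..b+s} (s + 1 * t) *\<^sub>R f (s + 1 * t)) =
      (\<lambda>t. indicator {a..b} t *\<^sub>R f (t + s))"
    by (auto simp: indicator_def algebra_simps fun_eq_iff)
  finally show ?thesis unfolding set_integrable_def .
qed

lemma has_weak_deriv_shift:
  assumes "has_weak_deriv u v"
  shows "has_weak_deriv (\<lambda>t. u (t + s)) (\<lambda>t. v (t + s))"
  using assms unfolding has_weak_deriv_def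
  by (auto simp: set_integral_shift intro!: set_integrable_shift[where f = "\<lambda>t. (norm (v t))\<^sup>2"])

lemma has_weak_deriv_continuous:
  assumes "has_weak_deriv u v"
  shows "continuous_on S u"
proof -
  have "continuous_on {a..b} u" for a b
  proof -
    have si: "set_integrable lborel {a..x} v" for x
      by (rule has_weak_deriv_set_integrable[OF assms])
    have "continuous_on {a..b} (\<lambda>x. u a + integral {a..x} v)"
      by (intro continuous_intros indefinite_integral_continuous_1 set_borel_integral_eq_integral si)
    moreover have "u a + integral {a..x} v = u x" if "x \<in> {a..b}" for x
    proof -
      have "u x - u a = (LINT t:{a..x}|lborel. v t)"
        using assms that by (auto simp: has_weak_deriv_def)
      then show ?thesis using set_borel_integral_eq_integral(2)[OF si] by (simp add: algebra_simps)
    qed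
    ultimately show ?thesis
      using continuous_on_cong[of "{a..b}" "{a..b}" "\<lambda>x. u a + integral {a..x} v" u] by blast
  qed
  then have "isCont u x" for x
    using continuous_on_interior[of "{x-1..x+1}" u x] by (simp add: interior_atLeastAtMost_real)
  then show ?thesis by (simp add: continuous_at_imp_continuous_on)
qed

lemma has_weak_deriv_C1:
  fixes u v :: "real \<Rightarrow> 'a::euclidean_space"
  assumes "\<And>t. (u has_vector_derivative v t) (at t)" "continuous_on UNIV v"
  shows "has_weak_deriv u v"
proof -
  have c: "continuous_on S v" for S using assms(2) continuous_on_subset by blast
  have "u b - u a = (LINT t:{a..b}|lborel. v t)" if "a \<le> b" for a b
  proof -
    have "set_integrable lborel {a..b} v" by (intro borel_integrable_atLeastAtMost' c)
    moreover have "(v has_integral u b - u a) {a..b}"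
      using that assms(1)
      by (intro fundamental_theorem_of_calculus) (auto intro: has_vector_derivative_at_within)
    ultimately show ?thesis by (simp add: set_borel_integral_eq_integral integral_unique)
  qed
  moreover have "set_integrable lborel {a..b} (\<lambda>t. (norm (v t))\<^sup>2)" for a b
    by (intro borel_integrable_atLeastAtMost' continuous_intros c)
  ultimately show ?thesis
    using assms(2) by (auto simp: has_weak_deriv_def intro: borel_measurable_continuous_onI)
qed

lemma AE_zero_of_interval_integrals:
  fixes v :: "real \<Rightarrow> 'a::euclidean_space"
  assumes int: "\<And>a b. set_integrable lborel {a..b} v"
    and zero: "\<And>a b. a \<le> b \<Longrightarrow> (LINT t:{a..b}|lborel. v t) = 0"
  shows "AE t in lborel. t \<in> {c..d} \<longrightarrow> v t = 0"
proof -
  define w where "w = (\<lambda>t. indicat_real {c..d} t *\<^sub>R v t)"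
  have w: "integrable lborel w" using int[of c d] by (simp add: w_def set_integrable_def)
  have wA: "set_integrable lborel A w" if "A \<in> sets borel" for A
    using that w by (simp add: set_integrable_def integrable_mult_indicator)
  have Icc: "(LINT t:{a..b}|lborel. w t) = 0" for a b
  proof -
    have "(LINT t:{a..b}|lborel. w t) = (LINT t:{max a c..min b d}|lborel. v t)"
      unfolding set_lebesgue_integral_def w_def
      by (intro Bochner_Integration.integral_cong) (auto simp: indicator_def)
    also have "\<dots> = 0"
      by (cases "max a c \<le> min b d")
         (use zero in \<open>simp del: min.bounded_iff max.bounded_iff\<close>, simp add: set_lebesgue_integral_def)
    finally show ?thesis .
  qed
  have tot: "(LINT t|lborel. w t) = 0"
  proof -
    have "(LINT t|lborel. w t) = (LINT t:{c..d}|lborel. w t)"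
      unfolding set_lebesgue_integral_def w_def
      by (intro Bochner_Integration.integral_cong) (auto simp: indicator_def)
    then show ?thesis by (simp add: Icc)
  qed
  have "(LINT t:A|lborel. w t) = 0" if "A \<in> sets borel" for A
    using that
  proof (induction rule: borel_set_induct)
    case (compl A)
    have "(LINT t:(-A)|lborel. w t) = (LINT t|lborel. w t - indicat_real A t *\<^sub>R w t)"
      unfolding set_lebesgue_integral_def
      by (intro Bochner_Integration.integral_cong) (auto simp: indicator_def)
    also have "\<dots> = (LINT t|lborel. w t) - (LINT t:A|lborel. w t)"
      using wA[OF compl(1)] w unfolding set_lebesgue_integral_def set_integrable_def
      by (intro Bochner_Integration.integral_diff) auto
    finally show ?case using tot compl by simp
  next
    case (union f)
    have "(LINT t:(\<Union>i. f i)|lborel. w t) = (\<Sum>i. LINT t:f i|lborel. w t)"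
      using union(1,2)
      by (intro lebesgue_integral_countable_add wA)
         (auto simp: disjoint_family_on_def)
    then show ?case by (simp add: union)
  next
    case (interval a b)
    show ?case by (rule Icc)
  qed (simp add: set_lebesgue_integral_def)
  then have "AE t in lborel. w t = 0" by (intro sigma_finite_measure.density_zero[OF sigma_finite_lborel] w) auto
  then show ?thesis by (rule AE_mp) (auto intro!: AE_I2 simp: w_def)
qed

lemma has_weak_deriv_unique:
  assumes "has_weak_deriv u v" "has_weak_deriv u v'"
  shows "AE t in lborel. t \<in> {a..b} \<longrightarrow> v t = v' t"
proof -
  note si = has_weak_deriv_set_integrable[OF assms(1)] has_weak_deriv_set_integrable[OF assms(2)]
  have "AE t in lborel. t \<in> {a..b} \<longrightarrow> v t - v' t = 0"
    using assms si
    by (intro AE_zero_of_interval_integrals set_integral_diff) (auto simp: has_weak_deriv_def)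
  then show ?thesis by simp
qed

typedef (overloaded) ('a::euclidean_space) h1per =
  "{u :: real \<Rightarrow> 'a. (\<forall>t. u (t + 2 * pi) = u t) \<and> (\<exists>v. has_weak_deriv u v)}"
  morphisms h1_fun Abs_h1per
  by (rule exI[of _ "\<lambda>_. 0"]) (auto intro: has_weak_deriv_zero)

setup_lifting type_definition_h1per

lemma h1_fun_periodic: "h1_fun u (t + 2 * pi) = h1_fun u t"
  using h1_fun[of u] by auto

definition h1_deriv :: "'a::euclidean_space h1per \<Rightarrow> real \<Rightarrow> 'a" where
  "h1_deriv u = (SOME v. has_weak_deriv (h1_fun u) v)"

lemma h1_deriv: "has_weak_deriv (h1_fun u) (h1_deriv u)"
  unfolding h1_deriv_def
proof -
  have "\<exists>v. has_weak_deriv (h1_fun u) v" using h1_fun[of u] by auto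
  then show "has_weak_deriv (h1_fun u) (SOME v. has_weak_deriv (h1_fun u) v)" by (rule someI_ex)
qed

lemma h1_deriv_AE:
  "has_weak_deriv (h1_fun u) v \<Longrightarrow> AE t in lborel. t \<in> {a..b} \<longrightarrow> h1_deriv u t = v t"
  by (rule has_weak_deriv_unique[OF h1_deriv])

lemma h1_fun_continuous: "continuous_on S (h1_fun u)"
  by (rule has_weak_deriv_continuous[OF h1_deriv])

instantiation h1per :: (euclidean_space) real_vector
begin

lift_definition zero_h1per :: "'a h1per" is "\<lambda>_. 0"
  by (auto intro: has_weak_deriv_zero)

lift_definition plus_h1per :: "'a h1per \<Rightarrow> 'a h1per \<Rightarrow> 'a h1per" is "\<lambda>u v t. u t + v t"
  by (auto intro: has_weak_deriv_add)

lift_definition scaleR_h1per :: "real \<Rightarrow> 'a h1per \<Rightarrow> 'a h1per" is "\<lambda>c u t. c *\<^sub>R u t"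
  by (auto intro: has_weak_deriv_scaleR)

definition uminus_h1per :: "'a h1per \<Rightarrow> 'a h1per" where
  "- u = (-1) *\<^sub>R (u :: 'a h1per)"

definition minus_h1per :: "'a h1per \<Rightarrow> 'a h1per \<Rightarrow> 'a h1per" where
  "u - v = u + (-1) *\<^sub>R (v :: 'a h1per)"

instance
proof
  fix a b c :: "'a h1per" and r s :: real
  show "a + b + c = a + (b + c)" by transfer (simp add: algebra_simps)
  show "a + b = b + a" by transfer (simp add: algebra_simps)
  show "0 + a = a" by transfer simp
  show "- a + a = 0" unfolding uminus_h1per_def by transfer simp
  show "a - b = a + - b" unfolding uminus_h1per_def minus_h1per_def ..
  show "r *\<^sub>R (a + b) = r *\<^sub>R a + r *\<^sub>R b" by transfer (simp add: algebra_simps)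
  show "(r + s) *\<^sub>R a = r *\<^sub>R a + s *\<^sub>R a" by transfer (simp add: algebra_simps)
  show "r *\<^sub>R s *\<^sub>R a = (r * s) *\<^sub>R a" by transfer simp
  show "1 *\<^sub>R a = a" by transfer simp
qed

end

lemma h1_fun_zero [simp]: "h1_fun 0 t = 0"
  and h1_fun_add [simp]: "h1_fun (u + v) t = h1_fun u t + h1_fun v t"
  and h1_fun_scaleR [simp]: "h1_fun (c *\<^sub>R u) t = c *\<^sub>R h1_fun u t"
  by (transfer, simp)+

lemma h1_fun_uminus [simp]: "h1_fun (- u) t = - h1_fun u t"
  unfolding uminus_h1per_def h1_fun_scaleR by simp

lemma h1_fun_diff [simp]: "h1_fun (u - v) t = h1_fun u t - h1_fun v t"
  unfolding minus_h1per_def h1_fun_add h1_fun_scaleR by simp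

lemma h1_eqI: "(\<And>t. h1_fun u t = h1_fun v t) \<Longrightarrow> u = v"
  by (rule h1_fun_inject[THEN iffD1], rule ext)

lemma set_integrable_inner_L2:
  fixes f g :: "real \<Rightarrow> 'a::euclidean_space"
  assumes [measurable]: "f \<in> borel_measurable borel" "g \<in> borel_measurable borel"
    and "set_integrable lborel {a..b} (\<lambda>t. (norm (f t))\<^sup>2)"
      "set_integrable lborel {a..b} (\<lambda>t. (norm (g t))\<^sup>2)"
  shows "set_integrable lborel {a..b} (\<lambda>t. f t \<bullet> g t)"
proof (rule set_integrable_measurable_bound)
  show "set_integrable lborel {a..b} (\<lambda>t. (norm (f t))\<^sup>2 + (norm (g t))\<^sup>2)"
    by (rule set_integral_add(1)[OF assms(3,4)])
  show "(\<lambda>t. f t \<bullet> g t) \<in> borel_measurable borel" by measurable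
  fix t
  have "\<bar>f t \<bullet> g t\<bar> \<le> norm (f t) * norm (g t)" by (rule Cauchy_Schwarz_ineq2)
  also have "\<dots> \<le> (norm (f t))\<^sup>2 + (norm (g t))\<^sup>2"
  proof -
    have "2 * norm (f t) * norm (g t) \<le> (norm (f t))\<^sup>2 + (norm (g t))\<^sup>2"
      by (rule sum_squares_bound)
    moreover have "0 \<le> norm (f t) * norm (g t)" by (intro mult_nonneg_nonneg norm_ge_zero)
    ultimately show ?thesis by linarith
  qed
  finally show "norm (f t \<bullet> g t) \<le> (norm (f t))\<^sup>2 + (norm (g t))\<^sup>2"
    by (simp only: real_norm_def)
qed

lemma h1_deriv_inner_integrable:
  "set_integrable lborel {a..b} (\<lambda>t. h1_deriv u t \<bullet> h1_deriv v t)"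
  using h1_deriv[of u] h1_deriv[of v]
  by (intro set_integrable_inner_L2[of "h1_deriv u" "h1_deriv v"]) (simp_all add: has_weak_deriv_def)

lemma h1_fun_inner_integrable:
  "set_integrable lborel {a..b} (\<lambda>t. h1_fun u t \<bullet> h1_fun v t)"
  by (rule borel_integrable_atLeastAtMost', rule continuous_on_inner; rule h1_fun_continuous)

lemma h1_deriv_measurable [measurable]: "h1_deriv u \<in> borel_measurable borel"
  using h1_deriv[of u] by (auto simp: has_weak_deriv_def)

lemma h1_deriv_inner_cong:
  assumes "has_weak_deriv (h1_fun u) v"
  shows "(LINT t:{a..b}|lborel. h1_deriv u t \<bullet> h1_deriv w t) = (LINT t:{a..b}|lborel. v t \<bullet> h1_deriv w t)"
proof -
  have [measurable]: "v \<in> borel_measurable borel" using assms by (auto simp: has_weak_deriv_def)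
  have "AE t in lborel. indicat_real {a..b} t *\<^sub>R (h1_deriv u t \<bullet> h1_deriv w t) =
      indicat_real {a..b} t *\<^sub>R (v t \<bullet> h1_deriv w t)"
    using h1_deriv_AE[OF assms, of a b] by eventually_elim (auto simp: indicator_def)
  then show ?thesis
    unfolding set_lebesgue_integral_def by (intro integral_cong_AE) simp_all
qed

instantiation h1per :: (euclidean_space) real_inner
begin

definition inner_h1per :: "'a h1per \<Rightarrow> 'a h1per \<Rightarrow> real" where
  "inner_h1per u v =
     (LINT t:{0..2*pi}|lborel. h1_fun u t \<bullet> h1_fun v t) +
     (LINT t:{0..2*pi}|lborel. h1_deriv u t \<bullet> h1_deriv v t)"

definition norm_h1per :: "'a h1per \<Rightarrow> real" where
  "norm_h1per u = sqrt (inner u u)"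

definition dist_h1per :: "'a h1per \<Rightarrow> 'a h1per \<Rightarrow> real" where
  "dist_h1per u v = norm (u - v)"

definition sgn_h1per :: "'a h1per \<Rightarrow> 'a h1per" where
  "sgn_h1per u = u /\<^sub>R norm u"

definition uniformity_h1per :: "('a h1per \<times> 'a h1per) filter" where
  "uniformity_h1per = (INF e\<in>{0<..}. principal {(x, y). dist x y < e})"

definition open_h1per :: "'a h1per set \<Rightarrow> bool" where
  "open_h1per S = (\<forall>x\<in>S. \<forall>\<^sub>F (x', y) in uniformity. x' = x \<longrightarrow> y \<in> S)"

lemma h1_inner_add_left: "inner (x + y) z = inner x z + inner y (z :: 'a h1per)"
proof -
  have "has_weak_deriv (h1_fun (x + y)) (\<lambda>t. h1_deriv x t + h1_deriv y t)"
    using has_weak_deriv_add[OF h1_deriv h1_deriv, of x y] by (simp add: plus_h1per.rep_eq)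
  note [simp] = h1_deriv_inner_cong[OF this]
  show ?thesis
    by (simp add: inner_h1per_def inner_add_left set_integral_add
        h1_fun_inner_integrable h1_deriv_inner_integrable)
qed

lemma h1_inner_scaleR_left: "inner (r *\<^sub>R x) y = r * inner x (y :: 'a h1per)"
proof -
  have "has_weak_deriv (h1_fun (r *\<^sub>R x)) (\<lambda>t. r *\<^sub>R h1_deriv x t)"
    using has_weak_deriv_scaleR[OF h1_deriv, of r x] by (simp add: scaleR_h1per.rep_eq)
  note [simp] = h1_deriv_inner_cong[OF this]
  show ?thesis by (simp add: inner_h1per_def distrib_left)
qed

lemma set_integral_inner_self_nonneg: "0 \<le> (LINT t:{a..b::real}|lborel. f t \<bullet> (f t :: 'a))"
  unfolding set_lebesgue_integral_def by (intro Bochner_Integration.integral_nonneg) auto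

lemma h1_inner_eq_zero_iff: "inner x x = 0 \<longleftrightarrow> x = (0 :: 'a h1per)"
proof
  assume "inner x x = 0"
  then have "(LINT t:{0..2*pi}|lborel. h1_fun x t \<bullet> h1_fun x t) = 0"
    using set_integral_inner_self_nonneg[of 0 "2*pi" "h1_fun x"]
      set_integral_inner_self_nonneg[of 0 "2*pi" "h1_deriv x"] by (simp add: inner_h1per_def)
  then have "integral {0..2*pi} (\<lambda>t. h1_fun x t \<bullet> h1_fun x t) = 0"
    by (simp add: set_borel_integral_eq_integral(2)[OF h1_fun_inner_integrable])
  moreover have "continuous_on {0..2*pi} (\<lambda>t. h1_fun x t \<bullet> h1_fun x t)"
    by (rule continuous_on_inner; rule h1_fun_continuous)
  ultimately have "\<forall>t\<in>{0..2*pi}. h1_fun x t \<bullet> h1_fun x t = 0"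
    using integral_eq_0_iff[of 0 "2*pi" "\<lambda>t. h1_fun x t \<bullet> h1_fun x t"] by simp
  then have 0: "h1_fun x t = 0" if "t \<in> {0..2*pi}" for t
    using that by simp
  interpret periodic_fun_simple "h1_fun x" "2*pi"
    by standard (rule h1_fun_periodic)
  have "h1_fun x t = 0" for t
  proof -
    define k where "k = \<lfloor>t / (2*pi)\<rfloor>"
    have eq: "h1_fun x t = h1_fun x (t - of_int k * (2*pi))" by (rule minus_of_int[symmetric])
    have "of_int k * (2*pi) \<le> t"
    proof -
      have "of_int k \<le> t / (2*pi)" unfolding k_def by simp
      then show ?thesis by (simp add: field_simps)
    qed
    moreover have "t \<le> (of_int k + 1) * (2*pi)"
    proof -
      have "t / (2*pi) \<le> of_int k + 1" unfolding k_def by linarith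
      then show ?thesis by (simp add: field_simps)
    qed
    ultimately have "t - of_int k * (2*pi) \<in> {0..2*pi}"
      by (simp add: distrib_right)
    from 0[OF this] eq show ?thesis by simp
  qed
  then show "x = 0" by (metis h1_eqI h1_fun_zero)
next
  assume "x = 0"
  moreover have "inner (0 :: 'a h1per) 0 = 0"
  proof -
    have "has_weak_deriv (h1_fun (0 :: 'a h1per)) (\<lambda>t. 0)"
      using has_weak_deriv_zero by (simp add: zero_h1per.rep_eq)
    from h1_deriv_inner_cong[OF this] show ?thesis
      by (simp add: inner_h1per_def set_lebesgue_integral_def)
  qed
  ultimately show "inner x x = 0" by simp
qed

instance
proof
  fix x y z :: "'a h1per" and r :: real and S :: "'a h1per set"
  show "dist x y = norm (x - y)" by (rule dist_h1per_def)
  show "sgn x = x /\<^sub>R norm x" by (rule sgn_h1per_def)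
  show "uniformity = (INF e\<in>{0<..}. principal {(x::'a h1per, y). dist x y < e})"
    by (rule uniformity_h1per_def)
  show "open S = (\<forall>x\<in>S. \<forall>\<^sub>F (x', y) in uniformity. x' = x \<longrightarrow> y \<in> S)" by (rule open_h1per_def)
  show "norm x = sqrt (inner x x)" by (rule norm_h1per_def)
  show "inner x y = inner y x" by (simp add: inner_h1per_def inner_commute)
  show "inner (x + y) z = inner x z + inner y z" by (rule h1_inner_add_left)
  show "inner (r *\<^sub>R x) y = r * inner x y" by (rule h1_inner_scaleR_left)
  show "0 \<le> inner x x" by (simp add: inner_h1per_def set_integral_inner_self_nonneg)
  show "inner x x = 0 \<longleftrightarrow> x = 0" by (rule h1_inner_eq_zero_iff)
qed

end

lemma h1_shift_closed:
  assumes "(\<forall>t. u (t + 2 * pi) = u t) \<and> (\<exists>v. has_weak_deriv u v)"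
  shows "(\<forall>t. u (t + 2 * pi + \<theta>) = u (t + \<theta>)) \<and> (\<exists>v. has_weak_deriv (\<lambda>t. u (t + \<theta>)) v)"
proof -
  have "u (t + 2 * pi + \<theta>) = u (t + \<theta>)" for t
  proof -
    have "u (t + 2 * pi + \<theta>) = u ((t + \<theta>) + 2 * pi)" by (simp add: add_ac)
    also have "\<dots> = u (t + \<theta>)" using assms by blast
    finally show ?thesis .
  qed
  then show ?thesis using assms has_weak_deriv_shift by blast
qed

text \<open>The \<open>S\<^sup>1\<close>-action; the group \<open>\<real>/2\<pi>\<int>\<close> is represented by real parameters \<open>\<theta>\<close>.\<close>

lift_definition h1_shift :: "real \<Rightarrow> 'a::euclidean_space h1per \<Rightarrow> 'a h1per" is
  "\<lambda>\<theta> u t. u (t + \<theta>)"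
  by (rule h1_shift_closed)


section \<open>Gradients, Hessians, \<open>C\<^sup>2\<close> functions, smooth domains\<close>

definition grad :: "('a::real_inner \<Rightarrow> real) \<Rightarrow> 'a \<Rightarrow> 'a" where
  "grad f x = (THE D. GDERIV f x :> D)"

text \<open>The Hessian is the derivative of the gradient, as a linear operator.\<close>

definition hessian :: "('a::real_inner \<Rightarrow> real) \<Rightarrow> 'a \<Rightarrow> 'a \<Rightarrow> 'a" where
  "hessian f x = frechet_derivative (grad f) (at x)"

definition nondegenerate_critical_point :: "('a::real_inner \<Rightarrow> real) \<Rightarrow> 'a \<Rightarrow> bool" where
  "nondegenerate_critical_point f x \<longleftrightarrow> GDERIV f x :> 0 \<and> bij (hessian f x)"

definition C2_on :: "'a::real_normed_vector set \<Rightarrow> ('a \<Rightarrow> real) \<Rightarrow> bool" where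
  "C2_on S f \<longleftrightarrow>
     (\<exists>(f' :: 'a \<Rightarrow> 'a \<Rightarrow>\<^sub>L real) (f'' :: 'a \<Rightarrow> 'a \<Rightarrow>\<^sub>L 'a \<Rightarrow>\<^sub>L real).
        (\<forall>x\<in>S. (f has_derivative blinfun_apply (f' x)) (at x)) \<and>
        (\<forall>x\<in>S. (f' has_derivative blinfun_apply (f'' x)) (at x)) \<and>
        continuous_on S f'')"

definition smooth_real :: "(real \<Rightarrow> real) \<Rightarrow> bool" where
  "smooth_real \<phi> \<longleftrightarrow> (\<forall>n x. (deriv ^^ n) \<phi> differentiable (at x))"

text \<open>
  An open connected set which near each of its boundary points is, in suitable orthonormal
  coordinates, the region strictly above the graph of a \<open>C\<^sup>\<infinity>\<close> function. The boundary may be empty.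
\<close>

definition smooth_domain :: "(real^2) set \<Rightarrow> bool" where
  "smooth_domain \<Omega> \<longleftrightarrow>
     open \<Omega> \<and> connected \<Omega> \<and> \<Omega> \<noteq> {} \<and>
     (\<forall>p\<in>frontier \<Omega>. \<exists>\<rho>>0. \<exists>(T :: real^2 \<Rightarrow> real^2) \<phi>. orthogonal_transformation T \<and> smooth_real \<phi> \<and>
        \<Omega> \<inter> ball p \<rho> = {x \<in> ball p \<rho>. T x $ 2 > \<phi> (T x $ 1)})"


section \<open>Point vortex systems\<close>

definition Jmat :: "real^2^2" where
  "Jmat = vector [vector [0, 1], vector [-1, 0]]"

definition config_space :: "(real^2) set \<Rightarrow> ((real^2)^'n) set" where
  "config_space A = {z. (\<forall>j. z $ j \<in> A) \<and> (\<forall>j k. j \<noteq> k \<longrightarrow> z $ j \<noteq> z $ k)}"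

definition ham_H0 :: "('n::finite \<Rightarrow> real) \<Rightarrow> (real^2)^'n \<Rightarrow> real" where
  "ham_H0 \<Gamma> z = - (1 / (2 * pi)) *
     (\<Sum>j\<in>UNIV. \<Sum>k\<in>UNIV - {j}. \<Gamma> j * \<Gamma> k * ln (norm (z $ j - z $ k)))"

text \<open>
  \<open>g\<close> is a total function here, but only its values on \<open>\<Omega> \<times> \<Omega>\<close> matter: solutions stay in the open set \<open>\<Omega>\<close>.
\<close>

definition ham_F :: "('n::finite \<Rightarrow> real) \<Rightarrow> (real^2 \<Rightarrow> real^2 \<Rightarrow> real) \<Rightarrow> (real^2)^'n \<Rightarrow> real" where
  "ham_F \<Gamma> g z = (\<Sum>j\<in>UNIV. \<Sum>k\<in>UNIV. \<Gamma> j * \<Gamma> k * g (z $ j) (z $ k))"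

definition ham_H :: "('n::finite \<Rightarrow> real) \<Rightarrow> (real^2 \<Rightarrow> real^2 \<Rightarrow> real) \<Rightarrow> (real^2)^'n \<Rightarrow> real" where
  "ham_H \<Gamma> g z = ham_H0 \<Gamma> z - ham_F \<Gamma> g z"

definition partial_grad :: "'n \<Rightarrow> ((real^2)^'n \<Rightarrow> real) \<Rightarrow> (real^2)^'n \<Rightarrow> real^2" where
  "partial_grad k f z = grad (\<lambda>x. f (\<chi> j. if j = k then x else z $ j)) (z $ k)"

text \<open>
  \<open>z\<close> solves \<open>\<Gamma>\<^sub>k z\<^sub>k' = J \<nabla>\<^bsub>z\<^sub>k\<^esub> K(z)\<close>, \<open>k = 1,\<dots>,N\<close>, on all of \<open>\<real>\<close> and stays in the configuration space of \<open>A\<close>.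
\<close>

definition vortex_solution ::
  "('n::finite \<Rightarrow> real) \<Rightarrow> (real^2) set \<Rightarrow> ((real^2)^'n \<Rightarrow> real) \<Rightarrow> (real \<Rightarrow> (real^2)^'n) \<Rightarrow> bool" where
  "vortex_solution \<Gamma> A K z \<longleftrightarrow>
     (\<forall>t. z t \<in> config_space A \<and>
        (\<forall>k. \<exists>v. ((\<lambda>s. z s $ k) has_vector_derivative v) (at t) \<and>
                 \<Gamma> k *\<^sub>R v = Jmat *v partial_grad k K (z t)))"

definition HS_solution where
  "HS_solution \<Gamma> \<Omega> g z \<longleftrightarrow> vortex_solution \<Gamma> \<Omega> (ham_H \<Gamma> g) z"

definition HS0_solution where
  "HS0_solution \<Gamma> z \<longleftrightarrow> vortex_solution \<Gamma> UNIV (ham_H0 \<Gamma>) z"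

definition is_periodic :: "(real \<Rightarrow> 'a) \<Rightarrow> bool" where
  "is_periodic z \<longleftrightarrow> (\<exists>T>0. \<forall>t. z (t + T) = z t)"

definition matrix_exp :: "real^'m^'m \<Rightarrow> real^'m^'m" where
  "matrix_exp A = (\<Sum>n. (1 / fact n) *\<^sub>R (((**) A ^^ n) (mat 1)))"

definition rotating :: "real \<Rightarrow> (real^2)^'n \<Rightarrow> real \<Rightarrow> (real^2)^'n" where
  "rotating \<omega> z t = (\<chi> k. matrix_exp ((- \<omega> * t) *\<^sub>R Jmat) *v (z $ k))"

definition relative_equilibrium :: "('n::finite \<Rightarrow> real) \<Rightarrow> real \<Rightarrow> (real^2)^'n \<Rightarrow> bool" where
  "relative_equilibrium \<Gamma> \<omega> z \<longleftrightarrow>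
     \<omega> \<noteq> 0 \<and> z \<in> config_space UNIV \<and> HS0_solution \<Gamma> (rotating \<omega> z)"

definition M_mult :: "('n \<Rightarrow> real) \<Rightarrow> (real^2)^'n \<Rightarrow> (real^2)^'n" where
  "M_mult \<Gamma> w = (\<chi> k. \<Gamma> k *\<^sub>R (w $ k))"

definition J_mult :: "(real^2)^'n \<Rightarrow> (real^2)^'n" where
  "J_mult w = (\<chi> k. Jmat *v (w $ k))"

definition linearized_periodic_solutions ::
  "('n::finite \<Rightarrow> real) \<Rightarrow> real \<Rightarrow> (real^2)^'n \<Rightarrow> (real \<Rightarrow> (real^2)^'n) set" where
  "linearized_periodic_solutions \<Gamma> \<omega> z =
     {w. (\<forall>t. w (t + 2 * pi / \<bar>\<omega>\<bar>) = w t) \<and>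
         (\<forall>t. \<exists>v. (w has_vector_derivative v) (at t) \<and>
                  M_mult \<Gamma> v = J_mult (hessian (ham_H0 \<Gamma>) (rotating \<omega> z t) (w t)))}"

text \<open>The linear space \<open>S\<close> of functions has a basis of \<open>d\<close> elements.\<close>

definition has_fun_dim :: "(real \<Rightarrow> 'a::real_vector) set \<Rightarrow> nat \<Rightarrow> bool" where
  "has_fun_dim S d \<longleftrightarrow>
     (\<exists>b :: nat \<Rightarrow> real \<Rightarrow> 'a.
        (\<forall>i<d. b i \<in> S) \<and>
        (\<forall>c :: nat \<Rightarrow> real. (\<forall>t. (\<Sum>i<d. c i *\<^sub>R b i t) = 0) \<longrightarrow> (\<forall>i<d. c i = 0)) \<and>
        (\<forall>w\<in>S. \<exists>c :: nat \<Rightarrow> real. \<forall>t. w t = (\<Sum>i<d. c i *\<^sub>R b i t)))"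

definition nondegenerate_relative_equilibrium ::
  "('n::finite \<Rightarrow> real) \<Rightarrow> real \<Rightarrow> (real^2)^'n \<Rightarrow> bool" where
  "nondegenerate_relative_equilibrium \<Gamma> \<omega> z \<longleftrightarrow>
     relative_equilibrium \<Gamma> \<omega> z \<and> has_fun_dim (linearized_periodic_solutions \<Gamma> \<omega> z) 3"

lemma J_power: "((**) (c *\<^sub>R Jmat) ^^ n) (mat 1) =
    (fact n * cos_coeff n * c ^ n) *\<^sub>R mat 1 + (fact n * sin_coeff n * c ^ n) *\<^sub>R Jmat"
proof (induction n)
  case 0
  show ?case by simp
next
  case (Suc n)
  have "(c *\<^sub>R Jmat) ** (a *\<^sub>R mat 1 + b *\<^sub>R Jmat) = (c * a) *\<^sub>R Jmat - (c * b) *\<^sub>R mat 1" for a b :: real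
    by (simp add: Jmat_def vec_eq_iff matrix_matrix_mult_def mat_def sum_2 forall_2)
  then have "((**) (c *\<^sub>R Jmat) ^^ Suc n) (mat 1) =
      (c * (fact n * cos_coeff n * c ^ n)) *\<^sub>R Jmat - (c * (fact n * sin_coeff n * c ^ n)) *\<^sub>R mat 1"
    by (simp add: Suc.IH)
  moreover have "fact (Suc n) * cos_coeff (Suc n) * c ^ Suc n = - (c * (fact n * sin_coeff n * c ^ n))"
    "fact (Suc n) * sin_coeff (Suc n) * c ^ Suc n = c * (fact n * cos_coeff n * c ^ n)"
    by (simp_all add: cos_coeff_Suc sin_coeff_Suc del: of_nat_Suc)
  ultimately show ?case by (metis diff_conv_add_uminus add.commute scaleR_minus_left)
qed

lemma matrix_exp_J: "matrix_exp (c *\<^sub>R Jmat) = cos c *\<^sub>R mat 1 + sin c *\<^sub>R Jmat"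
proof -
  have "(\<lambda>n. (cos_coeff n *\<^sub>R c ^ n) *\<^sub>R (mat 1 :: real^2^2) + (sin_coeff n *\<^sub>R c ^ n) *\<^sub>R Jmat)
      sums (cos c *\<^sub>R mat 1 + sin c *\<^sub>R Jmat)"
    by (intro sums_add bounded_linear.sums[OF bounded_linear_scaleR_left] cos_converges sin_converges)
  then show ?thesis
    unfolding matrix_exp_def J_power by (simp add: sums_iff scaleR_add_right)
qed

lemma rotating_eq: "rotating \<omega> z t = (\<chi> k. cos (\<omega> * t) *\<^sub>R (z $ k) - sin (\<omega> * t) *\<^sub>R (Jmat *v (z $ k)))"
  by (simp add: rotating_def matrix_exp_J[of "- (\<omega> * t)", simplified] vec_eq_iff
      matrix_vector_mult_diff_rdistrib scaleR_matrix_vector_assoc[symmetric])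

text \<open>
  The relative equilibrium as an element of \<open>H\<^sup>1\<close>. It is \<open>2\<pi>\<close>-periodic only for \<open>\<omega> \<in> \<int>\<close>; it is used
  for \<open>\<bar>\<omega>\<bar> = 1\<close> only, where the lemma below applies.
\<close>

definition rotating_h1 :: "real \<Rightarrow> (real^2)^'n::finite \<Rightarrow> ((real^2)^'n) h1per" where
  "rotating_h1 \<omega> z = Abs_h1per (rotating \<omega> z)"

lemma h1_fun_rotating_h1:
  assumes "\<bar>\<omega>\<bar> = 1"
  shows "h1_fun (rotating_h1 \<omega> z) = rotating \<omega> z"
proof -
  define Jz where "Jz = J_mult z"
  have eq: "rotating \<omega> z = (\<lambda>t. cos (\<omega> * t) *\<^sub>R z - sin (\<omega> * t) *\<^sub>R Jz)"
    by (simp add: fun_eq_iff rotating_eq vec_eq_iff Jz_def J_mult_def)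
  have om: "\<omega> = 1 \<or> \<omega> = -1" using assms by auto
  have per: "rotating \<omega> z (t + 2 * pi) = rotating \<omega> z t" for t
    using om by (auto simp: eq algebra_simps cos_add sin_add cos_diff sin_diff)
  have "has_weak_deriv (rotating \<omega> z) (\<lambda>t. (- \<omega> * sin (\<omega> * t)) *\<^sub>R z - (\<omega> * cos (\<omega> * t)) *\<^sub>R Jz)"
    unfolding eq
    by (intro has_weak_deriv_C1 continuous_intros)
       (auto intro!: derivative_eq_intros simp: has_real_derivative_iff_has_vector_derivative[symmetric] algebra_simps)
  then show ?thesis
    unfolding rotating_h1_def using per by (intro Abs_h1per_inverse) auto
qed

definition rescaled :: "real^2 \<Rightarrow> real \<Rightarrow> (real \<Rightarrow> (real^2)^'n) \<Rightarrow> real \<Rightarrow> (real^2)^'n" where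
  "rescaled a r u t = (\<chi> k. a + r *\<^sub>R (u (t / r\<^sup>2) $ k))"

end

theory Submission
  imports Defs
begin

text \<open>
  For \<open>z = a0 + r u(t / r\<^sup>2)\<close> the system becomes \<open>u' = M\<^sup>-\<^sup>1 J (\<nabla>H\<^sub>0(u) - r \<nabla>F(a0 + r u))\<close>, a perturbation of the
  whole-plane system whose linearisation at \<open>Z\<close> has a three-dimensional periodic kernel: one direction from the time
  shift and two from translations. The time shift is removed by a phase condition, and an
  additional drift term with a scalar unknown \<open>l\<close> makes up for the equation lost to conservation of energy; on periodic
  solutions conservation of energy gives \<open>l = 0\<close> back. Since the centre of vorticity changes
  only by the integrated total force of \<open>F\<close>, the translational part of the periodicity condition can be replaced by the
  vanishing of this integral divided by \<open>r\<close>, which tends to \<open>\<Gamma>\<close> times the Hessian of \<open>h\<close> applied to the integrated centre of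
  vorticity. The boundary value problem so obtained is nondegenerate at \<open>r = 0\<close>, and the contraction principle
  yields a locally unique solution that depends continuously differentiably on \<open>r\<close>. For \<open>(b)\<close>, a time shift brings any solution near
  the orbit of \<open>Z\<close> into the right phase, and local uniqueness applies.
\<close>

section \<open>Continuously differentiable maps between normed spaces\<close>

text \<open>The parameter value \<open>r = 0\<close> is singular: the rescaled total force carries a
  factor \<open>1 / r\<close> while \<open>gF\<close> is only C^1, so the implicit function theorem
  does not apply directly at 0. What survives the limit is that the Lipschitz constant of the
  perturbation tends to 0. This yields a contraction that is uniform in \<open>r\<close>;
  differentiability in \<open>r\<close> is asked for at \<open>r > 0\<close> only, and at 0 there is
  just convergence. The unknowns are bounded continuous functions, on which superposition with a C^1
  map is again C^1. The bounded linear map \<open>h1_prim\<close>, fed with an initial value and a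
  velocity, then carries convergence and C^1 dependence over to H^1. Keeping the integrated total
  force as a component of the state makes a nonlocal condition an ordinary boundary condition. The
  initial data together with \<open>l\<close> form a finite-dimensional unknown with equally many
  boundary equations, so nondegeneracy reduces to injectivity of a shooting matrix, and only true
  solutions of the linearised system have to be examined.\<close>

lemma uniform_nbhd_compact:
  fixes f :: "'a::metric_space \<Rightarrow> 'b::metric_space"
  assumes K: "compact K" "K \<subseteq> U" and U: "open U" "continuous_on U f" and "e > 0"
  obtains d where "d > 0" "\<And>x y. x \<in> K \<Longrightarrow> dist x y < d \<Longrightarrow> y \<in> U \<and> dist (f x) (f y) < e"
proof -
  \<comment> \<open>The Lebesgue number of a cover by open subsets of \<open>U\<close> on which
    \<open>f\<close> oscillates by less than \<open>e\<close> serves as \<open>d\<close>.\<close>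
  define \<G> where "\<G> = {G. open G \<and> G \<subseteq> U \<and> (\<forall>y\<in>G. \<forall>y'\<in>G. dist (f y) (f y') < e)}"
  have cover: "K \<subseteq> \<Union>\<G>"
  proof
    fix x assume "x \<in> K"
    then have x: "x \<in> U" using K by auto
    define G where "G = U \<inter> f -` ball (f x) (e/2)"
    have "open G" unfolding G_def by (rule continuous_open_preimage) (use U in auto)
    moreover have "dist (f y) (f y') < e" if "y \<in> G" "y' \<in> G" for y y'
      using that dist_triangle_half_r[of "f x" "f y" e "f y'"] by (auto simp: G_def)
    ultimately have "G \<in> \<G>" by (auto simp: \<G>_def G_def)
    moreover have "x \<in> G" using x \<open>e > 0\<close> by (auto simp: G_def)
    ultimately show "x \<in> \<Union>\<G>" by blast
  qed
  obtain d where d: "0 < d" "\<And>x. x \<in> K \<Longrightarrow> \<exists>G\<in>\<G>. ball x d \<subseteq> G"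
    using Heine_Borel_lemma[OF K(1) cover] unfolding \<G>_def by blast
  show ?thesis
  proof
    show "d > 0" by fact
    fix x y assume "x \<in> K" "dist x y < d"
    then obtain G where "G \<in> \<G>" "ball x d \<subseteq> G" using d by blast
    moreover have "x \<in> ball x d" "y \<in> ball x d" using d \<open>dist x y < d\<close> by auto
    ultimately show "y \<in> U \<and> dist (f x) (f y) < e" unfolding \<G>_def by blast
  qed
qed

text \<open>The derivative is taken in the full neighbourhood filter although \<open>S\<close> need
  not be open; this matters for the sets \<open>bcf_into K\<close> below. Continuity of the
  derivative refers to the operator norm.\<close>

definition C1_map :: "'a::real_normed_vector set \<Rightarrow> ('a \<Rightarrow> 'b::real_normed_vector) \<Rightarrow> bool" where
  "C1_map S f \<longleftrightarrow>
     (\<exists>f'. (\<forall>x\<in>S. (f has_derivative blinfun_apply (f' x)) (at x)) \<and> continuous_on S f')"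

lemma C1_mapE:
  assumes "C1_map S f"
  obtains f' where "\<And>x. x \<in> S \<Longrightarrow> (f has_derivative blinfun_apply (f' x)) (at x)" "continuous_on S f'"
  using assms unfolding C1_map_def by blast

lemma C1_mapI:
  assumes "\<And>x. x \<in> S \<Longrightarrow> (f has_derivative blinfun_apply (f' x)) (at x)" "continuous_on S f'"
  shows "C1_map S f"
  using assms unfolding C1_map_def by blast

lemma C1_map_subset: "C1_map S f \<Longrightarrow> T \<subseteq> S \<Longrightarrow> C1_map T f"
  unfolding C1_map_def using continuous_on_subset by blast

lemma C1_map_continuous_on: "C1_map S f \<Longrightarrow> continuous_on S f"
  by (metis C1_mapE continuous_at_imp_continuous_on has_derivative_continuous)

lemma C1_map_const [simp]: "C1_map S (\<lambda>x. c)"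
  by (rule C1_mapI[of _ _ "\<lambda>_. 0"]) (auto simp: zero_blinfun.rep_eq)

lemma C1_map_bounded_linear:
  assumes "bounded_linear f" shows "C1_map S f"
  by (rule C1_mapI[of _ _ "\<lambda>_. Blinfun f"])
     (auto simp: bounded_linear_Blinfun_apply assms intro: bounded_linear_imp_has_derivative)

lemma C1_map_ident [simp]: "C1_map S (\<lambda>x. x)"
  by (rule C1_map_bounded_linear) (rule bounded_linear_ident)

lemma C1_map_compose:
  assumes f: "C1_map S f" and g: "C1_map T g" and "\<And>x. x \<in> S \<Longrightarrow> f x \<in> T"
  shows "C1_map S (\<lambda>x. g (f x))"
proof -
  obtain f' where f': "\<And>x. x \<in> S \<Longrightarrow> (f has_derivative blinfun_apply (f' x)) (at x)" "continuous_on S f'"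
    using f by (rule C1_mapE) blast
  obtain g' where g': "\<And>x. x \<in> T \<Longrightarrow> (g has_derivative blinfun_apply (g' x)) (at x)" "continuous_on T g'"
    using g by (rule C1_mapE) blast
  have "((\<lambda>x. g (f x)) has_derivative blinfun_apply (g' (f x) o\<^sub>L f' x)) (at x)" if "x \<in> S" for x
    using has_derivative_compose[OF f'(1) g'(1)] that assms by (simp add: blinfun_compose.rep_eq o_def)
  moreover have "continuous_on S (\<lambda>x. g' (f x) o\<^sub>L f' x)"
    by (intro continuous_intros f' continuous_on_compose2[OF g'(2) C1_map_continuous_on[OF f]])
       (use assms in auto)
  ultimately show ?thesis by (rule C1_mapI)
qed

lemma C1_map_linear_compose: "bounded_linear g \<Longrightarrow> C1_map S f \<Longrightarrow> C1_map S (\<lambda>x. g (f x))"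
  by (rule C1_map_compose[of S f UNIV g]) (auto intro: C1_map_bounded_linear)

lemma C1_map_add:
  assumes "C1_map S f" "C1_map S g" shows "C1_map S (\<lambda>x. f x + g x)"
proof -
  obtain f' where f': "\<And>x. x \<in> S \<Longrightarrow> (f has_derivative blinfun_apply (f' x)) (at x)" "continuous_on S f'"
    using assms(1) by (rule C1_mapE) blast
  obtain g' where g': "\<And>x. x \<in> S \<Longrightarrow> (g has_derivative blinfun_apply (g' x)) (at x)" "continuous_on S g'"
    using assms(2) by (rule C1_mapE) blast
  show ?thesis
    by (rule C1_mapI[of _ _ "\<lambda>x. f' x + g' x"])
       (auto intro!: continuous_intros f' g' derivative_eq_intros f'(1)[THEN has_derivative_eq_rhs]
         simp: blinfun.add_left)
qed

lemma C1_map_bilinear: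
  assumes "bounded_bilinear p" "C1_map S f" "C1_map S g"
  shows "C1_map S (\<lambda>x. p (f x) (g x))"
proof -
  interpret p: bounded_bilinear p by fact
  obtain f' where f': "\<And>x. x \<in> S \<Longrightarrow> (f has_derivative blinfun_apply (f' x)) (at x)" "continuous_on S f'"
    using assms(2) by (rule C1_mapE) blast
  obtain g' where g': "\<And>x. x \<in> S \<Longrightarrow> (g has_derivative blinfun_apply (g' x)) (at x)" "continuous_on S g'"
    using assms(3) by (rule C1_mapE) blast
  define D where "D x = (p.prod_right (f x) o\<^sub>L g' x) + (p.prod_left (g x) o\<^sub>L f' x)" for x
  have "((\<lambda>x. p (f x) (g x)) has_derivative blinfun_apply (D x)) (at x)" if "x \<in> S" for x
    using p.FDERIV[OF f'(1)[OF that] g'(1)[OF that]]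
    by (rule has_derivative_eq_rhs) (auto simp: D_def blinfun.add_left p.prod_right.rep_eq p.prod_left.rep_eq)
  moreover have "continuous_on S D" unfolding D_def
    by (intro continuous_intros bounded_linear.continuous_on[OF p.bounded_linear_prod_right]
        bounded_linear.continuous_on[OF p.bounded_linear_prod_left]
        C1_map_continuous_on assms f' g')
  ultimately show ?thesis by (rule C1_mapI)
qed

lemmas C1_map_scaleR = C1_map_bilinear[OF bounded_bilinear_scaleR]
lemmas C1_map_inner = C1_map_bilinear[OF bounded_bilinear_inner]
lemmas C1_map_uminus = C1_map_linear_compose[OF bounded_linear_minus[OF bounded_linear_ident]]

lemma C1_map_diff: "C1_map S f \<Longrightarrow> C1_map S g \<Longrightarrow> C1_map S (\<lambda>x. f x - g x)"
  using C1_map_add[of S f "\<lambda>x. - g x"] C1_map_uminus[of S g] by simp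

lemma C1_map_sum: "(\<And>i. i \<in> I \<Longrightarrow> C1_map S (f i)) \<Longrightarrow> C1_map S (\<lambda>x. \<Sum>i\<in>I. f i x)"
  by (induction I rule: infinite_finite_induct) (auto intro: C1_map_add)

lemma C1_map_Pair:
  assumes "C1_map S f" "C1_map S g" shows "C1_map S (\<lambda>x. (f x, g x))"
proof -
  have "C1_map S (\<lambda>x. (f x, 0) + (0, g x))"
    by (intro C1_map_add C1_map_linear_compose[OF _ assms(1)] C1_map_linear_compose[OF _ assms(2)])
       (auto intro!: bounded_linear_intros bounded_linear_Pair bounded_linear_zero bounded_linear_ident)
  then show ?thesis by simp
qed

lemma C1_map_inverse:
  fixes f :: "'a::real_normed_vector \<Rightarrow> real"
  assumes f: "C1_map S f" "\<And>x. x \<in> S \<Longrightarrow> f x \<noteq> 0"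
  shows "C1_map S (\<lambda>x. inverse (f x))"
proof (rule C1_map_compose[OF f(1), where T = "{y. y \<noteq> 0}"])
  show "C1_map {y::real. y \<noteq> 0} inverse"
  proof (rule C1_mapI[of _ _ "\<lambda>y. blinfun_mult_left (- (inverse y * inverse y))"])
    show "(inverse has_derivative blinfun_apply (blinfun_mult_left (- (inverse x * inverse x)))) (at x)"
      if "x \<in> {y. y \<noteq> 0}" for x :: real
      using that by (auto intro!: derivative_eq_intros simp: fun_eq_iff)
    show "continuous_on {y. y \<noteq> 0} (\<lambda>y::real. blinfun_mult_left (- (inverse y * inverse y)))"
      by (intro bounded_linear.continuous_on[OF bounded_linear_blinfun_mult_left] continuous_intros) auto
  qed
qed (use f in auto)

text \<open>A vector is the sum of its embedded components, so calculus for vector-valued maps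
  reduces to sums of bounded linear images.\<close>

lemma bounded_linear_axis: "bounded_linear (axis i :: 'b::real_normed_vector \<Rightarrow> 'b^'i::finite)"
proof (rule bounded_linear_intro[of _ 1])
  show "norm (axis i x :: 'b^'i) \<le> norm x * 1" for x
    by (simp add: norm_vec_def axis_def L2_set_def if_distrib[of norm] if_distrib[of "\<lambda>y. y\<^sup>2"]
        cong: if_cong)
qed (auto simp: axis_def vec_eq_iff)

lemma C1_map_vec:
  fixes f :: "'i::finite \<Rightarrow> 'a::real_normed_vector \<Rightarrow> 'b::real_normed_vector"
  assumes "\<And>i. C1_map S (f i)" shows "C1_map S (\<lambda>x. \<chi> i. f i x)"
proof -
  have "C1_map S (\<lambda>x. \<Sum>i\<in>UNIV. axis i (f i x))"
    by (intro C1_map_sum C1_map_linear_compose[OF bounded_linear_axis] assms)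
  moreover have "(\<lambda>x. \<Sum>i\<in>UNIV. axis i (f i x)) = (\<lambda>x. \<chi> i. f i x)"
    by (simp add: fun_eq_iff vec_eq_iff axis_def if_distrib cong: if_cong)
  ultimately show ?thesis by simp
qed

text \<open>The mean value inequality is applied to \<open>f - f' x\<close> on a ball whose radius
  is uniform in \<open>x\<close>, since \<open>f'\<close> varies little near the compact set
  \<open>K\<close>. Comparing two arbitrary points of the ball, instead of one point with the
  centre, is what contraction estimates require.\<close>

lemma strict_derivative_compact:
  assumes K: "compact K" "K \<subseteq> U" and "open U"
    and f': "\<And>x. x \<in> U \<Longrightarrow> (f has_derivative blinfun_apply (f' x)) (at x)" "continuous_on U f'"
    and "e > 0"
  obtains d where "d > 0" "\<forall>x\<in>K. ball x d \<subseteq> U"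
    "\<forall>x\<in>K. \<forall>y\<in>ball x d. \<forall>y'\<in>ball x d. norm (f y - f y' - f' x (y - y')) \<le> e * norm (y - y')"
proof -
  obtain d where d: "d > 0" "\<And>x y. x \<in> K \<Longrightarrow> dist x y < d \<Longrightarrow> y \<in> U \<and> dist (f' x) (f' y) < e"
    using uniform_nbhd_compact[OF K \<open>open U\<close> f'(2) \<open>e > 0\<close>] by blast
  show ?thesis
  proof
    show "d > 0" by fact
    show "\<forall>x\<in>K. ball x d \<subseteq> U" using d by auto
    show "\<forall>x\<in>K. \<forall>y\<in>ball x d. \<forall>y'\<in>ball x d. norm (f y - f y' - f' x (y - y')) \<le> e * norm (y - y')"
    proof (intro ballI)
    fix x y y' assume x: "x \<in> K" and y: "y \<in> ball x d" "y' \<in> ball x d"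
    have "norm ((f y - f' x y) - (f y' - f' x y')) \<le> e * norm (y - y')"
    proof (rule differentiable_bound[where S = "ball x d" and f' = "\<lambda>w. blinfun_apply (f' w - f' x)"])
      fix w assume w: "w \<in> ball x d"
      then have "w \<in> U" "dist (f' x) (f' w) < e" using d(2)[OF x] by auto
      have "((\<lambda>y. f y - blinfun_apply (f' x) y) has_derivative (\<lambda>h. f' w h - f' x h)) (at w)"
        by (intro has_derivative_diff f'(1) \<open>w \<in> U\<close> bounded_linear_imp_has_derivative blinfun.bounded_linear_right)
      then show "((\<lambda>y. f y - blinfun_apply (f' x) y) has_derivative blinfun_apply (f' w - f' x)) (at w within ball x d)"
        unfolding minus_blinfun.rep_eq by (rule has_derivative_at_withinI)
      show "onorm (blinfun_apply (f' w - f' x)) \<le> e"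
        using \<open>dist (f' x) (f' w) < e\<close> by (simp add: norm_blinfun.rep_eq[symmetric] dist_norm norm_minus_commute)
    qed (use y in auto)
    then show "norm (f y - f y' - f' x (y - y')) \<le> e * norm (y - y')"
      by (simp add: blinfun.diff_right algebra_simps)
    qed
  qed
qed

text \<open>Difference quotients in direction \<open>h\<close> are bounded by \<open>L\<close>, and
  the derivative differs from them by an arbitrarily small error.\<close>

lemma lipschitz_derivative_bound:
  assumes f': "(f has_derivative f') (at x)" and "open U" "x \<in> U" "L \<ge> 0"
    and lip: "\<And>y. y \<in> U \<Longrightarrow> norm (f y - f x) \<le> L * norm (y - x)"
  shows "norm (f' h) \<le> L * norm h"
proof (cases "h = 0")
  case True
  then show ?thesis using has_derivative_bounded_linear[OF f'] by (simp add: linear_simps)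
next
  case False
  interpret bounded_linear f' using f' by (rule has_derivative_bounded_linear)
  have "norm (f' h) \<le> L * norm h + e" if "e > 0" for e
  proof -
    define e' where "e' = e / norm h"
    have e': "e' > 0" using that False by (simp add: e'_def)
    obtain d where d: "d > 0" "\<And>y. norm (y - x) < d \<Longrightarrow> norm (f y - f x - f' (y - x)) \<le> e' * norm (y - x)"
      using f' e' unfolding has_derivative_at_alt by blast
    obtain d2 where d2: "d2 > 0" "ball x d2 \<subseteq> U" using assms openE by blast
    \<comment> \<open>Shrinks \<open>h\<close> so that the step stays inside \<open>U\<close> and
      inside the radius of differentiability.\<close>
    define s where "s = min d d2 / (2 * norm h)"
    have s: "s > 0" "norm (s *\<^sub>R h) < d" "norm (s *\<^sub>R h) < d2"
      using d(1) d2(1) False by (auto simp: s_def)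
    define y where "y = x + s *\<^sub>R h"
    have "y \<in> U" using s(3) d2 by (auto simp: y_def dist_norm)
    have "norm (f' (y - x)) \<le> norm (f y - f x) + norm (f y - f x - f' (y - x))"
      by (metis norm_minus_commute norm_triangle_sub)
    also have "\<dots> \<le> L * norm (y - x) + e' * norm (y - x)"
      using lip[OF \<open>y \<in> U\<close>] d(2)[of y] s(2) by (simp add: y_def)
    finally have "s * norm (f' h) \<le> s * (L * norm h + e' * norm h)"
      using s(1) by (simp add: y_def scale algebra_simps)
    then have "norm (f' h) \<le> L * norm h + e' * norm h" using s(1) by simp
    then show ?thesis using False by (simp add: e'_def)
  qed
  then show ?thesis by (rule field_le_epsilon)
qed

section \<open>Families of contractions\<close>

text \<open>No map at \<open>r = 0\<close> is involved, only the limit of the images of the centre.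
  With contraction factor 1/2 the distance of the fixed point from \<open>x0\<close> is at most
  twice the displacement of \<open>x0\<close>, which gives both membership in the open ball and
  convergence.\<close>

lemma fixed_point_family:
  fixes \<Psi> :: "real \<Rightarrow> 'x::banach \<Rightarrow> 'x"
  assumes "\<delta> > 0" "\<rho> > 0"
    and lip: "\<And>r x y. r \<in> {0<..<\<rho>} \<Longrightarrow> x \<in> cball x0 \<delta> \<Longrightarrow> y \<in> cball x0 \<delta> \<Longrightarrow>
          norm (\<Psi> r x - \<Psi> r y) \<le> norm (x - y) / 2"
    and lim: "((\<lambda>r. \<Psi> r x0) \<longlongrightarrow> x0) (at_right 0)"
  obtains r0 X where "r0 > 0" "r0 \<le> \<rho>"
    "\<forall>r\<in>{0<..<r0}. X r \<in> ball x0 \<delta> \<and> \<Psi> r (X r) = X r \<and> (\<forall>x\<in>cball x0 \<delta>. \<Psi> r x = x \<longrightarrow> x = X r)"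
    "(X \<longlongrightarrow> x0) (at_right 0)"
proof -
  have "\<forall>\<^sub>F r in at_right 0. dist (\<Psi> r x0) x0 < \<delta> / 4"
    using tendstoD[OF lim, of "\<delta>/4"] \<open>\<delta> > 0\<close> by simp
  then obtain r1 where r1: "r1 > 0" "\<And>r. r > 0 \<Longrightarrow> r < r1 \<Longrightarrow> dist (\<Psi> r x0) x0 < \<delta> / 4"
    unfolding eventually_at_right_field by auto
  define r0 where "r0 = min r1 \<rho>"
  have r0: "r0 > 0" "r0 \<le> \<rho>" "r0 \<le> r1" using r1 assms by (auto simp: r0_def)
  have ex: "\<exists>!x. x \<in> cball x0 \<delta> \<and> \<Psi> r x = x" if r: "r \<in> {0<..<r0}" for r
  proof (rule Banach_fix[where c = "1/2"])
    show "complete (cball x0 \<delta>)" by (simp add: complete_eq_closed)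
    show "\<Psi> r ` cball x0 \<delta> \<subseteq> cball x0 \<delta>"
    proof
      fix y assume "y \<in> \<Psi> r ` cball x0 \<delta>"
      then obtain x where x: "x \<in> cball x0 \<delta>" "y = \<Psi> r x" by auto
      \<comment> \<open>The centre moves by less than a quarter of the radius and the contraction
        contributes at most half of it, so the closed ball is mapped into itself.\<close>
      have "dist x0 y \<le> dist (\<Psi> r x0) x0 + dist (\<Psi> r x0) (\<Psi> r x)"
        by (metis dist_triangle3 x(2))
      also have "\<dots> \<le> \<delta>/4 + norm (x0 - x) / 2"
        using r1(2)[of r] r r0 lip[of r x0 x] x \<open>\<delta> > 0\<close> by (intro add_mono) (auto simp: dist_norm)
      also have "\<dots> \<le> \<delta>" using x \<open>\<delta> > 0\<close> by (simp add: dist_norm)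
      finally show "y \<in> cball x0 \<delta>" by simp
    qed
    show "\<And>x y. x \<in> cball x0 \<delta> \<Longrightarrow> y \<in> cball x0 \<delta> \<Longrightarrow> dist (\<Psi> r x) (\<Psi> r y) \<le> 1/2 * dist x y"
      using lip[of r] r r0 by (auto simp: dist_norm)
  qed (use \<open>\<delta> > 0\<close> in auto)
  define X where "X r = (THE x. x \<in> cball x0 \<delta> \<and> \<Psi> r x = x)" for r
  have X: "X r \<in> cball x0 \<delta>" "\<Psi> r (X r) = X r" if "r \<in> {0<..<r0}" for r
    using theI'[OF ex[OF that]] by (auto simp: X_def)
  have bnd: "dist (X r) x0 \<le> 2 * dist (\<Psi> r x0) x0" if r: "r \<in> {0<..<r0}" for r
  proof -
    have "dist (X r) x0 \<le> dist (\<Psi> r (X r)) (\<Psi> r x0) + dist (\<Psi> r x0) x0"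
      using X(2)[OF r] dist_triangle by metis
    also have "dist (\<Psi> r (X r)) (\<Psi> r x0) \<le> dist (X r) x0 / 2"
      using lip[of r "X r" x0] X[OF r] r r0 \<open>\<delta> > 0\<close> by (simp add: dist_norm)
    finally show ?thesis by simp
  qed
  show ?thesis
  proof
    show "r0 > 0" "r0 \<le> \<rho>" by fact+
    have "X r \<in> ball x0 \<delta> \<and> \<Psi> r (X r) = X r" if "r \<in> {0<..<r0}" for r
      using bnd[OF that] X[OF that] r1(2)[of r] that r0 \<open>\<delta> > 0\<close> by (auto simp: dist_commute)
    moreover have "x = X r" if "r \<in> {0<..<r0}" "x \<in> cball x0 \<delta>" "\<Psi> r x = x" for r x
      using ex[OF that(1)] X[OF that(1)] that by blast
    ultimately show "\<forall>r\<in>{0<..<r0}. X r \<in> ball x0 \<delta> \<and> \<Psi> r (X r) = X r \<and> (\<forall>x\<in>cball x0 \<delta>. \<Psi> r x = x \<longrightarrow> x = X r)"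
      by blast
    show "(X \<longlongrightarrow> x0) (at_right 0)"
    proof (rule Lim_transform_bound[where g = "\<lambda>r. 2 * dist (\<Psi> r x0) x0", THEN Lim_null[THEN iffD2]] )
      show "\<forall>\<^sub>F r in at_right 0. norm (X r - x0) \<le> norm (2 * dist (\<Psi> r x0) x0)"
        unfolding eventually_at_right_field
        using bnd r0 by (intro exI[of _ r0]) (auto simp: dist_norm)
      show "((\<lambda>r. 2 * dist (\<Psi> r x0) x0) \<longlongrightarrow> 0) (at_right 0)"
        by (intro tendsto_mult_right_zero) (rule tendsto_dist_iff[THEN iffD1, OF lim])
    qed
  qed
qed

text \<open>Implicit differentiation of \<open>\<Psi> r (X r) = X r\<close> gives a linear fixed
  point equation for the derivative. The partial derivative in \<open>x\<close> inherits the bound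
  1/2 from the Lipschitz estimate, so that equation is again solved by contraction.\<close>

lemma fixed_point_family_C1:
  fixes \<Psi> :: "real \<Rightarrow> 'x::banach \<Rightarrow> 'x"
  assumes lip: "\<And>r x y. r \<in> {0<..<r0} \<Longrightarrow> x \<in> ball x0 \<delta> \<Longrightarrow> y \<in> ball x0 \<delta> \<Longrightarrow>
          norm (\<Psi> r x - \<Psi> r y) \<le> norm (x - y) / 2"
    and X: "\<And>r. r \<in> {0<..<r0} \<Longrightarrow> X r \<in> ball x0 \<delta> \<and> \<Psi> r (X r) = X r"
    and C1: "C1_map ({0<..<r0} \<times> ball x0 \<delta>) (\<lambda>(r, x). \<Psi> r x)"
  shows "C1_map {0<..<r0} X"
proof -
  define I where "I = {0<..<r0}"
  obtain D where D: "\<And>p. p \<in> I \<times> ball x0 \<delta> \<Longrightarrow> ((\<lambda>(r, x). \<Psi> r x) has_derivative blinfun_apply (D p)) (at p)"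
    and contD: "continuous_on (I \<times> ball x0 \<delta>) D"
    using C1 unfolding I_def by (rule C1_mapE) blast
  have half: "norm (D (r, X r) (0, h)) \<le> norm h / 2" if r: "r \<in> I" for r h
  proof -
    have Xr: "X r \<in> ball x0 \<delta>" using X r by (auto simp: I_def)
    have "((\<lambda>x. (\<lambda>(r, x). \<Psi> r x) (r, x)) has_derivative (\<lambda>h. D (r, X r) (0, h))) (at (X r))"
      by (rule has_derivative_compose[where f = "\<lambda>x. (r, x)" and g = "\<lambda>(r, x). \<Psi> r x"])
         (auto intro!: derivative_eq_intros D r Xr[simplified])
    then have "norm (D (r, X r) (0, h)) \<le> 1/2 * norm h"
      by (rule lipschitz_derivative_bound[where U = "ball x0 \<delta>"])
         (use Xr lip[of r _ "X r"] r in \<open>auto simp: I_def\<close>)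
    then show ?thesis by simp
  qed
  \<comment> \<open>The candidate for the derivative of \<open>X\<close>: the solution of the
    differentiated fixed point equation.\<close>
  have "\<exists>\<xi>. \<forall>r\<in>I. \<xi> r = D (r, X r) (1, \<xi> r)"
  proof (intro bchoice ballI)
    fix r assume r: "r \<in> I"
    have "\<exists>!\<xi>. D (r, X r) (1, \<xi>) = \<xi>"
    proof (rule banach_fix_type[where c = "1/2"])
      show "\<forall>x y. dist (D (r, X r) (1, x)) (D (r, X r) (1, y)) \<le> 1/2 * dist x y"
      proof (intro allI)
        fix x y
        have "D (r, X r) (1, x) - D (r, X r) (1, y) = D (r, X r) (0, x - y)"
          by (simp add: blinfun.diff_right[symmetric])
        then show "dist (D (r, X r) (1, x)) (D (r, X r) (1, y)) \<le> 1/2 * dist x y"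
          using half[OF r, of "x - y"] by (simp add: dist_norm)
      qed
    qed auto
    then show "\<exists>\<xi>. \<xi> = D (r, X r) (1, \<xi>)" by metis
  qed
  then obtain \<xi> where \<xi>: "\<And>r. r \<in> I \<Longrightarrow> \<xi> r = D (r, X r) (1, \<xi> r)" by blast
  have der: "(X has_derivative (\<lambda>s. s *\<^sub>R \<xi> r)) (at r)" if r: "r \<in> I" for r
  proof -
    have Xr: "X r \<in> ball x0 \<delta>" "\<Psi> r (X r) = X r" using X r by (auto simp: I_def)
    obtain B where B: "B \<ge> 0" "\<And>p. norm (D (r, X r) p) \<le> B * norm p"
      by (meson norm_blinfun norm_ge_zero)
    define C where "C = 2 * (B + 1)"
    have C: "C \<ge> 0" using B by (simp add: C_def)
    show ?thesis unfolding has_derivative_at_alt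
    proof (intro conjI allI impI)
      show "bounded_linear (\<lambda>s. s *\<^sub>R \<xi> r)" by (rule bounded_linear_scaleR_left)
      fix e :: real assume "e > 0"
      \<comment> \<open>Chosen so that \<open>2 * e' * (1 + C) \<le> e\<close>: the factor 2 comes
        from absorbing the implicit term, and \<open>1 + C\<close> bounds the joint increment of
        \<open>s\<close> and \<open>X s\<close> by that of \<open>s\<close>.\<close>
      define e' where "e' = min 1 (e / (2 * (1 + C)))"
      have e': "e' > 0" "e' \<le> 1"
        using \<open>e > 0\<close> C by (auto simp: e'_def)
      have "e' \<le> e / (2 * (1 + C))" by (simp add: e'_def)
      then have "2 * e' * (1 + C) \<le> e" using C by (simp add: pos_le_divide_eq algebra_simps)
      note e' = e' this
      have "((\<lambda>(r, x). \<Psi> r x) has_derivative blinfun_apply (D (r, X r))) (at (r, X r))"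
        using D r Xr by blast
      then obtain d where d: "d > 0" "\<And>q. norm (q - (r, X r)) < d \<Longrightarrow>
          norm ((\<lambda>(r, x). \<Psi> r x) q - (\<lambda>(r, x). \<Psi> r x) (r, X r) - D (r, X r) (q - (r, X r))) \<le> e' * norm (q - (r, X r))"
        using e'(1) unfolding has_derivative_at_alt by blast
      have d': "norm (\<Psi> s x - X r - D (r, X r) (s - r, x - X r)) \<le> e' * (\<bar>s - r\<bar> + norm (x - X r))"
        if "\<bar>s - r\<bar> + norm (x - X r) < d" for s x
      proof -
        have *: "norm ((s, x) - (r, X r)) \<le> \<bar>s - r\<bar> + norm (x - X r)"
          using norm_Pair_le[of "s - r" "x - X r"] by simp
        then have "norm ((s, x) - (r, X r)) < d" using that by simp
        from d(2)[OF this] have "norm (\<Psi> s x - X r - D (r, X r) (s - r, x - X r)) \<le> e' * norm ((s, x) - (r, X r))"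
          using Xr by simp
        also have "\<dots> \<le> e' * (\<bar>s - r\<bar> + norm (x - X r))" using * e' by (intro mult_left_mono) auto
        finally show ?thesis .
      qed
      obtain d2 where d2: "d2 > 0" "ball r d2 \<subseteq> I" using r openE[of I r] by (auto simp: I_def)
      define d3 where "d3 = min d2 (d / (1 + C))"
      have d3: "d3 > 0" using d d2 C by (simp add: d3_def)
      have "norm (X s - X r - (s - r) *\<^sub>R \<xi> r) \<le> e * \<bar>s - r\<bar>" if s: "\<bar>s - r\<bar> < d3" for s
      proof -
        have sI: "s \<in> I" using s d2 by (auto simp: d3_def dist_real_def)
        have sd: "(1 + C) * \<bar>s - r\<bar> < d" using s C by (simp add: d3_def field_simps)
        have Cs: "0 \<le> C * \<bar>s - r\<bar>" using C by simp
        have Xs: "X s \<in> ball x0 \<delta>" "\<Psi> s (X s) = X s" using X sI by (auto simp: I_def)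
        have "norm (X s - X r) \<le> norm (\<Psi> s (X s) - \<Psi> s (X r)) + norm (\<Psi> s (X r) - X r)"
          using Xs norm_triangle_ineq[of "\<Psi> s (X s) - \<Psi> s (X r)" "\<Psi> s (X r) - X r"] by simp
        also have "norm (\<Psi> s (X s) - \<Psi> s (X r)) \<le> norm (X s - X r) / 2"
          using lip[of s "X s" "X r"] sI Xs Xr by (auto simp: I_def)
        finally have "norm (X s - X r) \<le> 2 * norm (\<Psi> s (X r) - X r)" by simp
        also have "norm (\<Psi> s (X r) - X r) \<le> norm (D (r, X r) (s - r, 0)) + norm (\<Psi> s (X r) - X r - D (r, X r) (s - r, 0))"
          by (metis norm_triangle_sub)
        also have "\<dots> \<le> B * \<bar>s - r\<bar> + e' * \<bar>s - r\<bar>"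
          using B(2)[of "(s - r, 0)"] d'[of s "X r"] sd Cs by (intro add_mono) (auto simp: norm_Pair algebra_simps)
        also have "\<dots> \<le> (B + 1) * \<bar>s - r\<bar>" using e' by (simp add: algebra_simps mult_left_le_one_le)
        finally have "norm (X s - X r) \<le> 2 * ((B + 1) * \<bar>s - r\<bar>)" by simp
        then have Lip: "norm (X s - X r) \<le> C * \<bar>s - r\<bar>" unfolding C_def by argo
        \<comment> \<open>The error \<open>\<Delta>\<close> equals a differentiability remainder
          \<open>E\<close> plus the partial derivative applied to \<open>\<Delta>\<close> itself;
          since the latter is at most half of \<open>\<Delta>\<close>, it can be absorbed.\<close>
        define \<Delta> where "\<Delta> = X s - X r - (s - r) *\<^sub>R \<xi> r"
        define E where "E = X s - X r - D (r, X r) (s - r, X s - X r)"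
        have 1: "(s - r, X s - X r) = (s - r) *\<^sub>R (1, \<xi> r) + (0, \<Delta>)" by (simp add: \<Delta>_def)
        have 2: "D (r, X r) (s - r, X s - X r) = (s - r) *\<^sub>R \<xi> r + D (r, X r) (0, \<Delta>)"
          unfolding 1 blinfun.add_right blinfun.scaleR_right using \<xi>[OF r] by simp
        have eq: "\<Delta> = E + D (r, X r) (0, \<Delta>)"
          unfolding E_def 2 by (simp add: \<Delta>_def)
        have "norm \<Delta> \<le> norm E + norm (D (r, X r) (0, \<Delta>))"
          using norm_triangle_ineq[of E "D (r, X r) (0, \<Delta>)"] unfolding eq[symmetric] .
        then have 3: "norm \<Delta> \<le> 2 * norm E" using half[OF r, of \<Delta>] by linarith
        have "norm E \<le> e' * (\<bar>s - r\<bar> + norm (X s - X r))"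
          using d'[of s "X s"] Lip sd Xs unfolding E_def by (simp add: algebra_simps)
        also have "\<dots> \<le> e' * (\<bar>s - r\<bar> + C * \<bar>s - r\<bar>)" using e' Lip by (intro mult_left_mono) auto
        finally have "norm \<Delta> \<le> 2 * e' * (1 + C) * \<bar>s - r\<bar>" using 3 by (simp add: algebra_simps)
        also have "\<dots> \<le> e * \<bar>s - r\<bar>" using e' by (intro mult_right_mono) auto
        finally show ?thesis by (simp add: \<Delta>_def)
      qed
      then show "\<exists>d>0. \<forall>y. norm (y - r) < d \<longrightarrow> norm (X y - X r - (y - r) *\<^sub>R \<xi> r) \<le> e * norm (y - r)"
        using d3 by auto
    qed
  qed
  have contX: "continuous_on I X"
    using der has_derivative_continuous continuous_at_imp_continuous_on by blast
  have contDX: "continuous_on I (\<lambda>r. D (r, X r))"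
    by (rule continuous_on_compose2[OF contD]) (use X contX in \<open>auto intro!: continuous_intros simp: I_def\<close>)
  have "continuous_on I \<xi>" unfolding continuous_on_def
  proof
    fix r assume r: "r \<in> I"
    \<comment> \<open>The same absorption bounds the variation of \<open>\<xi>\<close> by that of
      the total derivative along the curve.\<close>
    have bnd: "norm (\<xi> s - \<xi> r) \<le> 2 * (norm (D (s, X s) - D (r, X r)) * norm (1::real, \<xi> r))" if s: "s \<in> I" for s
    proof -
      have "\<xi> s - \<xi> r = D (s, X s) (0, \<xi> s - \<xi> r) + (D (s, X s) - D (r, X r)) (1, \<xi> r)"
      proof -
        have "D (s, X s) (1, \<xi> s) = D (s, X s) (0, \<xi> s - \<xi> r) + D (s, X s) (1, \<xi> r)"
          by (simp add: blinfun.add_right[symmetric])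
        then show ?thesis using \<xi>[OF s] \<xi>[OF r] by (metis add_diff_eq blinfun.diff_left)
      qed
      then have "norm (\<xi> s - \<xi> r) \<le> norm (D (s, X s) (0, \<xi> s - \<xi> r)) + norm ((D (s, X s) - D (r, X r)) (1, \<xi> r))"
        by (metis norm_triangle_ineq)
      also have "\<dots> \<le> norm (\<xi> s - \<xi> r) / 2 + norm (D (s, X s) - D (r, X r)) * norm (1::real, \<xi> r)"
        by (intro add_mono half s norm_blinfun)
      finally show ?thesis by simp
    qed
    have "((\<lambda>s. 2 * (norm (D (s, X s) - D (r, X r)) * norm (1::real, \<xi> r))) \<longlongrightarrow> 0) (at r within I)"
      by (intro tendsto_mult_right_zero tendsto_mult_left_zero tendsto_norm_zero LIM_zero)
         (use contDX r in \<open>auto simp: continuous_on_def\<close>)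
    then have "((\<lambda>s. \<xi> s - \<xi> r) \<longlongrightarrow> 0) (at r within I)"
      by (rule Lim_null_comparison[rotated]) (use bnd in \<open>auto simp: eventually_at_filter\<close>)
    then show "(\<xi> \<longlongrightarrow> \<xi> r) (at r within I)" by (rule LIM_zero_cancel)
  qed
  then have "C1_map I X"
    by (intro C1_mapI[of _ _ "\<lambda>r. blinfun_scaleR_left (\<xi> r)"])
       (auto intro: der bounded_linear.continuous_on[OF bounded_linear_blinfun_scaleR_left])
  then show ?thesis by (simp add: I_def)
qed

lemma C1_map_imp_C1_differentiable_on:
  fixes f :: "real \<Rightarrow> 'a::real_normed_vector"
  assumes "C1_map S f" shows "f C1_differentiable_on S"
proof -
  obtain f' where f': "\<And>x. x \<in> S \<Longrightarrow> (f has_derivative blinfun_apply (f' x)) (at x)" "continuous_on S f'"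
    using assms unfolding C1_map_def by blast
  have lin: "blinfun_apply (f' x) = (\<lambda>h. h *\<^sub>R f' x 1)" for x
  proof
    fix h show "f' x h = h *\<^sub>R f' x 1" using blinfun.scaleR_right[of "f' x" h 1] unfolding real_scaleR_def mult_1_right .
  qed
  have "(f has_vector_derivative f' x 1) (at x)" if "x \<in> S" for x
    unfolding has_vector_derivative_def by (rule has_derivative_eq_rhs[OF f'(1)[OF that] lin])
  moreover have "continuous_on S (\<lambda>x. f' x 1)" by (intro continuous_intros f')
  ultimately show ?thesis
    unfolding C1_differentiable_on_def by (intro exI[of _ "\<lambda>x. f' x 1"] conjI ballI)
qed

text \<open>Local derivatives agree by uniqueness, so an arbitrary choice at each point is
  automatically continuous. Needed when estimates hold only on compact windows of the
  parameter.\<close>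

lemma C1_map_locally:
  assumes "\<And>x. x \<in> S \<Longrightarrow> \<exists>V. open V \<and> x \<in> V \<and> C1_map V f"
  shows "C1_map S f"
proof -
  define g where "g x = (SOME D. (f has_derivative blinfun_apply D) (at x))" for x
  have *: "(f has_derivative blinfun_apply (g x)) (at x) \<and> isCont g x" if xS: "x \<in> S" for x
  proof -
    obtain V where V: "open V" "x \<in> V" "C1_map V f" using assms[OF xS] by blast
    obtain f' where f': "\<And>y. y \<in> V \<Longrightarrow> (f has_derivative blinfun_apply (f' y)) (at y)" "continuous_on V f'"
      using V(3) by (rule C1_mapE) blast
    have eq: "g y = f' y" if "y \<in> V" for y
    proof -
      have "(f has_derivative blinfun_apply (g y)) (at y)"
        unfolding g_def by (rule someI[of _ "f' y"]) (rule f'(1)[OF that])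
      then show ?thesis using f'(1)[OF that] has_derivative_unique by (metis blinfun_apply_inject)
    qed
    have "continuous_on V g" using f'(2) eq by (simp cong: continuous_on_cong)
    then have "isCont g x" using V by (simp add: continuous_on_eq_continuous_at)
    then show ?thesis using f'(1)[OF V(2)] eq[OF V(2)] by simp
  qed
  then show ?thesis
    by (intro C1_mapI[of _ _ g]) (auto intro: continuous_at_imp_continuous_on)
qed

lemma C1_map_compose_snd:
  assumes "C1_map S f" "\<And>p. p \<in> P \<Longrightarrow> snd p \<in> S"
  shows "C1_map P (\<lambda>p. f (snd p))"
  by (rule C1_map_compose[OF _ assms(1)]) (auto intro: C1_map_bounded_linear bounded_linear_snd assms)

instance bcontfun :: (metric_space, banach) banach ..

section \<open>Superposition operators on bounded continuous functions\<close>

lemma compact_tube: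
  fixes K :: "'a::euclidean_space set"
  assumes "compact K" shows "compact {x + y | x y. x \<in> K \<and> y \<in> cball 0 d}"
  using compact_sums[OF assms compact_cball[of 0 d]] by simp

abbreviation bcf_into :: "'b::metric_space set \<Rightarrow> ('a::topological_space \<Rightarrow>\<^sub>C 'b) set" where
  "bcf_into K \<equiv> {u. range (apply_bcontfun u) \<subseteq> K}"

text \<open>\<open>Bcontfun\<close> is meaningful only on bounded continuous functions; the lemmas
  therefore confine the range of \<open>u\<close> to a compact set on which \<open>f\<close> is
  continuous.\<close>

definition bcf_comp :: "('b::metric_space \<Rightarrow> 'c::metric_space) \<Rightarrow> ('a::topological_space \<Rightarrow>\<^sub>C 'b) \<Rightarrow> 'a \<Rightarrow>\<^sub>C 'c" where
  "bcf_comp f u = Bcontfun (\<lambda>x. f (u x))"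

lemma bcf_comp_apply:
  fixes u :: "'a::topological_space \<Rightarrow>\<^sub>C 'b::metric_space"
  assumes "compact K" "continuous_on K f" "range u \<subseteq> K"
  shows "apply_bcontfun (bcf_comp f u) x = f (apply_bcontfun u x)"
proof -
  have "(\<lambda>x. f (apply_bcontfun u x)) \<in> bcontfun"
    unfolding bcontfun_def
  proof (intro CollectI conjI)
    show "continuous_on UNIV (\<lambda>x. f (apply_bcontfun u x))"
      by (rule continuous_on_compose2[OF assms(2)]) (use assms in auto)
    have "bounded (f ` K)" using assms by (intro compact_imp_bounded compact_continuous_image)
    then show "bounded (range (\<lambda>x. f (apply_bcontfun u x)))"
      by (rule bounded_subset) (use assms in auto)
  qed
  then show ?thesis by (simp add: bcf_comp_def Bcontfun_inverse)
qed

text \<open>Uniform continuity of \<open>f\<close> on \<open>K\<close> turns pointwise closeness of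
  the values into closeness in the supremum metric.\<close>

lemma continuous_on_bcf_comp:
  fixes f :: "'b::metric_space \<Rightarrow> 'c::metric_space"
  assumes "compact K" "continuous_on K f"
  shows "continuous_on (bcf_into K) (bcf_comp f :: ('a::topological_space \<Rightarrow>\<^sub>C 'b) \<Rightarrow> _)"
  unfolding continuous_on_iff
proof (intro ballI allI impI)
  fix u :: "'a \<Rightarrow>\<^sub>C 'b" and e :: real
  assume u: "u \<in> bcf_into K" and "e > 0"
  have "uniformly_continuous_on K f" by (intro compact_uniformly_continuous assms)
  then obtain d where d: "d > 0" "\<And>x y. x \<in> K \<Longrightarrow> y \<in> K \<Longrightarrow> dist y x < d \<Longrightarrow> dist (f y) (f x) < e/2"
    unfolding uniformly_continuous_on_def using \<open>e > 0\<close> half_gt_zero by metis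
  have "dist (bcf_comp f v) (bcf_comp f u) < e" if v: "v \<in> bcf_into K" "dist v u < d" for v
  proof -
    have "dist (bcf_comp f v) (bcf_comp f u) \<le> e/2"
    proof (rule dist_bound)
      fix x
      have "dist (apply_bcontfun v x) (apply_bcontfun u x) < d"
        using dist_fun_lt_imp_dist_val_lt[OF v(2)] .
      then have "dist (f (apply_bcontfun v x)) (f (apply_bcontfun u x)) < e/2" using u v by (intro d) auto
      then show "dist (apply_bcontfun (bcf_comp f v) x) (apply_bcontfun (bcf_comp f u) x) \<le> e/2"
        using u v bcf_comp_apply[OF assms, of u] bcf_comp_apply[OF assms, of v] by simp
    qed
    then show ?thesis using \<open>e > 0\<close> by simp
  qed
  then show "\<exists>d>0. \<forall>v\<in>bcf_into K. dist v u < d \<longrightarrow> dist (bcf_comp f v) (bcf_comp f u) < e"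
    using d(1) by blast
qed

definition bcf_blin :: "('a::topological_space \<Rightarrow>\<^sub>C ('b::real_normed_vector \<Rightarrow>\<^sub>L 'c::real_normed_vector)) \<Rightarrow> ('a \<Rightarrow>\<^sub>C 'b) \<Rightarrow> 'a \<Rightarrow>\<^sub>C 'c" where
  "bcf_blin A u = Bcontfun (\<lambda>x. blinfun_apply (A x) (u x))"

lemma norm_blin_bcf_le: "norm (blinfun_apply (apply_bcontfun A x) (apply_bcontfun u x)) \<le> norm A * norm u"
  by (rule order_trans[OF norm_blinfun]) (intro mult_mono norm_bounded norm_ge_zero)

lemma bcf_blin_apply [simp]: "apply_bcontfun (bcf_blin A u) x = blinfun_apply (A x) (u x)"
proof -
  have "(\<lambda>x. blinfun_apply (apply_bcontfun A x) (apply_bcontfun u x)) \<in> bcontfun"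
    by (rule bcontfun_normI[OF _ norm_blin_bcf_le]) (intro continuous_intros continuous_on_apply_bcontfun)
  then show ?thesis by (simp add: bcf_blin_def Bcontfun_inverse)
qed

lemma bounded_bilinear_bcf_blin: "bounded_bilinear bcf_blin"
proof
  show "\<exists>K. \<forall>a b. norm (bcf_blin a b) \<le> norm a * norm b * K"
    by (rule exI[of _ 1]) (auto intro!: norm_bound norm_blin_bcf_le)
qed (auto intro!: bcontfun_eqI simp: blinfun.bilinear_simps)

text \<open>The first-order estimate for \<open>f\<close> is uniform along the compact set, so its
  pointwise version is already an estimate in the supremum norm.\<close>

lemma has_derivative_bcf_comp:
  fixes f :: "'b::euclidean_space \<Rightarrow> 'c::real_normed_vector" and u :: "'a::topological_space \<Rightarrow>\<^sub>C 'b"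
  assumes K: "compact K" "K \<subseteq> U" and "open U"
    and f': "\<And>x. x \<in> U \<Longrightarrow> (f has_derivative blinfun_apply (f' x)) (at x)" "continuous_on U f'"
    and u: "range u \<subseteq> K"
  shows "(bcf_comp f has_derivative bcf_blin (bcf_comp f' u)) (at u)"
  unfolding has_derivative_at_alt
proof (intro conjI allI impI)
  interpret bounded_bilinear "bcf_blin :: _ \<Rightarrow> ('a \<Rightarrow>\<^sub>C 'b) \<Rightarrow> 'a \<Rightarrow>\<^sub>C 'c" by (rule bounded_bilinear_bcf_blin)
  show "bounded_linear (bcf_blin (bcf_comp f' u))" by (rule bounded_linear_right)
  fix e :: real assume "e > 0"
  obtain d where d: "d > 0" "\<forall>x\<in>K. ball x d \<subseteq> U"
    "\<forall>x\<in>K. \<forall>y\<in>ball x d. \<forall>y'\<in>ball x d. norm (f y - f y' - f' x (y - y')) \<le> e * norm (y - y')"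
    using strict_derivative_compact[OF K \<open>open U\<close> f' \<open>e > 0\<close>] by metis
  \<comment> \<open>A slightly larger compact set that also contains the values of all nearby
    \<open>v\<close>, so that \<open>bcf_comp f v\<close> has its intended meaning.\<close>
  define K2 where "K2 = {x + y | x y. x \<in> K \<and> y \<in> cball 0 (d/2)}"
  have K2: "compact K2" unfolding K2_def by (rule compact_tube[OF K(1)])
  have K2U: "K2 \<subseteq> U"
  proof
    fix z assume "z \<in> K2"
    then obtain x y where "z = x + y" "x \<in> K" "norm y \<le> d/2" by (auto simp: K2_def)
    then show "z \<in> U" using d(1) d(2) by (auto simp: dist_norm subset_eq)
  qed
  have contf: "continuous_on U f" using f'(1) has_derivative_continuous continuous_at_imp_continuous_on by blast
  have KK2: "K \<subseteq> K2"
  proof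
    fix x assume "x \<in> K"
    then show "x \<in> K2" using d(1) unfolding K2_def by (intro CollectI exI[of _ x] exI[of _ 0]) auto
  qed
  have "norm (bcf_comp f v - bcf_comp f u - bcf_blin (bcf_comp f' u) (v - u)) \<le> e * norm (v - u)"
    if v: "norm (v - u) < d/2" for v
  proof (rule norm_bound)
    fix x
    have n: "norm (apply_bcontfun v x - apply_bcontfun u x) < d/2"
      using norm_bounded[of "v - u" x] v by simp
    have "range v \<subseteq> K2"
    proof
      fix z assume "z \<in> range v"
      then obtain s where s: "z = apply_bcontfun v s" by auto
      have "norm (apply_bcontfun v s - apply_bcontfun u s) \<le> d/2"
        using norm_bounded[of "v - u" s] v by simp
      then show "z \<in> K2" unfolding K2_def s using u
        by (intro CollectI exI[of _ "apply_bcontfun u s"] exI[of _ "apply_bcontfun v s - apply_bcontfun u s"]) auto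
    qed
    then have "apply_bcontfun (bcf_comp f v) x = f (apply_bcontfun v x)"
      by (intro bcf_comp_apply[OF K2]) (auto intro: continuous_on_subset[OF contf K2U])
    moreover have "apply_bcontfun (bcf_comp f u) x = f (apply_bcontfun u x)"
      by (intro bcf_comp_apply[OF K(1) _ u]) (auto intro: continuous_on_subset[OF contf K(2)])
    moreover have "apply_bcontfun (bcf_comp f' u) x = f' (apply_bcontfun u x)"
      by (intro bcf_comp_apply[OF K(1) _ u]) (auto intro: continuous_on_subset[OF f'(2) K(2)])
    moreover have "norm (f (apply_bcontfun v x) - f (apply_bcontfun u x) -
        f' (apply_bcontfun u x) (apply_bcontfun v x - apply_bcontfun u x)) \<le>
        e * norm (apply_bcontfun v x - apply_bcontfun u x)"
      by (rule d(3)[rule_format]) (use u n d(1) in \<open>auto simp: dist_norm norm_minus_commute\<close>)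
    moreover have "\<dots> \<le> e * norm (v - u)"
      using norm_bounded[of "v - u" x] \<open>e > 0\<close> by simp
    ultimately show "norm (apply_bcontfun (bcf_comp f v - bcf_comp f u - bcf_blin (bcf_comp f' u) (v - u)) x) \<le> e * norm (v - u)"
      by simp
  qed
  then show "\<exists>d>0. \<forall>v. norm (v - u) < d \<longrightarrow>
      norm (bcf_comp f v - bcf_comp f u - bcf_blin (bcf_comp f' u) (v - u)) \<le> e * norm (v - u)"
    using d(1) half_gt_zero by blast
qed

lemma C1_map_bcf_comp:
  fixes f :: "'b::euclidean_space \<Rightarrow> 'c::real_normed_vector"
  assumes K: "compact K" "K \<subseteq> U" and "open U" "C1_map U f"
  shows "C1_map (bcf_into K) (bcf_comp f :: ('a::topological_space \<Rightarrow>\<^sub>C 'b) \<Rightarrow> _)"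
proof -
  interpret bounded_bilinear "bcf_blin :: _ \<Rightarrow> ('a \<Rightarrow>\<^sub>C 'b) \<Rightarrow> 'a \<Rightarrow>\<^sub>C 'c" by (rule bounded_bilinear_bcf_blin)
  obtain f' where f': "\<And>x. x \<in> U \<Longrightarrow> (f has_derivative blinfun_apply (f' x)) (at x)" "continuous_on U f'"
    using assms(4) by (rule C1_mapE) blast
  show ?thesis
  proof (rule C1_mapI[of _ _ "\<lambda>u. prod_right (bcf_comp f' u)"])
    show "(bcf_comp f has_derivative blinfun_apply (prod_right (bcf_comp f' u))) (at u)"
      if "u \<in> bcf_into K" for u :: "'a \<Rightarrow>\<^sub>C 'b"
      using has_derivative_bcf_comp[OF K \<open>open U\<close> f', of u] that by (simp add: prod_right.rep_eq)
    show "continuous_on (bcf_into K) (\<lambda>u. prod_right (bcf_comp f' u))"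
      by (rule bounded_linear.continuous_on[OF bounded_linear_prod_right])
         (rule continuous_on_bcf_comp[OF K(1) continuous_on_subset[OF f'(2) K(2)]])
  qed
qed

text \<open>Treats the parameter as a constant component of the function, so that dependence on the
  parameter and on the function is one superposition operator.\<close>

definition bcf_pair :: "'b::real_normed_vector \<times> ('a::topological_space \<Rightarrow>\<^sub>C 'c::real_normed_vector) \<Rightarrow> 'a \<Rightarrow>\<^sub>C ('b \<times> 'c)" where
  "bcf_pair p = Bcontfun (\<lambda>x. (fst p, apply_bcontfun (snd p) x))"

lemma bcf_pair_apply [simp]: "apply_bcontfun (bcf_pair (r, u)) x = (r, apply_bcontfun u x)"
proof -
  have "(\<lambda>x. (r, apply_bcontfun u x)) \<in> bcontfun"
    by (rule bcontfun_normI[of _ "norm r + norm u"])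
       (auto intro!: continuous_intros order_trans[OF norm_Pair_le] norm_bounded)
  then show ?thesis by (simp add: bcf_pair_def Bcontfun_inverse)
qed

lemma bounded_linear_bcf_pair: "bounded_linear bcf_pair"
proof (rule bounded_linear_intro[where K = 2])
  show "norm (bcf_pair p) \<le> norm p * 2" for p :: "'a \<times> ('b \<Rightarrow>\<^sub>C 'c)"
  proof (rule norm_bound)
    fix x
    have "norm (apply_bcontfun (bcf_pair p) x) \<le> norm (fst p) + norm (snd p)"
      by (cases p) (auto intro!: order_trans[OF norm_Pair_le] norm_bounded)
    also have "\<dots> \<le> norm p + norm p" using norm_fst_le[of "fst p" "snd p"] norm_snd_le[of "snd p" "fst p"] by simp
    finally show "norm (apply_bcontfun (bcf_pair p) x) \<le> norm p * 2" by simp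
  qed
qed (auto intro!: bcontfun_eqI)

lemma bounded_linear_const_bcontfun: "bounded_linear (const_bcontfun :: 'b::real_normed_vector \<Rightarrow> 'a::topological_space \<Rightarrow>\<^sub>C 'b)"
  by (rule bounded_linear_intro[where K = 1]) (auto intro!: bcontfun_eqI norm_bound)

lemma bounded_linear_apply_bcontfun: "bounded_linear (\<lambda>u :: 'a::topological_space \<Rightarrow>\<^sub>C 'b::real_normed_vector. apply_bcontfun u x)"
  by (rule bounded_linear_intro[where K = 1]) (auto intro: norm_bounded)

section \<open>Volterra operators\<close>

text \<open>Functions on \<open>[0, T]\<close> are represented by their constant extensions to the
  line, which places them in the Banach space of bounded continuous functions.\<close>

definition clip :: "real \<Rightarrow> real \<Rightarrow> real" where "clip T t = max 0 (min t T)"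

lemma clip_simps [simp]:
  "0 \<le> t \<Longrightarrow> t \<le> T \<Longrightarrow> clip T t = t" "T \<ge> 0 \<Longrightarrow> 0 \<le> clip T t" "T \<ge> 0 \<Longrightarrow> clip T t \<le> T"
  by (auto simp: clip_def)

lemma continuous_on_clip [continuous_intros]: "continuous_on S (clip T)"
  unfolding clip_def by (intro continuous_intros)

lemma bcontfun_clip:
  assumes "T \<ge> 0" "continuous_on {0..T} f"
  shows "(\<lambda>t. f (clip T t)) \<in> bcontfun"
  unfolding bcontfun_def
proof (intro CollectI conjI)
  show "continuous_on UNIV (\<lambda>t. f (clip T t))"
    by (rule continuous_on_compose2[OF assms(2)]) (use assms(1) in \<open>auto intro: continuous_intros\<close>)
  have "bounded (f ` {0..T})" by (intro compact_imp_bounded compact_continuous_image assms) auto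
  then show "bounded (range (\<lambda>t. f (clip T t)))" by (rule bounded_subset) (use assms(1) in auto)
qed

definition bcf_int :: "real \<Rightarrow> (real \<Rightarrow>\<^sub>C 'a::banach) \<Rightarrow> real \<Rightarrow>\<^sub>C 'a" where
  "bcf_int T v = Bcontfun (\<lambda>t. integral {0..clip T t} v)"

lemma integrable_bcontfun [simp]: "apply_bcontfun v integrable_on {a..b::real}"
  for v :: "real \<Rightarrow>\<^sub>C 'a::banach"
  by (rule integrable_continuous_interval) simp

context
  fixes T :: real assumes T: "T \<ge> 0"
begin

lemma bcf_int_apply [simp]: "apply_bcontfun (bcf_int T v) t = integral {0..clip T t} v"
  for v :: "real \<Rightarrow>\<^sub>C 'a::banach"
proof -
  have "(\<lambda>t. integral {0..clip T t} v) \<in> bcontfun"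
    by (rule bcontfun_clip[OF T, of "\<lambda>t. integral {0..t} v"]) (rule indefinite_integral_continuous_1, simp)
  then show ?thesis by (simp add: bcf_int_def Bcontfun_inverse)
qed

lemma bounded_linear_bcf_int: "bounded_linear (bcf_int T :: (real \<Rightarrow>\<^sub>C 'a::banach) \<Rightarrow> _)"
proof (rule bounded_linear_intro[where K = T])
  show "norm (bcf_int T v) \<le> norm v * T" for v :: "real \<Rightarrow>\<^sub>C 'a"
  proof (rule norm_bound)
    fix t
    have "norm (integral {0..clip T t} v) \<le> norm v * (clip T t - 0)"
      by (rule integral_bound) (use T norm_bounded in auto)
    also have "\<dots> \<le> norm v * T" using T by (intro mult_left_mono) auto
    finally show "norm (apply_bcontfun (bcf_int T v) t) \<le> norm v * T" by simp
  qed
qed (auto intro!: bcontfun_eqI simp: integral_add)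

text \<open>An exponential weight makes the Volterra operator a contraction for every
  \<open>T\<close>: conjugation with \<open>exp (L t)\<close> brings its norm down to 1/2, and
  undoing the conjugation costs only bounded factors.\<close>

lemma volterra_resolvent:
  fixes A :: "real \<Rightarrow>\<^sub>C ('y::banach \<Rightarrow>\<^sub>L 'y)"
  obtains R :: "(real \<Rightarrow>\<^sub>C 'y) \<Rightarrow> (real \<Rightarrow>\<^sub>C 'y)"
  where "bounded_linear R" "\<And>a. R a = a + bcf_int T (bcf_blin A (R a))"
    "\<And>a w. w = a + bcf_int T (bcf_blin A w) \<Longrightarrow> w = R a"
proof -
  define W where "W s u = Bcontfun (\<lambda>t. exp (s * clip T t) *\<^sub>R apply_bcontfun u t)" for s :: real and u :: "real \<Rightarrow>\<^sub>C 'y"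
  have expb: "exp (s * clip T t) \<le> exp (\<bar>s\<bar> * T)" for s t
  proof -
    have "s * clip T t \<le> \<bar>s\<bar> * clip T t" using T by (intro mult_right_mono) auto
    also have "\<dots> \<le> \<bar>s\<bar> * T" using T by (intro mult_left_mono) auto
    finally show ?thesis by simp
  qed
  have W: "apply_bcontfun (W s u) t = exp (s * clip T t) *\<^sub>R apply_bcontfun u t" for s u t
  proof -
    have "(\<lambda>t. exp (s * clip T t) *\<^sub>R apply_bcontfun u t) \<in> bcontfun"
      by (rule bcontfun_normI[of _ "exp (\<bar>s\<bar> * T) * norm u"])
         (auto intro!: continuous_intros mult_mono norm_bounded expb)
    then show ?thesis by (simp add: W_def Bcontfun_inverse)
  qed
  have blW: "bounded_linear (W s)" for s
    by (rule bounded_linear_intro[where K = "exp (\<bar>s\<bar> * T)"])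
       (auto intro!: bcontfun_eqI norm_bound simp: W scaleR_add_right mult.commute[of _ "exp (\<bar>s\<bar> * T)"]
         intro!: mult_mono norm_bounded expb)
  have WW: "W s (W (-s) u) = u" "W (-s) (W s u) = u" for s u
    by (auto intro!: bcontfun_eqI simp: W exp_add[symmetric])
  define K where "K w = bcf_int T (bcf_blin A w)" for w
  have blK: "bounded_linear K"
    unfolding K_def
    by (rule bounded_linear_compose[OF bounded_linear_bcf_int])
       (rule bounded_bilinear.bounded_linear_right[OF bounded_bilinear_bcf_blin])
  \<comment> \<open>Large enough for \<open>norm A / L \<le> 1/2\<close>, and positive even for
    \<open>A = 0\<close>.\<close>
  define L where "L = 2 * norm A + 1"
  have L: "L > 0" by (simp add: L_def add_nonneg_pos)
  define M where "M w = W (-L) (K (W L w))" for w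
  have blM: "bounded_linear M"
    unfolding M_def by (intro bounded_linear_compose[OF blW] bounded_linear_compose[OF blK] blW)
  have M_half: "norm (M w) \<le> norm w / 2" for w
  proof (rule norm_bound)
    fix t
    define s where "s = clip T t"
    have s: "0 \<le> s" "s \<le> T" using T by (auto simp: s_def)
    have hi: "((\<lambda>x. norm A * norm w * exp (L * x)) has_integral
        norm A * norm w * (exp (L * s) / L - exp (L * 0) / L)) {0..s}"
      by (rule has_integral_mult_right, rule fundamental_theorem_of_calculus)
         (use s L in \<open>auto intro!: derivative_eq_intros simp: has_real_derivative_iff_has_vector_derivative[symmetric]\<close>)
    have "norm (integral {0..s} (bcf_blin A (W L w))) \<le> integral {0..s} (\<lambda>x. norm A * norm w * exp (L * x))"
    proof (rule integral_norm_bound_integral)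
      show "(\<lambda>x. norm A * norm w * exp (L * x)) integrable_on {0..s}" using hi by blast
      fix x assume x: "x \<in> {0..s}"
      have "norm (bcf_blin A (W L w) x) \<le> norm (apply_bcontfun A x) * norm (W L w x)"
        by (simp add: norm_blinfun)
      also have "\<dots> = norm (apply_bcontfun A x) * (exp (L * x) * norm (apply_bcontfun w x))"
        using x s by (simp add: W)
      also have "\<dots> \<le> norm A * (exp (L * x) * norm w)"
        by (intro mult_mono norm_bounded) auto
      finally show "norm (bcf_blin A (W L w) x) \<le> norm A * norm w * exp (L * x)" by (simp add: ac_simps)
    qed simp
    also have "\<dots> = norm A * norm w * (exp (L * s) - 1) / L"
      unfolding integral_unique[OF hi] by (simp add: diff_divide_distrib right_diff_distrib)
    also have "\<dots> \<le> exp (L * s) * (norm w / 2)"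
    proof -
      have "norm A / L \<le> 1/2" using L by (simp add: L_def field_simps)
      then have "norm A / L * (norm w * (exp (L * s) - 1)) \<le> 1/2 * (norm w * exp (L * s))"
        by (intro mult_mono) (use L s in auto)
      then show ?thesis by (simp add: ac_simps)
    qed
    finally have "exp (- (L * s)) * norm (integral {0..s} (bcf_blin A (W L w))) \<le> exp (- (L * s)) * (exp (L * s) * (norm w / 2))"
      by (intro mult_left_mono) auto
    then show "norm (apply_bcontfun (M w) t) \<le> norm w / 2"
      by (simp add: M_def W K_def s_def exp_minus field_simps)
  qed
  have fixM: "\<exists>!w. b + M w = w" for b
  proof (rule banach_fix_type[where c = "1/2"])
    interpret bounded_linear M by (rule blM)
    show "\<forall>x y. dist (b + M x) (b + M y) \<le> 1/2 * dist x y"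
      using M_half by (simp add: dist_norm diff[symmetric])
  qed auto
  \<comment> \<open>The original equation for \<open>w\<close> is the contractive one for the
    weighted function \<open>W (-L) w\<close>.\<close>
  have trans_eq: "w = a + K w \<longleftrightarrow> W (-L) a + M (W (-L) w) = W (-L) w" for a w
  proof -
    have "W (-L) a + M (W (-L) w) = W (-L) (a + K w)"
      using bounded_linear.linear[OF blW] by (simp add: M_def WW linear_add)
    then show ?thesis using WW by metis
  qed
  have ex: "\<exists>!w. w = a + K w" for a
  proof -
    obtain v where v: "W (-L) a + M v = v" "\<And>v'. W (-L) a + M v' = v' \<Longrightarrow> v' = v" using fixM by metis
    have "W L v = a + K (W L v)" using trans_eq[of "W L v" a] v(1) by (simp add: WW)
    moreover have "w = W L v" if "w = a + K w" for w
      using v(2)[of "W (-L) w"] that[unfolded trans_eq] WW by metis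
    ultimately show ?thesis by blast
  qed
  define R where "R a = (THE w. w = a + K w)" for a
  have R: "R a = a + K (R a)" for a unfolding R_def by (rule theI'[OF ex])
  have Ru: "w = R a" if "w = a + K w" for a w
    unfolding R_def by (rule the1_equality[OF ex that, symmetric])
  interpret K: bounded_linear K by (rule blK)
  have "bounded_linear R"
  proof -
    obtain C1 C2 where C12: "C1 \<ge> 0" "C2 \<ge> 0" "\<And>u. norm (W L u) \<le> norm u * C1" "\<And>u. norm (W (-L) u) \<le> norm u * C2"
      using bounded_linear.nonneg_bounded[OF blW] by metis
    show ?thesis
    proof (rule bounded_linear_intro[where K = "2 * C2 * C1"])
      show "R (a + b) = R a + R b" for a b
        by (rule Ru[symmetric]) (subst R, subst (2) R, simp add: K.add)
      show "R (c *\<^sub>R a) = c *\<^sub>R R a" for c a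
        by (rule Ru[symmetric]) (subst R, simp add: K.scaleR scaleR_add_right)
      fix a
      define v where "v = W (-L) (R a)"
      have "v = W (-L) a + M v" using trans_eq[of "R a" a] R[of a] by (simp add: v_def)
      then have "norm v \<le> norm (W (-L) a) + norm (M v)" by (metis norm_triangle_ineq)
      then have v: "norm v \<le> 2 * norm (W (-L) a)" using M_half[of v] by simp
      have "norm (R a) = norm (W L v)" by (simp add: v_def WW)
      also have "\<dots> \<le> norm v * C1" by (rule C12)
      also have "\<dots> \<le> 2 * norm (W (-L) a) * C1" using v C12 by (intro mult_right_mono) auto
      also have "\<dots> \<le> 2 * (norm a * C2) * C1" using C12 by (intro mult_right_mono mult_left_mono) auto
      finally show "norm (R a) \<le> norm a * (2 * C2 * C1)" by (simp add: ac_simps)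
    qed
  qed
  then show ?thesis using R Ru that unfolding K_def by blast
qed

end

section \<open>Shooting\<close>

text \<open>
  A boundary value problem \<open>y' = F0 y + \<rho> r y\<close> on \<open>[0, T]\<close> with \<open>y 0 = \<iota> q\<close>, \<open>\<beta> (y T, q) = 0\<close> and unknown
  \<open>(y, q)\<close>, near a nondegenerate solution \<open>(y0, q0)\<close> for the singular parameter value \<open>r = 0\<close>.
\<close>
locale shooting =
  fixes T :: real and y0 :: "real \<Rightarrow> 'y::euclidean_space" and q0 :: "'p::euclidean_space"
    and \<iota> :: "'p \<Rightarrow> 'y" and \<beta> :: "'y \<times> 'p \<Rightarrow> 'p"
    and U :: "'y set" and F0 :: "'y \<Rightarrow> 'y" and A :: "'y \<Rightarrow> 'y \<Rightarrow>\<^sub>L 'y" and \<rho> :: "real \<Rightarrow> 'y \<Rightarrow> 'y"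
  assumes T: "T > 0" and lin: "bounded_linear \<iota>" "bounded_linear \<beta>"
    and U: "open U" "y0 ` {0..T} \<subseteq> U"
    and A: "\<And>x. x \<in> U \<Longrightarrow> (F0 has_derivative blinfun_apply (A x)) (at x)" "continuous_on U A"
    and y0: "continuous_on {0..T} y0" "\<And>t. t \<in> {0..T} \<Longrightarrow> y0 t = \<iota> q0 + integral {0..t} (\<lambda>s. F0 (y0 s))"
      "\<beta> (y0 T, q0) = 0"
    and nondegenerate: "\<And>w q. continuous_on {0..T} w \<Longrightarrow>
      (\<And>t. t \<in> {0..T} \<Longrightarrow> w t = \<iota> q + integral {0..t} (\<lambda>s. A (y0 s) (w s))) \<Longrightarrow> \<beta> (w T, q) = 0 \<Longrightarrow> q = 0"
    and \<rho>0: "\<And>r. \<rho> r 0 = 0"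
    and \<rho>_lip: "\<And>R e. e > 0 \<Longrightarrow> \<exists>r1>0. \<forall>r\<in>{0<..<r1}. \<forall>x\<in>ball 0 R. \<forall>y\<in>ball 0 R. norm (\<rho> r x - \<rho> r y) \<le> e * norm (x - y)"
    and \<rho>_C1: "\<And>R. \<exists>r1>0. C1_map ({0<..<r1} \<times> ball 0 R) (\<lambda>(r, x). \<rho> r x)"
begin

definition "solves r y q \<longleftrightarrow> continuous_on {0..T} y \<and> \<beta> (y T, q) = 0 \<and>
  (\<forall>t\<in>{0..T}. y t = \<iota> q + integral {0..t} (\<lambda>s. F0 (y s) + \<rho> r (y s)))"

definition "y0c = Bcontfun (\<lambda>t. y0 (clip T t))"

lemma y0c [simp]: "apply_bcontfun y0c t = y0 (clip T t)"
  unfolding y0c_def using bcontfun_clip[OF _ y0(1)] T by (simp add: Bcontfun_inverse)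

lemma range_y0c: "range (apply_bcontfun y0c) \<subseteq> y0 ` {0..T}"
  using T by auto

lemma compact_y0: "compact (y0 ` {0..T})"
  by (intro compact_continuous_image y0) auto

lemmas T0 = less_imp_le[OF T]

definition "Ac = bcf_comp A y0c"

lemma Ac [simp]: "apply_bcontfun Ac t = A (y0 (clip T t))"
  unfolding Ac_def
  by (subst bcf_comp_apply[OF compact_y0 continuous_on_subset[OF A(2) U(2)] range_y0c]) simp

text \<open>The resolvent solves the inhomogeneous equation for every initial parameter, which
  leaves a linear system for \<open>q\<close>. Its homogeneous part is injective by
  \<open>nondegenerate\<close>. The equivalence in the conclusion makes fixed points and solutions
  of the boundary value problem interchangeable.\<close>

lemma linear_bvp:
  obtains Q1 :: "(real \<Rightarrow>\<^sub>C 'y) \<Rightarrow> (real \<Rightarrow>\<^sub>C 'y)" and Q2 :: "(real \<Rightarrow>\<^sub>C 'y) \<Rightarrow> 'p"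
  where "bounded_linear Q1" "bounded_linear Q2"
    "\<forall>n w q. w = Q1 n \<and> q = Q2 n \<longleftrightarrow>
       w = const_bcontfun (\<iota> q) + bcf_int T (bcf_blin Ac w + n) \<and> \<beta> (apply_bcontfun w T, q) = 0"
proof -
  interpret \<iota>: bounded_linear \<iota> by (rule lin)
  interpret \<beta>: bounded_linear \<beta> by (rule lin)
  interpret I: bounded_linear "bcf_int T :: (real \<Rightarrow>\<^sub>C 'y) \<Rightarrow> _" by (rule bounded_linear_bcf_int[OF T0])
  obtain R :: "(real \<Rightarrow>\<^sub>C 'y) \<Rightarrow> (real \<Rightarrow>\<^sub>C 'y)" where blR: "bounded_linear R" and
    R: "\<And>a. R a = a + bcf_int T (bcf_blin Ac (R a))" and
    Ru: "\<And>a w. w = a + bcf_int T (bcf_blin Ac w) \<Longrightarrow> w = R a"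
    using volterra_resolvent[OF T0, of Ac] by metis
  interpret R: bounded_linear R by (rule blR)
  define E where "E u = apply_bcontfun u T" for u :: "real \<Rightarrow>\<^sub>C 'y"
  have blE: "bounded_linear E" unfolding E_def by (rule bounded_linear_apply_bcontfun)
  interpret E: bounded_linear E by (rule blE)
  interpret c: bounded_linear "const_bcontfun :: 'y \<Rightarrow> real \<Rightarrow>\<^sub>C 'y" by (rule bounded_linear_const_bcontfun)
  define C where "C q = R (const_bcontfun (\<iota> q))" for q
  have blC: "bounded_linear C" unfolding C_def
    by (intro bounded_linear_compose[OF blR] bounded_linear_compose[OF bounded_linear_const_bcontfun] lin)
  interpret C: bounded_linear C by (rule blC)
  \<comment> \<open>The shooting matrix: initial parameter to boundary defect of the homogeneous
    solution.\<close>
  define B where "B q = \<beta> (E (C q), q)" for q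
  have blB: "bounded_linear B" unfolding B_def
    by (intro bounded_linear_compose[OF lin(2)] bounded_linear_Pair bounded_linear_compose[OF blE] blC bounded_linear_ident)
  interpret B: bounded_linear B by (rule blB)
  have "inj B" unfolding linear_injective_0[OF B.linear]
  proof (intro allI impI)
    fix q assume "B q = 0"
    show "q = 0"
    proof (rule nondegenerate)
      show "continuous_on {0..T} (apply_bcontfun (C q))" by simp
      show "\<beta> (apply_bcontfun (C q) T, q) = 0" using \<open>B q = 0\<close> by (simp add: B_def E_def)
      fix t assume t: "t \<in> {0..T}"
      have "apply_bcontfun (C q) t = \<iota> q + integral {0..t} (bcf_blin Ac (C q))"
        using arg_cong[OF R[of "const_bcontfun (\<iota> q)"], of "\<lambda>u. apply_bcontfun u t"] t T
        by (simp add: C_def bcf_int_apply[OF T0])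
      also have "integral {0..t} (bcf_blin Ac (C q)) = integral {0..t} (\<lambda>s. A (y0 s) (apply_bcontfun (C q) s))"
        by (rule Henstock_Kurzweil_Integration.integral_cong) (use t in auto)
      finally show "apply_bcontfun (C q) t = \<iota> q + integral {0..t} (\<lambda>s. A (y0 s) (apply_bcontfun (C q) s))" .
    qed
  qed
  \<comment> \<open>Here finite dimension enters: \<open>B\<close> is an injective endomorphism, so
    uniqueness yields solvability.\<close>
  then obtain Bi where Bi: "linear Bi" "\<And>x. Bi (B x) = x" "\<And>x. B (Bi x) = x"
    using linear_injective_isomorphism[OF B.linear] by blast
  interpret Bi: bounded_linear Bi using Bi(1) by (rule linear_conv_bounded_linear[THEN iffD1])
  define Q2 where "Q2 n = Bi (- \<beta> (E (R (bcf_int T n)), 0))" for n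
  define Q1 where "Q1 n = C (Q2 n) + R (bcf_int T n)" for n
  have bl2: "bounded_linear Q2" unfolding Q2_def
    by (intro bounded_linear_compose[OF Bi.bounded_linear] bounded_linear_minus bounded_linear_compose[OF lin(2)]
        bounded_linear_Pair bounded_linear_compose[OF blE] bounded_linear_compose[OF blR] I.bounded_linear bounded_linear_zero)
  have bl1: "bounded_linear Q1" unfolding Q1_def
    by (intro bounded_linear_add bounded_linear_compose[OF blC] bl2 bounded_linear_compose[OF blR] I.bounded_linear)
  have eqR: "w = const_bcontfun (\<iota> q) + bcf_int T (bcf_blin Ac w + n) \<longleftrightarrow> w = C q + R (bcf_int T n)" for w q n
  proof -
    have "C q + R (bcf_int T n) = R (const_bcontfun (\<iota> q) + bcf_int T n)" by (simp add: C_def R.add)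
    moreover have "const_bcontfun (\<iota> q) + bcf_int T (bcf_blin Ac w + n)
        = (const_bcontfun (\<iota> q) + bcf_int T n) + bcf_int T (bcf_blin Ac w)" by (simp add: I.add)
    ultimately show ?thesis using R Ru by metis
  qed
  have eqB: "\<beta> (E (C q + R (bcf_int T n)), q) = B q + \<beta> (E (R (bcf_int T n)), 0)" for q n
    unfolding B_def by (simp add: \<beta>.add[symmetric] E.add)
  have "w = Q1 n \<and> q = Q2 n \<longleftrightarrow>
       w = const_bcontfun (\<iota> q) + bcf_int T (bcf_blin Ac w + n) \<and> \<beta> (apply_bcontfun w T, q) = 0" for n w q
  proof -
    have "q = Q2 n \<longleftrightarrow> B q + \<beta> (E (R (bcf_int T n)), 0) = 0"
      unfolding Q2_def using Bi(2,3) by (metis add_eq_0_iff2)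
    then show ?thesis unfolding eqR Q1_def using eqB by (auto simp: E_def)
  qed
  with bl1 bl2 show ?thesis using that by blast
qed

lemma F0y0: "apply_bcontfun (bcf_comp F0 y0c) t = F0 (y0 (clip T t))"
proof -
  have contF0: "continuous_on U F0" by (rule C1_map_continuous_on[OF C1_mapI[OF A]])
  show ?thesis
    by (subst bcf_comp_apply[OF compact_y0 continuous_on_subset[OF contF0 U(2)] range_y0c]) simp
qed

text \<open>Written as a map of the pair so that \<open>field_op\<close> is a superposition operator
  after \<open>bcf_pair\<close> and inherits joint C^1 dependence on \<open>r\<close> and
  \<open>u\<close>.\<close>

definition "field p = F0 (snd p) + (\<lambda>(r, x). \<rho> r x) p"
definition "field_op r u = bcf_comp field (bcf_pair (r :: real, u))"

text \<open>A simplified Newton iteration: the linearisation along \<open>y0\<close> stays on the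
  left and is inverted by \<open>Q1\<close>, and what remains has a small Lipschitz constant near
  \<open>y0c\<close>. The velocity \<open>field_op r (Y r)\<close> is part of the conclusion because
  its convergence and smoothness later give those of the H^1 family.\<close>

theorem shooting_family:
  obtains r0 \<delta> Y P where "r0 > 0" "\<delta> > 0"
    "\<forall>r\<in>{0<..<r0}. solves r (apply_bcontfun (Y r)) (P r) \<and> (\<forall>t. apply_bcontfun (Y r) t \<in> U \<and>
       apply_bcontfun (field_op r (Y r)) t = F0 (apply_bcontfun (Y r) t) + \<rho> r (apply_bcontfun (Y r) t))"
    "\<forall>r\<in>{0<..<r0}. \<forall>y q. solves r y q \<longrightarrow> (\<forall>t\<in>{0..T}. norm (y t - y0 t) \<le> \<delta>) \<longrightarrow>
       q = P r \<and> (\<forall>t\<in>{0..T}. y t = apply_bcontfun (Y r) t)"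
    "(Y \<longlongrightarrow> y0c) (at_right 0)" "(P \<longlongrightarrow> q0) (at_right 0)"
    "C1_map {0<..<r0} P" "C1_map {0<..<r0} (\<lambda>r. field_op r (Y r))"
    "((\<lambda>r. field_op r (Y r)) \<longlongrightarrow> bcf_comp F0 y0c) (at_right 0)"
proof -
  obtain Q1 Q2 where bl1: "bounded_linear Q1" and bl2: "bounded_linear Q2" and
    Q': "\<forall>n w q. w = Q1 n \<and> q = Q2 n \<longleftrightarrow>
       w = const_bcontfun (\<iota> q) + bcf_int T (bcf_blin Ac w + n) \<and> \<beta> (apply_bcontfun w T, q) = 0"
    using linear_bvp .
  note Q = Q'[rule_format]
  interpret Q1: bounded_linear Q1 by (rule bl1)
  interpret Q2: bounded_linear Q2 by (rule bl2)
  interpret bb: bounded_bilinear "bcf_blin :: (real \<Rightarrow>\<^sub>C 'y \<Rightarrow>\<^sub>L 'y) \<Rightarrow> _" by (rule bounded_bilinear_bcf_blin)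
  obtain M where M: "M > 0" "\<And>n. norm (Q1 n) \<le> norm n * M" using Q1.pos_bounded by blast
  \<comment> \<open>Both the nonlinear remainder of \<open>F0\<close> and the perturbation
    \<open>\<rho>\<close> get Lipschitz constant \<open>e\<close>; then
    \<open>2 * e * M = 1/2\<close> is the contraction factor.\<close>
  define e where "e = 1 / (4 * M)"
  have e: "e > 0" "e * M = 1/4" using M(1) by (simp_all add: e_def)
  obtain d where d: "d > 0" "\<forall>x\<in>y0 ` {0..T}. ball x d \<subseteq> U"
    "\<forall>x\<in>y0 ` {0..T}. \<forall>y\<in>ball x d. \<forall>y'\<in>ball x d. norm (F0 y - F0 y' - A x (y - y')) \<le> e * norm (y - y')"
    using strict_derivative_compact[OF compact_y0 U(2) U(1) A e(1)] by metis
  \<comment> \<open>Half of \<open>d\<close>, so that the closed tube of this radius lies in the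
    open balls where the estimate holds.\<close>
  define \<delta> where "\<delta> = d / 2"
  have \<delta>: "\<delta> > 0" "\<delta> < d" using d(1) by (auto simp: \<delta>_def)
  define K where "K = {x + y | x y. x \<in> y0 ` {0..T} \<and> y \<in> cball 0 \<delta>}"
  have K: "compact K" unfolding K_def by (rule compact_tube[OF compact_y0])
  have KI: "z \<in> K" if "x \<in> y0 ` {0..T}" "norm (z - x) \<le> \<delta>" for x z
    unfolding K_def using that by (intro CollectI exI[of _ x] exI[of _ "z - x"]) auto
  have KU: "K \<subseteq> U"
  proof
    fix z assume "z \<in> K"
    then obtain x y where xy: "z = x + y" "x \<in> y0 ` {0..T}" "norm y \<le> \<delta>" by (auto simp: K_def)
    then have "z \<in> ball x d" using \<delta> by (simp add: dist_norm)
    then show "z \<in> U" using d(2) xy(2) by blast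
  qed
  obtain R where R: "K \<subseteq> ball 0 R" "R > 0"
    using compact_imp_bounded[OF K] bounded_subset_ballD by blast
  obtain r1 where r1: "r1 > 0"
    "\<forall>r\<in>{0<..<r1}. \<forall>x\<in>ball 0 R. \<forall>y\<in>ball 0 R. norm (\<rho> r x - \<rho> r y) \<le> e * norm (x - y)"
    using \<rho>_lip[OF e(1)] by metis
  obtain r2 where r2: "r2 > 0" "C1_map ({0<..<r2} \<times> ball 0 R) (\<lambda>(r, x). \<rho> r x)" using \<rho>_C1 by metis
  define r3 where "r3 = min r1 r2"
  have r3: "r3 > 0" "r3 \<le> r1" "r3 \<le> r2" using r1(1) r2(1) by (auto simp: r3_def)
  define V where "V = {0<..<r3} \<times> (U \<inter> ball 0 R)"
  have V: "open V" unfolding V_def by (intro open_Times open_Int U) auto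
  have fieldC1: "C1_map V field"
    unfolding field_def
  proof (rule C1_map_add)
    show "C1_map V (\<lambda>p. F0 (snd p))"
      by (rule C1_map_compose_snd[of U]) (use A in \<open>auto simp: V_def intro: C1_mapI\<close>)
    show "C1_map V (\<lambda>(r, x). \<rho> r x)"
      by (rule C1_map_subset[OF r2(2)]) (use r3 in \<open>auto simp: V_def\<close>)
  qed
  have into: "range (apply_bcontfun u) \<subseteq> K" if "u \<in> cball y0c \<delta>" for u
  proof
    fix z assume "z \<in> range (apply_bcontfun u)"
    then obtain t where t: "z = apply_bcontfun u t" by auto
    have "norm (z - y0 (clip T t)) \<le> \<delta>"
      using norm_bounded[of "u - y0c" t] that t by (simp add: dist_norm norm_minus_commute)
    then show "z \<in> K" by (rule KI[rotated]) (use T in auto)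
  qed
  have inR: "apply_bcontfun u t \<in> ball 0 R" if "u \<in> cball y0c \<delta>" for u t
    using into[OF that] R(1) by blast
  have VK: "compact ({a..b} \<times> K)" "{a..b} \<times> K \<subseteq> V" if "0 < a" "b < r3" for a b
    using that K KU R by (auto simp: V_def intro: compact_Times)
  have pair_into: "bcf_pair (r, u) \<in> bcf_into ({a..b} \<times> K)" if "u \<in> cball y0c \<delta>" "r \<in> {a..b}" for a b r u
    using into[OF that(1)] that(2) by auto
  have fop: "apply_bcontfun (field_op r u) t = F0 (apply_bcontfun u t) + \<rho> r (apply_bcontfun u t)"
    if "u \<in> cball y0c \<delta>" "r \<in> {0<..<r3}" for u r t
  proof -
    have "continuous_on ({r..r} \<times> K) field"
      by (rule continuous_on_subset[OF C1_map_continuous_on[OF fieldC1]]) (rule VK, use that in auto)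
    then show ?thesis
      unfolding field_op_def
      by (subst bcf_comp_apply[OF VK(1), of r r]) (use that pair_into[OF that(1), of r r r] in \<open>auto simp: field_def\<close>)
  qed
  \<comment> \<open>The superposition lemma needs values in a compact subset of \<open>V\<close>, so
    \<open>r\<close> is kept in a compact window inside the open interval and the local results are
    glued.\<close>
  have fopC1: "C1_map ({0<..<r3} \<times> ball y0c \<delta>) (\<lambda>p. field_op (fst p) (snd p))"
  proof (rule C1_map_locally)
    fix p assume p: "p \<in> {0<..<r3} \<times> ball y0c \<delta>"
    define a where "a = fst p / 2"
    define b where "b = (fst p + r3) / 2"
    have ab: "0 < a" "b < r3" "a < fst p" "fst p < b" using p by (auto simp: a_def b_def)
    have "C1_map ({a<..<b} \<times> ball y0c \<delta>) (\<lambda>p. bcf_comp field (bcf_pair p))"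
    proof (rule C1_map_compose[OF C1_map_bounded_linear[OF bounded_linear_bcf_pair]])
      show "C1_map (bcf_into ({a..b} \<times> K)) (bcf_comp field)"
        by (rule C1_map_bcf_comp[OF VK[OF ab(1,2)] V fieldC1])
      show "bcf_pair q \<in> bcf_into ({a..b} \<times> K)" if "q \<in> {a<..<b} \<times> ball y0c \<delta>" for q
        using pair_into[of "snd q" "fst q" a b] that by (auto simp: mem_Times_iff)
    qed
    then show "\<exists>V. open V \<and> p \<in> V \<and> C1_map V (\<lambda>p. field_op (fst p) (snd p))"
      unfolding field_op_def using p ab
      by (intro exI[of _ "{a<..<b} \<times> ball y0c \<delta>"]) (auto intro!: open_Times)
  qed
  \<comment> \<open>Its fixed points are the first components of solutions; the second component is
    recovered by \<open>Q2\<close>.\<close>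
  define \<Psi> where "\<Psi> r u = Q1 (field_op r u - bcf_blin Ac u)" for r u
  have key: "norm (field_op r u - field_op r v - bcf_blin Ac (u - v)) \<le> 2 * e * norm (u - v)"
    if r: "r \<in> {0<..<r3}" and u: "u \<in> cball y0c \<delta>" and v: "v \<in> cball y0c \<delta>" for r u v
  proof (rule norm_bound)
    fix t
    define a b where "a = apply_bcontfun u t" and "b = apply_bcontfun v t"
    have x: "y0 (clip T t) \<in> y0 ` {0..T}" using T by auto
    have "a \<in> ball (y0 (clip T t)) d" "b \<in> ball (y0 (clip T t)) d"
      using dist_bounded[of y0c t u] dist_bounded[of y0c t v] u v \<delta> by (auto simp: a_def b_def)
    then have 1: "norm (F0 a - F0 b - A (y0 (clip T t)) (a - b)) \<le> e * norm (a - b)" using d(3) x by blast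
    have "a \<in> ball 0 R" "b \<in> ball 0 R" unfolding a_def b_def by (intro inR u v)+
    then have 2: "norm (\<rho> r a - \<rho> r b) \<le> e * norm (a - b)" using r1(2) r r3 by auto
    have 3: "norm (a - b) \<le> norm (u - v)" using norm_bounded[of "u - v" t] by (simp add: a_def b_def)
    have "apply_bcontfun (field_op r u - field_op r v - bcf_blin Ac (u - v)) t =
        (F0 a - F0 b - A (y0 (clip T t)) (a - b)) + (\<rho> r a - \<rho> r b)"
      using fop[OF u r] fop[OF v r] by (simp add: a_def b_def)
    then have "norm (apply_bcontfun (field_op r u - field_op r v - bcf_blin Ac (u - v)) t) \<le> e * norm (a - b) + e * norm (a - b)"
      using 1 2 norm_triangle_mono by metis
    also have "\<dots> \<le> 2 * e * norm (u - v)" using 3 e(1) by simp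
    finally show "norm (apply_bcontfun (field_op r u - field_op r v - bcf_blin Ac (u - v)) t) \<le> 2 * e * norm (u - v)" .
  qed
  have lip: "norm (\<Psi> r u - \<Psi> r v) \<le> norm (u - v) / 2"
    if r: "r \<in> {0<..<r3}" and u: "u \<in> cball y0c \<delta>" and v: "v \<in> cball y0c \<delta>" for r u v
  proof -
    have "\<Psi> r u - \<Psi> r v = Q1 (field_op r u - field_op r v - bcf_blin Ac (u - v))"
      unfolding \<Psi>_def Q1.diff[symmetric] bb.diff_right by (simp add: algebra_simps)
    then have "norm (\<Psi> r u - \<Psi> r v) \<le> norm (field_op r u - field_op r v - bcf_blin Ac (u - v)) * M" using M(2) by metis
    also have "\<dots> \<le> (2 * e * norm (u - v)) * M" using key[OF that] M(1) by (intro mult_right_mono) auto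
    also have "\<dots> = 2 * (e * M) * norm (u - v)" by simp
    finally show ?thesis unfolding e by simp
  qed
  have y0c_in: "y0c \<in> cball y0c \<delta>" using \<delta> by simp
  have fixy0: "y0c = Q1 (bcf_comp F0 y0c - bcf_blin Ac y0c) \<and> q0 = Q2 (bcf_comp F0 y0c - bcf_blin Ac y0c)"
    unfolding Q
  proof (intro conjI bcontfun_eqI)
    fix t
    have ct: "clip T t \<in> {0..T}" using T by auto
    have "integral {0..clip T t} (apply_bcontfun (bcf_comp F0 y0c)) = integral {0..clip T t} (\<lambda>s. F0 (y0 s))"
      by (rule Henstock_Kurzweil_Integration.integral_cong) (use ct in \<open>auto simp: F0y0\<close>)
    then show "apply_bcontfun y0c t = apply_bcontfun (const_bcontfun (\<iota> q0) +
        bcf_int T (bcf_blin Ac y0c + (bcf_comp F0 y0c - bcf_blin Ac y0c))) t"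
      using y0(2)[OF ct] by (simp add: bcf_int_apply[OF T0])
    show "\<beta> (apply_bcontfun y0c T, q0) = 0" using y0(3) T by simp
  qed
  have field_lim0: "((\<lambda>r. field_op r y0c) \<longlongrightarrow> bcf_comp F0 y0c) (at_right 0)"
  proof (rule tendstoI)
    fix \<epsilon> :: real assume "\<epsilon> > 0"
    define e' where "e' = \<epsilon> / (2 * R)"
    have e': "e' > 0" "e' * R < \<epsilon>" using \<open>\<epsilon> > 0\<close> R(2) by (auto simp: e'_def)
    obtain r4 where r4: "r4 > 0"
      "\<forall>r\<in>{0<..<r4}. \<forall>x\<in>ball 0 R. \<forall>y\<in>ball 0 R. norm (\<rho> r x - \<rho> r y) \<le> e' * norm (x - y)"
      using \<rho>_lip[OF e'(1)] by metis
    have "dist (field_op r y0c) (bcf_comp F0 y0c) < \<epsilon>" if "r > 0" "r < min r3 r4" for r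
    proof -
      have "dist (field_op r y0c) (bcf_comp F0 y0c) \<le> e' * R"
      proof (rule dist_bound)
        fix t
        have x: "y0 (clip T t) \<in> ball 0 R" using inR[OF y0c_in, of t] by simp
        then have "norm (\<rho> r (y0 (clip T t)) - \<rho> r 0) \<le> e' * norm (y0 (clip T t) - 0)"
          using r4(2)[rule_format, of r "y0 (clip T t)" 0] that R(2) by auto
        also have "\<dots> \<le> e' * R" using x e' by (intro mult_left_mono) auto
        finally show "dist (apply_bcontfun (field_op r y0c) t) (apply_bcontfun (bcf_comp F0 y0c) t) \<le> e' * R"
          using fop[OF y0c_in, of r t] that by (simp add: F0y0 \<rho>0 dist_norm)
      qed
      then show ?thesis using e' by simp
    qed
    then show "\<forall>\<^sub>F r in at_right 0. dist (field_op r y0c) (bcf_comp F0 y0c) < \<epsilon>"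
      unfolding eventually_at_right_field using r3 r4 by (intro exI[of _ "min r3 r4"]) auto
  qed
  have lim: "((\<lambda>r. \<Psi> r y0c) \<longlongrightarrow> y0c) (at_right 0)"
  proof -
    have "((\<lambda>r. \<Psi> r y0c) \<longlongrightarrow> Q1 (bcf_comp F0 y0c - bcf_blin Ac y0c)) (at_right 0)"
      unfolding \<Psi>_def by (intro Q1.tendsto tendsto_diff field_lim0 tendsto_const)
    then show ?thesis using fixy0 by simp
  qed
  obtain r0 Y where r0: "r0 > 0" "r0 \<le> r3" and Y': "\<forall>r\<in>{0<..<r0}. Y r \<in> ball y0c \<delta> \<and> \<Psi> r (Y r) = Y r \<and>
      (\<forall>x\<in>cball y0c \<delta>. \<Psi> r x = x \<longrightarrow> x = Y r)"
    and Ylim: "(Y \<longlongrightarrow> y0c) (at_right 0)"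
    using fixed_point_family[of \<delta> r3 y0c \<Psi>, OF \<delta>(1) r3(1) lip lim] .
  have Y: "Y r \<in> ball y0c \<delta> \<and> \<Psi> r (Y r) = Y r" if "r \<in> {0<..<r0}" for r using Y' that by blast
  have Yu: "x = Y r" if "r \<in> {0<..<r0}" "x \<in> cball y0c \<delta>" "\<Psi> r x = x" for r x using Y' that by blast
  have r0_r3: "r \<in> {0<..<r3}" if "r \<in> {0<..<r0}" for r using that r0 by auto
  define P where "P r = Q2 (field_op r (Y r) - bcf_blin Ac (Y r))" for r
  have YC1: "C1_map {0<..<r0} Y"
  proof (rule fixed_point_family_C1[of r0 y0c \<delta> \<Psi> Y, OF _ Y])
    show "norm (\<Psi> r u - \<Psi> r v) \<le> norm (u - v) / 2"
      if "r \<in> {0<..<r0}" "u \<in> ball y0c \<delta>" "v \<in> ball y0c \<delta>" for r u v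
      by (rule lip[OF r0_r3[OF that(1)]]) (use that in auto)
    have "C1_map ({0<..<r0} \<times> ball y0c \<delta>) (\<lambda>p. \<Psi> (fst p) (snd p))"
      unfolding \<Psi>_def
      by (intro C1_map_linear_compose[OF bl1] C1_map_diff C1_map_subset[OF fopC1]
          C1_map_bounded_linear bounded_linear_compose[OF bb.bounded_linear_right] bounded_linear_snd)
         (use r0 in auto)
    then show "C1_map ({0<..<r0} \<times> ball y0c \<delta>) (\<lambda>(r, x). \<Psi> r x)"
      by (simp add: case_prod_unfold)
  qed
  have fY: "C1_map {0<..<r0} (\<lambda>r. field_op r (Y r))"
    using C1_map_compose[OF C1_map_Pair[OF C1_map_ident YC1] fopC1] Y r0 by auto
  have PC1: "C1_map {0<..<r0} P" unfolding P_def
    by (intro C1_map_linear_compose[OF bl2] C1_map_diff fY C1_map_linear_compose[OF bb.bounded_linear_right] YC1)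
  \<comment> \<open>The field operator is Lipschitz in \<open>u\<close> with constant
    \<open>2 * e + norm Ac\<close> independent of \<open>r\<close>, so convergence of
    \<open>Y\<close> carries over to the velocities.\<close>
  have fYlim: "((\<lambda>r. field_op r (Y r)) \<longlongrightarrow> bcf_comp F0 y0c) (at_right 0)"
  proof (rule Lim_transform2[OF field_lim0])
    have ev: "\<forall>\<^sub>F r in at_right 0. norm (field_op r y0c - field_op r (Y r)) \<le> (2 * e + norm Ac) * norm (y0c - Y r)"
      unfolding eventually_at_right_field
    proof (intro exI[of _ r0] conjI allI impI r0)
      fix r assume "0 < r" "r < r0"
      then have r: "r \<in> {0<..<r0}" by simp
      have "norm (field_op r y0c - field_op r (Y r) - bcf_blin Ac (y0c - Y r)) \<le> 2 * e * norm (y0c - Y r)"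
        by (rule key[OF r0_r3[OF r] y0c_in]) (use Y[OF r] in auto)
      moreover have "norm (bcf_blin Ac (y0c - Y r)) \<le> norm Ac * norm (y0c - Y r)"
        by (rule norm_bound) (simp add: norm_blin_bcf_le[of Ac _ "y0c - Y r", simplified])
      ultimately have "norm (field_op r y0c - field_op r (Y r)) \<le> 2 * e * norm (y0c - Y r) + norm Ac * norm (y0c - Y r)"
        using norm_triangle_sub[of "field_op r y0c - field_op r (Y r)" "bcf_blin Ac (y0c - Y r)"] by linarith
      then show "norm (field_op r y0c - field_op r (Y r)) \<le> (2 * e + norm Ac) * norm (y0c - Y r)" by (simp add: algebra_simps)
    qed
    have "((\<lambda>r. (2 * e + norm Ac) * norm (y0c - Y r)) \<longlongrightarrow> (2 * e + norm Ac) * norm (y0c - y0c)) (at_right 0)"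
      by (intro tendsto_intros Ylim)
    then show "((\<lambda>r. field_op r y0c - field_op r (Y r)) \<longlongrightarrow> 0) (at_right 0)"
      by (intro Lim_null_comparison[OF ev]) simp
  qed
  have Plim: "(P \<longlongrightarrow> q0) (at_right 0)"
  proof -
    have "(P \<longlongrightarrow> Q2 (bcf_comp F0 y0c - bcf_blin Ac y0c)) (at_right 0)"
      unfolding P_def by (intro Q2.tendsto tendsto_diff fYlim bounded_linear.tendsto[OF bb.bounded_linear_right] Ylim)
    then show ?thesis using fixy0 by simp
  qed
  have sol_iff: "u = Q1 (field_op r u - bcf_blin Ac u) \<and> q = Q2 (field_op r u - bcf_blin Ac u) \<longleftrightarrow>
      (\<forall>t. apply_bcontfun u t = \<iota> q + integral {0..clip T t} (\<lambda>s. F0 (apply_bcontfun u s) + \<rho> r (apply_bcontfun u s))) \<and>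
      \<beta> (apply_bcontfun u T, q) = 0"
    if "r \<in> {0<..<r0}" "u \<in> cball y0c \<delta>" for r u q
  proof -
    have eq: "apply_bcontfun (const_bcontfun (\<iota> q) + bcf_int T (bcf_blin Ac u + (field_op r u - bcf_blin Ac u))) t =
       \<iota> q + integral {0..clip T t} (\<lambda>s. F0 (apply_bcontfun u s) + \<rho> r (apply_bcontfun u s))" for t
    proof -
      have "apply_bcontfun (field_op r u) = (\<lambda>s. F0 (apply_bcontfun u s) + \<rho> r (apply_bcontfun u s))"
        by (rule ext) (rule fop[OF that(2) r0_r3[OF that(1)]])
      then show ?thesis by (simp add: bcf_int_apply[OF T0])
    qed
    have E: "u = X \<longleftrightarrow> (\<forall>t. apply_bcontfun u t = apply_bcontfun X t)" for X by (auto intro: bcontfun_eqI)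
    show ?thesis unfolding Q by (simp only: E eq)
  qed
  show ?thesis
  proof (rule that[OF r0(1) \<delta>(1) _ _ Ylim Plim PC1 fY fYlim]; intro ballI allI impI)
    fix r assume r: "r \<in> {0<..<r0}"
    have Yr: "Y r \<in> cball y0c \<delta>" "Y r = Q1 (field_op r (Y r) - bcf_blin Ac (Y r))" using Y[OF r] by (auto simp: \<Psi>_def)
    have "Y r = Q1 (field_op r (Y r) - bcf_blin Ac (Y r)) \<and> P r = Q2 (field_op r (Y r) - bcf_blin Ac (Y r))"
      using Yr(2) unfolding P_def by blast
    from this[unfolded sol_iff[OF r Yr(1)]] have "solves r (apply_bcontfun (Y r)) (P r)"
      unfolding solves_def using T by (metis atLeastAtMost_iff clip_simps(1) continuous_on_apply_bcontfun)
    moreover have "apply_bcontfun (field_op r (Y r)) t = F0 (apply_bcontfun (Y r) t) + \<rho> r (apply_bcontfun (Y r) t)" for t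
      by (rule fop[OF Yr(1) r0_r3[OF r]])
    moreover have "apply_bcontfun (Y r) t \<in> U" for t using into[OF Yr(1)] KU by auto
    ultimately show "solves r (apply_bcontfun (Y r)) (P r) \<and> (\<forall>t. apply_bcontfun (Y r) t \<in> U \<and>
       apply_bcontfun (field_op r (Y r)) t = F0 (apply_bcontfun (Y r) t) + \<rho> r (apply_bcontfun (Y r) t))"
      by blast
  next
    fix r y q assume r: "r \<in> {0<..<r0}" and y: "solves r y q" and "\<forall>t\<in>{0..T}. norm (y t - y0 t) \<le> \<delta>"
    then have near: "norm (y t - y0 t) \<le> \<delta>" if "t \<in> {0..T}" for t using that by blast
    have yc: "continuous_on {0..T} y" using y by (simp add: solves_def)
    \<comment> \<open>The constant extension of \<open>y\<close> satisfies the clipped integral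
      equation on the whole line, which puts it within reach of the uniqueness of the fixed
      point.\<close>
    define u where "u = Bcontfun (\<lambda>t. y (clip T t))"
    have u: "apply_bcontfun u t = y (clip T t)" for t
      unfolding u_def using bcontfun_clip[OF T0 yc] by (simp add: Bcontfun_inverse)
    have u_in: "u \<in> cball y0c \<delta>"
      unfolding mem_cball
    proof (rule dist_bound)
      show "dist (apply_bcontfun y0c t) (apply_bcontfun u t) \<le> \<delta>" for t
        using near[of "clip T t"] T by (simp add: u dist_norm norm_minus_commute)
    qed
    have "apply_bcontfun u t = \<iota> q + integral {0..clip T t} (\<lambda>s. F0 (apply_bcontfun u s) + \<rho> r (apply_bcontfun u s))" for t
    proof -
      have ct: "clip T t \<in> {0..T}" using T by auto
      have "integral {0..clip T t} (\<lambda>s. F0 (apply_bcontfun u s) + \<rho> r (apply_bcontfun u s)) =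
         integral {0..clip T t} (\<lambda>s. F0 (y s) + \<rho> r (y s))"
        by (rule Henstock_Kurzweil_Integration.integral_cong) (use ct in \<open>auto simp: u\<close>)
      then show ?thesis using y ct unfolding solves_def u by simp
    qed
    moreover have "\<beta> (apply_bcontfun u T, q) = 0"
      using y clip_simps(1)[OF T0 order_refl] unfolding solves_def u by metis
    ultimately have *: "u = Q1 (field_op r u - bcf_blin Ac u) \<and> q = Q2 (field_op r u - bcf_blin Ac u)"
      using sol_iff[OF r u_in] by blast
    then have "u = Y r" using Yu[OF r u_in] unfolding \<Psi>_def by metis
    moreover have "y t = apply_bcontfun u t" if "t \<in> {0..T}" for t using that by (simp add: u)
    ultimately show "q = P r \<and> (\<forall>t\<in>{0..T}. y t = apply_bcontfun (Y r) t)"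
      using * unfolding P_def by metis
  qed
qed

end

section \<open>Periodic \<open>H\<^sup>1\<close> functions\<close>

text \<open>The representative of \<open>t\<close> modulo \<open>2 * pi\<close> in the half-open
  interval; in particular \<open>2 * pi\<close> goes to 0.\<close>

definition wrap :: "real \<Rightarrow> real" where "wrap t = t - 2 * pi * \<lfloor>t / (2 * pi)\<rfloor>"

lemma wrap_bounds: "0 \<le> wrap t" "wrap t < 2 * pi"
proof -
  define k where "k = \<lfloor>t / (2*pi)\<rfloor>"
  have "of_int k \<le> t / (2*pi)" "t / (2*pi) < of_int k + 1"
    unfolding k_def by linarith+
  then have "2 * pi * of_int k \<le> t" "t < 2 * pi * (of_int k + 1)"
    by (simp_all add: field_simps)
  then show "0 \<le> wrap t" "wrap t < 2 * pi" by (simp_all add: wrap_def k_def algebra_simps)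
qed

lemma wrap_add [simp]: "wrap (t + 2 * pi) = wrap t"
proof -
  have "(t + 2 * pi) / (2 * pi) = t / (2 * pi) + 1" by (simp add: field_simps)
  then show ?thesis by (simp add: wrap_def algebra_simps)
qed

lemma wrap_id: "0 \<le> t \<Longrightarrow> t < 2 * pi \<Longrightarrow> wrap t = t"
  by (simp add: wrap_def floor_eq_iff)

lemma periodic_int:
  fixes k :: int
  assumes "\<And>t. f (t + 2 * pi) = f t"
  shows "f (t + 2 * pi * k) = f t"
proof -
  interpret periodic_fun_simple f "2*pi" by standard (rule assms)
  show ?thesis using plus_of_int[of t k] by (simp add: mult.commute)
qed

lemma periodic_wrap:
  assumes "\<And>t. f (t + 2 * pi) = f t" shows "f (wrap t) = f t"
  using periodic_int[of f "wrap t" "\<lfloor>t / (2*pi)\<rfloor>", OF assms] by (simp add: wrap_def)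

lemma wrap_measurable [measurable]: "wrap \<in> borel_measurable borel"
  unfolding wrap_def by measurable

lemma has_weak_deriv_vector_derivative:
  fixes u :: "real \<Rightarrow> 'a::euclidean_space"
  assumes u: "has_weak_deriv u v" and v: "continuous_on UNIV v"
  shows "(u has_vector_derivative v t) (at t)"
proof -
  define a where "a = t - 1"
  have "((\<lambda>x. integral {a..x} v) has_vector_derivative v t) (at t within {a..t+1})"
    by (rule integral_has_vector_derivative) (use v in \<open>auto intro: continuous_on_subset simp: a_def\<close>)
  then have "((\<lambda>x. u a + integral {a..x} v) has_vector_derivative v t) (at t within {a..t+1})"
    by (auto intro!: derivative_eq_intros)
  then have "(u has_vector_derivative v t) (at t within {a..t+1})"
  proof (rule has_vector_derivative_transform[rotated 2])
    show "t \<in> {a..t+1}" by (simp add: a_def)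
    fix x assume "x \<in> {a..t+1}"
    then have "u x - u a = (LINT s:{a..x}|lborel. v s)" using u by (simp add: has_weak_deriv_def)
    then show "u x = u a + integral {a..x} v"
      using set_borel_integral_eq_integral(2)[OF has_weak_deriv_set_integrable[OF u, of a x]]
      by (simp add: algebra_simps)
  qed
  moreover have "at t within {a..t+1} = at t"
    by (rule at_within_interior) (simp add: interior_atLeastAtMost_real a_def)
  ultimately show ?thesis by simp
qed

text \<open>Bounds an L^1 norm by the length of the interval plus a squared L^2 norm, which takes
  the place of the Cauchy-Schwarz inequality below.\<close>

lemma square_bound: "x \<le> 1 + x\<^sup>2" for x :: real
proof -
  have "0 \<le> (x - 1/2)\<^sup>2" by simp
  then show ?thesis by (simp add: power2_eq_square algebra_simps)
qed

lemma h1_norm_integrals: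
  "(norm u)\<^sup>2 = (LINT t:{0..2*pi}|lborel. (norm (h1_fun u t))\<^sup>2) + (LINT t:{0..2*pi}|lborel. (norm (h1_deriv u t))\<^sup>2)"
  unfolding power2_norm_eq_inner inner_h1per_def ..

text \<open>By homogeneity only the unit sphere matters.\<close>
lemma h1_sup_bound:
  obtains C where "C > 0" "\<And>(u :: 'a::euclidean_space h1per) t. norm (h1_fun u t) \<le> C * norm u"
proof -
  \<comment> \<open>On the unit sphere both squared L^2 norms are at most 1, so by
    \<open>square_bound\<close> this bounds the L^1 norms of the function and of its derivative over
    one period.\<close>
  define B where "B = 2 * pi + 1"
  have sphere: "norm (h1_fun u t) \<le> 2 * B" if u: "norm u = 1" for u :: "'a h1per" and t
  proof -
    let ?I = "{0..2*pi}"
    have si: "set_integrable lborel ?I (\<lambda>t. (norm (h1_fun u t))\<^sup>2)" "set_integrable lborel ?I (\<lambda>t. (norm (h1_deriv u t))\<^sup>2)"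
      using h1_fun_inner_integrable[of 0 "2*pi" u u] h1_deriv_inner_integrable[of 0 "2*pi" u u]
      by (simp_all add: power2_norm_eq_inner)
    have nn: "0 \<le> (LINT t:?I|lborel. (norm (h1_fun u t))\<^sup>2)" "0 \<le> (LINT t:?I|lborel. (norm (h1_deriv u t))\<^sup>2)"
      unfolding set_lebesgue_integral_def by (auto intro!: Bochner_Integration.integral_nonneg)
    have le1: "(LINT t:?I|lborel. (norm (h1_fun u t))\<^sup>2) \<le> 1" "(LINT t:?I|lborel. (norm (h1_deriv u t))\<^sup>2) \<le> 1"
      using h1_norm_integrals[of u] nn u by auto
    have c1: "(LINT t:?I|lborel. (1::real)) = 2 * pi" by (simp add: set_lebesgue_integral_def)
    have meas: "h1_fun u \<in> borel_measurable borel"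
      by (intro borel_measurable_continuous_onI h1_fun_continuous)
    have siu: "set_integrable lborel ?I (\<lambda>t. norm (h1_fun u t))" "set_integrable lborel {a..b} (\<lambda>t. norm (h1_deriv u t))" for a b
      by (intro borel_integrable_atLeastAtMost' continuous_intros h1_fun_continuous)
         (intro set_integrable_norm has_weak_deriv_set_integrable[OF h1_deriv])
    have L1: "(LINT t:?I|lborel. norm (h1_fun u t)) \<le> B" "(LINT t:?I|lborel. norm (h1_deriv u t)) \<le> B"
    proof -
      have "(LINT t:?I|lborel. norm (h1_fun u t)) \<le> (LINT t:?I|lborel. 1 + (norm (h1_fun u t))\<^sup>2)"
        by (intro set_integral_mono siu set_integral_add si set_integrable_const_Icc square_bound)
      then show "(LINT t:?I|lborel. norm (h1_fun u t)) \<le> B"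
        using le1(1) c1 by (simp add: set_integral_add(2)[OF set_integrable_const_Icc si(1)] B_def)
      have "(LINT t:?I|lborel. norm (h1_deriv u t)) \<le> (LINT t:?I|lborel. 1 + (norm (h1_deriv u t))\<^sup>2)"
        by (intro set_integral_mono siu set_integral_add si set_integrable_const_Icc square_bound)
      then show "(LINT t:?I|lborel. norm (h1_deriv u t)) \<le> B"
        using le1(2) c1 by (simp add: set_integral_add(2)[OF set_integrable_const_Icc si(2)] B_def)
    qed
    have osc: "norm (h1_fun u b - h1_fun u a) \<le> B" if "a \<in> ?I" "b \<in> ?I" "a \<le> b" for a b
    proof -
      have "h1_fun u b - h1_fun u a = (LINT t:{a..b}|lborel. h1_deriv u t)"
        using h1_deriv[of u] that by (simp add: has_weak_deriv_def)
      also have "norm \<dots> \<le> (LINT t:{a..b}|lborel. norm (h1_deriv u t))"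
        by (rule set_integral_norm_bound) (rule has_weak_deriv_set_integrable[OF h1_deriv])
      also have "\<dots> \<le> (LINT t:?I|lborel. norm (h1_deriv u t))"
        using siu(2)[of a b] siu(2)[of 0 "2*pi"] that unfolding set_lebesgue_integral_def set_integrable_def
        by (intro integral_mono) (auto simp: indicator_def)
      finally show ?thesis using L1(2) by simp
    qed
    have "norm (h1_fun u s) \<le> 2 * B" if s: "s \<in> ?I" for s
    proof -
      \<comment> \<open>The function oscillates by at most \<open>B\<close>; averaging this lower
        bound over the period compares the value at \<open>s\<close> with the L^1 norm.\<close>
      have "norm (h1_fun u s) - B \<le> norm (h1_fun u x)" if "x \<in> ?I" for x
        using osc[of s x] osc[of x s] s that norm_triangle_sub[of "h1_fun u s" "h1_fun u x"]
        by (cases "s \<le> x") (auto simp: norm_minus_commute)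
      then have "(LINT x:?I|lborel. norm (h1_fun u s) - B) \<le> (LINT t:?I|lborel. norm (h1_fun u t))"
        by (intro set_integral_mono siu set_integrable_const_Icc) auto
      moreover have "(LINT x:?I|lborel. norm (h1_fun u s) - B) = 2 * pi * (norm (h1_fun u s) - B)"
        by (simp add: set_lebesgue_integral_def)
      ultimately have "2 * pi * (norm (h1_fun u s) - B) \<le> B" using L1 by simp
      moreover have "B \<le> 2 * pi * B" using pi_gt3 by (simp add: B_def)
      ultimately have "2 * pi * (norm (h1_fun u s) - B) \<le> 2 * pi * B" by linarith
      then show ?thesis by simp
    qed
    moreover have "wrap t \<in> ?I" using wrap_bounds[of t] by simp
    ultimately show ?thesis using periodic_wrap[of "h1_fun u" t, OF h1_fun_periodic] by metis
  qed
  show ?thesis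
  proof
    show "2 * B > 0" using pi_gt3 by (simp add: B_def)
    fix u :: "'a h1per" and t
    show "norm (h1_fun u t) \<le> 2 * B * norm u"
    proof (cases "u = 0")
      case False
      have "norm (h1_fun ((1 / norm u) *\<^sub>R u) t) \<le> 2 * B" by (rule sphere) (use False in simp)
      then show ?thesis using False by (simp add: field_simps)
    qed simp
  qed
qed

lemma h1_norm_le:
  assumes w: "has_weak_deriv (h1_fun u) v" and a: "\<And>t. norm (h1_fun u t) \<le> a" and b: "\<And>t. norm (v t) \<le> b"
  shows "norm u \<le> 3 * (a + b)"
proof -
  let ?I = "{0..2*pi}"
  have ab: "a \<ge> 0" "b \<ge> 0" using a[of 0] b[of 0] norm_ge_zero order_trans by blast+
  have dv: "(LINT t:?I|lborel. h1_deriv u t \<bullet> h1_deriv u t) = (LINT t:?I|lborel. v t \<bullet> v t)"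
  proof -
    have "AE t in lborel. indicat_real ?I t *\<^sub>R (h1_deriv u t \<bullet> h1_deriv u t) = indicat_real ?I t *\<^sub>R (v t \<bullet> v t)"
      using h1_deriv_AE[OF w, of 0 "2*pi"] by eventually_elim (auto simp: indicator_def)
    moreover have [measurable]: "v \<in> borel_measurable borel" using w by (simp add: has_weak_deriv_def)
    ultimately show ?thesis
      unfolding set_lebesgue_integral_def by (intro integral_cong_AE) simp_all
  qed
  have c: "(LINT t:?I|lborel. c) = 2 * pi * c" for c :: real by (simp add: set_lebesgue_integral_def)
  have "(LINT t:?I|lborel. h1_fun u t \<bullet> h1_fun u t) \<le> (LINT t:?I|lborel. a\<^sup>2)"
    by (intro set_integral_mono h1_fun_inner_integrable set_integrable_const_Icc)
       (use a in \<open>auto simp: power2_norm_eq_inner[symmetric] intro!: power_mono\<close>)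
  moreover have "(LINT t:?I|lborel. v t \<bullet> v t) \<le> (LINT t:?I|lborel. b\<^sup>2)"
    by (intro set_integral_mono set_integrable_const_Icc)
       (use w b in \<open>auto simp: has_weak_deriv_def power2_norm_eq_inner[symmetric] intro!: power_mono\<close>)
  ultimately have "(norm u)\<^sup>2 \<le> 2 * pi * a\<^sup>2 + 2 * pi * b\<^sup>2"
    unfolding power2_norm_eq_inner inner_h1per_def dv c by linarith
  \<comment> \<open>The factor 3 of the claim comes from \<open>2 * pi < 9\<close>.\<close>
  also have "\<dots> \<le> 9 * a\<^sup>2 + 9 * b\<^sup>2" using pi_less_4 by (intro add_mono mult_right_mono) auto
  also have "\<dots> \<le> (3 * (a + b))\<^sup>2" using ab by (simp add: power2_eq_square algebra_simps)
  finally show ?thesis by (rule power2_le_imp_le) (use ab in simp)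
qed

text \<open>
  The periodic extension of \<open>t \<mapsto> p + \<integral>\<^sub>0\<^sup>t (v - m)\<close> on \<open>[0, 2\<pi>]\<close>, where \<open>m\<close> is the mean of \<open>v\<close>.
  The integral over the empty interval vanishes, so one of the two integrals below is always \<open>0\<close>.
\<close>
definition periodic_prim :: "'a::euclidean_space \<times> (real \<Rightarrow>\<^sub>C 'a) \<Rightarrow> real \<Rightarrow> 'a" where
  "periodic_prim p t = (let v = (\<lambda>s. apply_bcontfun (snd p) (wrap s) - (1 / (2 * pi)) *\<^sub>R integral {0..2*pi} (snd p))
     in fst p + integral {0..t} v - integral {t..0} v)"

text \<open>Subtracting the mean makes the integral over a period vanish, hence the primitive is
  periodic. The wrapped integrand may jump at multiples of the period, so only a weak derivative is
  claimed.\<close>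

lemma
  fixes v :: "real \<Rightarrow>\<^sub>C 'a::euclidean_space"
  defines "m \<equiv> (1 / (2 * pi)) *\<^sub>R integral {0..2*pi} v"
  shows has_weak_deriv_periodic_prim: "has_weak_deriv (periodic_prim (p, v)) (\<lambda>t. apply_bcontfun v (wrap t) - m)"
    and periodic_prim_periodic: "periodic_prim (p, v) (t + 2 * pi) = periodic_prim (p, v) t"
    and periodic_prim_eq: "t \<in> {0..2*pi} \<Longrightarrow> periodic_prim (p, v) t = p + integral {0..t} v - t *\<^sub>R m"
proof -
  define w where "w t = apply_bcontfun v (wrap t) - m" for t
  define P where "P = periodic_prim (p, v)"
  have P: "P t = p + integral {0..t} w - integral {t..0} w" for t
    unfolding P_def periodic_prim_def w_def m_def by (simp add: Let_def)
  have [measurable]: "apply_bcontfun v \<in> borel_measurable borel" by (intro borel_measurable_continuous_onI) simp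
  have wm [measurable]: "w \<in> borel_measurable borel" unfolding w_def by measurable
  have wb: "norm (w t) \<le> norm v + norm m" for t
    unfolding w_def by (intro order_trans[OF norm_triangle_ineq4] add_mono norm_bounded order_refl)
  have wsi: "set_integrable lborel {a..b} w" for a b
    by (rule set_integrable_measurable_bound[OF set_integrable_const_Icc wm wb])
  have wi: "w integrable_on {a..b}" for a b
    by (rule set_borel_integral_eq_integral(1)[OF wsi])
  have lint: "(LINT t:{a..b}|lborel. w t) = integral {a..b} w" for a b
    by (rule set_borel_integral_eq_integral(2)[OF wsi])
  have empty: "integral {b..a} w = 0" if "a \<le> b" for a b using that by (cases "a = b") auto
  have Pdiff: "P b - P a = integral {a..b} w" if "a \<le> b" for a b
  proof -
    consider "0 \<le> a" | "a \<le> 0" "0 \<le> b" | "b \<le> 0" using that by linarith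
    then show ?thesis
    proof cases
      case 1
      then show ?thesis
        using Henstock_Kurzweil_Integration.integral_combine[OF _ that wi, of 0] that
        by (auto simp: P empty algebra_simps)
    next
      case 2
      then show ?thesis
        using Henstock_Kurzweil_Integration.integral_combine[OF _ _ wi, of a 0 b]
        by (auto simp: P empty algebra_simps)
    next
      case 3
      then show ?thesis
        using Henstock_Kurzweil_Integration.integral_combine[OF that _ wi, of 0] that
        by (auto simp: P empty algebra_simps)
    qed
  qed
  show "has_weak_deriv (periodic_prim (p, v)) (\<lambda>t. apply_bcontfun v (wrap t) - m)"
    unfolding has_weak_deriv_def w_def[symmetric] P_def[symmetric]
  proof (intro conjI allI impI wm)
    show "set_integrable lborel {a..b} (\<lambda>t. (norm (w t))\<^sup>2)" for a b
      by (rule set_integrable_measurable_bound[OF set_integrable_const_Icc, of _ "(norm v + norm m)\<^sup>2"])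
         (auto intro!: power_mono wb)
    show "P b - P a = (LINT t:{a..b}|lborel. w t)" if "a \<le> b" for a b
      unfolding lint by (rule Pdiff[OF that])
  qed
  have base: "integral {0..t} w = integral {0..t} v - t *\<^sub>R m" if t: "t \<in> {0..2*pi}" for t
  proof -
    \<comment> \<open>The integrands can differ only at \<open>2 * pi\<close>, which
      \<open>wrap\<close> sends to 0; a single point does not affect the integral.\<close>
    have "integral {0..t} w = integral {0..t} (\<lambda>s. apply_bcontfun v s - m)"
      by (rule integral_spike[of "{2*pi}"]) (use t in \<open>auto simp: w_def wrap_id\<close>)
    also have "\<dots> = integral {0..t} v - t *\<^sub>R m"
      using t by (subst Henstock_Kurzweil_Integration.integral_diff) (auto intro!: integrable_continuous_interval)
    finally show ?thesis .
  qed
  show "periodic_prim (p, v) t = p + integral {0..t} v - t *\<^sub>R m" if t: "t \<in> {0..2*pi}"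
    unfolding P_def[symmetric] using base[OF t] t by (cases "t = 0") (auto simp: P)
  have wper: "w (t + 2 * pi) = w t" for t by (simp add: w_def)
  have full: "integral {0..2*pi} w = 0" using base[of "2*pi"] by (simp add: m_def)
  have shift: "integral {a..b} w = integral {a + 2 * pi * of_int k..b + 2 * pi * of_int k} w" for a b and k :: int
    using set_integral_shift[of a b w "2 * pi * of_int k"] periodic_int[of w, OF wper] by (simp add: lint)
  have "P (t + 2 * pi) - P t = integral {t..t + 2 * pi} w" by (rule Pdiff) simp
  also have "\<dots> = integral {wrap t..wrap t + 2 * pi} w"
    using shift[of "wrap t" "wrap t + 2 * pi" "\<lfloor>t / (2*pi)\<rfloor>"] by (simp add: wrap_def algebra_simps)
  also have "\<dots> = integral {wrap t..2*pi} w + integral {2*pi..wrap t + 2 * pi} w"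
    using wrap_bounds[of t] by (intro Henstock_Kurzweil_Integration.integral_combine[symmetric] wi) auto
  also have "integral {2*pi..wrap t + 2 * pi} w = integral {0..wrap t} w"
    using shift[of 0 "wrap t" 1] by simp
  also have "integral {wrap t..2*pi} w + integral {0..wrap t} w = integral {0..2*pi} w"
    using Henstock_Kurzweil_Integration.integral_combine[OF _ _ wi, of 0 "wrap t" "2*pi"] wrap_bounds[of t] by (simp add: add.commute)
  finally show "periodic_prim (p, v) (t + 2 * pi) = periodic_prim (p, v) t" by (simp add: full P_def)
qed

definition h1_prim :: "'a::euclidean_space \<times> (real \<Rightarrow>\<^sub>C 'a) \<Rightarrow> 'a h1per" where
  "h1_prim p = Abs_h1per (periodic_prim p)"

lemma h1_fun_h1_prim: "h1_fun (h1_prim (p, v)) = periodic_prim (p, v)"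
  unfolding h1_prim_def
  by (rule Abs_h1per_inverse) (use has_weak_deriv_periodic_prim periodic_prim_periodic in blast)

lemma h1_eqI_period:
  assumes "\<And>t. t \<in> {0..2*pi} \<Longrightarrow> h1_fun u t = h1_fun v t" shows "u = v"
proof (rule h1_eqI)
  fix t
  have "h1_fun u (wrap t) = h1_fun v (wrap t)" using wrap_bounds[of t] by (intro assms) auto
  then show "h1_fun u t = h1_fun v t"
    using periodic_wrap[of "h1_fun u" t, OF h1_fun_periodic] periodic_wrap[of "h1_fun v" t, OF h1_fun_periodic] by simp
qed

text \<open>Through this map every limit and every C^1 dependence obtained for initial values and
  velocities in the supremum norm holds in H^1 as well. The constant 60 is a crude bound resulting
  from \<open>pi < 4\<close>.\<close>

lemma bounded_linear_h1_prim: "bounded_linear (h1_prim :: 'a::euclidean_space \<times> (real \<Rightarrow>\<^sub>C 'a) \<Rightarrow> _)"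
proof (rule bounded_linear_intro[where K = 60])
  have ii: "apply_bcontfun v integrable_on {a..b}" for v :: "real \<Rightarrow>\<^sub>C 'a" and a b :: real
    by (intro integrable_continuous_interval) simp
  show "h1_prim (x + y) = h1_prim x + h1_prim y" for x y :: "'a \<times> (real \<Rightarrow>\<^sub>C 'a)"
    by (rule h1_eqI_period, cases x, cases y)
       (simp add: h1_fun_h1_prim periodic_prim_eq Henstock_Kurzweil_Integration.integral_add ii algebra_simps)
  show "h1_prim (c *\<^sub>R x) = c *\<^sub>R h1_prim x" for c and x :: "'a \<times> (real \<Rightarrow>\<^sub>C 'a)"
    by (rule h1_eqI_period, cases x) (simp add: h1_fun_h1_prim periodic_prim_eq algebra_simps)
  fix x :: "'a \<times> (real \<Rightarrow>\<^sub>C 'a)"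
  obtain p v where x: "x = (p, v)" by (cases x)
  define m where "m = (1 / (2 * pi)) *\<^sub>R integral {0..2*pi} v"
  have int: "norm (integral {0..t} v) \<le> norm v * (2 * pi)" if "t \<in> {0..2*pi}" for t
  proof -
    have "norm (integral {0..t} v) \<le> norm v * (t - 0)"
      by (rule integral_bound) (use that norm_bounded in auto)
    also have "\<dots> \<le> norm v * (2 * pi)" using that by (intro mult_left_mono) auto
    finally show ?thesis .
  qed
  have m: "norm m \<le> norm v" using int[of "2*pi"] by (simp add: m_def field_simps)
  have P: "norm (periodic_prim (p, v) t) \<le> norm p + 16 * norm v" for t
  proof -
    define s where "s = wrap t"
    have s: "s \<in> {0..2*pi}" using wrap_bounds[of t] by (simp add: s_def)
    have "periodic_prim (p, v) t = periodic_prim (p, v) s"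
      unfolding s_def by (rule periodic_wrap[symmetric]) (rule periodic_prim_periodic)
    also have "\<dots> = p + integral {0..s} v - s *\<^sub>R m" using periodic_prim_eq[OF s] by (simp add: m_def)
    also have "norm \<dots> \<le> norm p + norm (integral {0..s} v) + norm (s *\<^sub>R m)"
      by (meson norm_triangle_ineq norm_triangle_ineq4 add_right_mono order_trans)
    also have "\<dots> \<le> norm p + norm v * (2 * pi) + (2 * pi) * norm v"
      unfolding norm_scaleR using int[OF s] m s by (intro add_mono mult_mono) auto
    also have "\<dots> = norm p + (4 * pi) * norm v" by simp
    also have "\<dots> \<le> norm p + 16 * norm v" using pi_less_4 by (intro add_left_mono mult_right_mono) auto
    finally show ?thesis .
  qed
  have "norm (h1_prim x) \<le> 3 * ((norm p + 16 * norm v) + 2 * norm v)"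
    unfolding x
  proof (rule h1_norm_le)
    show "has_weak_deriv (h1_fun (h1_prim (p, v))) (\<lambda>t. apply_bcontfun v (wrap t) - m)"
      unfolding h1_fun_h1_prim m_def by (rule has_weak_deriv_periodic_prim)
    show "norm (apply_bcontfun v (wrap t) - m) \<le> 2 * norm v" for t
      using m norm_bounded[of v "wrap t"] norm_triangle_ineq4[of "apply_bcontfun v (wrap t)" m] by simp
  qed (simp add: h1_fun_h1_prim P)
  also have "\<dots> = 3 * norm p + 54 * norm v" by simp
  also have "\<dots> \<le> norm x * 60" using norm_fst_le[of p v] norm_snd_le[of v p] norm_ge_zero[of "(p, v)"] unfolding x by linarith
  finally show "norm (h1_prim x) \<le> norm x * 60" .
qed

lemma h1_prim_eqI:
  fixes v :: "real \<Rightarrow>\<^sub>C 'a::euclidean_space"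
  assumes "\<And>t. t \<in> {0..2*pi} \<Longrightarrow> h1_fun u t = p + integral {0..t} v" "integral {0..2*pi} v = 0"
  shows "h1_prim (p, v) = u"
  by (rule h1_eqI_period) (simp add: h1_fun_h1_prim periodic_prim_eq assms)

section \<open>Gradients\<close>

lemma grad_eqI:
  assumes "GDERIV f x :> D" shows "grad f x = D"
  unfolding grad_def
proof (rule the_equality, rule assms)
  fix D' assume "GDERIV f x :> D'"
  then have "(\<lambda>h. h \<bullet> D') = (\<lambda>h. h \<bullet> D)"
    using assms unfolding gderiv_def by (rule has_derivative_unique)
  then have "(D' - D) \<bullet> D' = (D' - D) \<bullet> D" by meson
  then have "(D' - D) \<bullet> (D' - D) = 0" unfolding inner_diff_right[of "D' - D" D' D] by simp
  then show "D' = D" unfolding inner_eq_zero_iff by simp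
qed

lemma partial_grad_eqI:
  fixes f :: "(real^2)^'n::finite \<Rightarrow> real"
  assumes "GDERIV f z :> D" shows "partial_grad k f z = D $ k"
  unfolding partial_grad_def
proof (rule grad_eqI)
  define e where "e x = (\<chi> j. if j = k then x else z $ j)" for x
  have e: "e x = z + axis k (x - z $ k)" for x by (simp add: e_def vec_eq_iff axis_def)
  have "(e has_derivative axis k) (at (z $ k))"
    unfolding e by (auto intro!: derivative_eq_intros bounded_linear.has_derivative[OF bounded_linear_axis])
  moreover have "(f has_derivative (\<lambda>h. h \<bullet> D)) (at (e (z $ k)))"
    using assms by (simp add: gderiv_def e axis_def zero_vec_def[symmetric])
  ultimately have "((\<lambda>x. f (e x)) has_derivative (\<lambda>h. axis k h \<bullet> D)) (at (z $ k))"
    by (rule has_derivative_compose)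
  then show "GDERIV (\<lambda>x. f (\<chi> j. if j = k then x else z $ j)) (z $ k) :> D $ k"
    unfolding gderiv_def e_def by (simp add: inner_axis')
qed

lemma has_vector_derivative_vec_iff:
  fixes f :: "real \<Rightarrow> 'a::real_normed_vector^'n::finite"
  shows "(f has_vector_derivative D) F \<longleftrightarrow> (\<forall>k. ((\<lambda>t. f t $ k) has_vector_derivative D $ k) F)"
proof
  assume "(f has_vector_derivative D) F"
  then show "\<forall>k. ((\<lambda>t. f t $ k) has_vector_derivative D $ k) F"
    by (auto intro: bounded_linear.has_vector_derivative[OF bounded_linear_vec_nth])
next
  assume *: "\<forall>k. ((\<lambda>t. f t $ k) has_vector_derivative D $ k) F"
  have eq: "x = (\<Sum>k\<in>UNIV. axis k (x $ k))" for x :: "'a^'n"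
    by (simp add: vec_eq_iff axis_def if_distrib cong: if_cong)
  have "((\<lambda>t. \<Sum>k\<in>UNIV. axis k (f t $ k)) has_vector_derivative (\<Sum>k\<in>UNIV. axis k (D $ k))) F"
    by (intro has_vector_derivative_sum bounded_linear.has_vector_derivative[OF bounded_linear_axis]) (use * in auto)
  then show "(f has_vector_derivative D) F" unfolding eq[symmetric] .
qed

section \<open>The symplectic matrix\<close>

abbreviation J :: "real^2 \<Rightarrow> real^2" where "J x \<equiv> Jmat *v x"

lemma J_nth [simp]: "J x $ 1 = x $ 2" "J x $ 2 = - x $ 1"
  by (simp_all add: Jmat_def matrix_vector_mult_def sum_2)

lemma J_J [simp]: "J (J x) = - x" by (simp add: vec_eq_iff forall_2)
lemma inner_2: "x \<bullet> y = x $ 1 * y $ 1 + x $ 2 * y $ 2" for x y :: "real^2"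
  by (simp add: inner_vec_def sum_2)
lemma J_inner: "J x \<bullet> y = - (x \<bullet> J y)" by (simp add: inner_2)
lemma J_inner_self [simp]: "x \<bullet> J x = 0" "J x \<bullet> x = 0" by (simp_all add: inner_2)
lemma J_inner_J [simp]: "J x \<bullet> J y = x \<bullet> y" by (simp add: inner_2)
lemma J_eq_0_iff [simp]: "J x = 0 \<longleftrightarrow> x = 0" by (auto simp: vec_eq_iff forall_2)
lemma bounded_linear_J: "bounded_linear J" by (rule matrix_vector_mul_bounded_linear)
lemmas J_linear = linear_simps[OF bounded_linear_J]

section \<open>The Hamiltonian of the whole plane\<close>

text \<open>The gradient of \<open>ln \<circ> norm\<close>, with the junk value \<open>0\<close> at \<open>0\<close>, and its derivative.\<close>
definition ker :: "real^2 \<Rightarrow> real^2" where "ker y = inverse (y \<bullet> y) *\<^sub>R y"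
definition ker' :: "real^2 \<Rightarrow> real^2 \<Rightarrow> real^2" where
  "ker' y h = inverse (y \<bullet> y) *\<^sub>R h - (2 * (y \<bullet> h) * (inverse (y \<bullet> y))\<^sup>2) *\<^sub>R y"

lemma ker_0 [simp]: "ker 0 = 0" and ker_minus: "ker (- y) = - ker y" by (simp_all add: ker_def)
lemma ker'_0 [simp]: "ker' y 0 = 0" and ker'_minus: "ker' (- y) (- h) = - ker' y h" by (simp_all add: ker'_def)
lemma ker'_sym: "ker' y a \<bullet> b = ker' y b \<bullet> a"
proof -
  have "ker' y a \<bullet> b = inverse (y \<bullet> y) * (a \<bullet> b) - 2 * (inverse (y \<bullet> y))\<^sup>2 * ((y \<bullet> a) * (y \<bullet> b))" for a b
    by (simp add: ker'_def inner_diff_left)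
  then show ?thesis by (simp only: inner_commute[of a b] mult.commute[of "y \<bullet> a"])
qed

lemma ker_has_derivative:
  assumes "y \<noteq> 0" shows "(ker has_derivative ker' y) (at y)"
proof -
  have "y \<bullet> y \<noteq> 0" using assms by simp
  then show ?thesis
    unfolding ker_def ker'_def
    by (auto intro!: derivative_eq_intros simp: fun_eq_iff inner_commute power2_eq_square algebra_simps)
qed

lemma ln_norm_has_derivative:
  assumes "y \<noteq> 0" shows "((\<lambda>y::real^2. ln (norm y)) has_derivative (\<lambda>h. ker y \<bullet> h)) (at y)"
proof -
  have "((\<lambda>y::real^2. ln (norm y)) has_derivative (\<lambda>h. (sgn y \<bullet> h) * inverse (norm y))) (at y)"
    using assms by (auto intro!: derivative_eq_intros has_derivative_norm simp: inner_commute divide_inverse)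
  moreover have "(sgn y \<bullet> h) * inverse (norm y) = ker y \<bullet> h" for h
    by (simp add: ker_def sgn_div_norm divide_inverse power2_norm_eq_inner[symmetric] power2_eq_square)
  ultimately show ?thesis by simp
qed

lemma config_open:
  assumes "open A" shows "open (config_space A :: ((real^2)^'n::finite) set)"
proof -
  have eq: "(config_space A :: ((real^2)^'n) set) = (\<Inter>j. (\<lambda>z. z $ j) -` A) \<inter> (\<Inter>j. \<Inter>k\<in>UNIV - {j}. {z. z $ j \<noteq> z $ k})"
    by (auto simp: config_space_def)
  have "open ((\<lambda>z::(real^2)^'n. z $ j) -` A)" for j
    by (rule open_vimage[OF assms]) (intro continuous_intros)
  moreover have "open {z::(real^2)^'n. z $ j \<noteq> z $ k}" for j k
    by (intro open_Collect_neq continuous_intros)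
  ultimately show ?thesis unfolding eq by (intro open_Int open_INT) auto
qed

lemma inner_conf: "x \<bullet> y = (\<Sum>k\<in>UNIV. x $ k \<bullet> y $ k)" for x y :: "(real^2)^'n::finite"
  by (rule inner_vec_def)

lemma antisym_sum:
  fixes c :: "'n::finite \<Rightarrow> 'n \<Rightarrow> 'a::real_vector"
  assumes "\<And>j k. c k j = - c j k" shows "(\<Sum>k\<in>UNIV. \<Sum>j\<in>UNIV. c k j) = 0"
proof -
  have "(\<Sum>k\<in>UNIV. \<Sum>j\<in>UNIV. c k j) = (\<Sum>j\<in>UNIV. \<Sum>k\<in>UNIV. c k j)" by (rule sum.swap)
  also have "\<dots> = - (\<Sum>j\<in>UNIV. \<Sum>k\<in>UNIV. c j k)" by (subst assms) (simp add: sum_negf)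
  finally have "2 *\<^sub>R (\<Sum>k\<in>UNIV. \<Sum>j\<in>UNIV. c k j) = 0" unfolding scaleR_2 by (metis add.right_inverse)
  then show ?thesis by simp
qed

text \<open>Exchanging the indices turns the terms with \<open>h j\<close> into those with
  \<open>h k\<close>; a sum over pairwise differences thereby becomes an inner product with a
  gradient.\<close>

lemma antisym_sum_inner:
  fixes c :: "'n::finite \<Rightarrow> 'n \<Rightarrow> 'a::real_inner"
  assumes "\<And>j k. c k j = - c j k"
  shows "(\<Sum>k\<in>UNIV. \<Sum>j\<in>UNIV. c k j \<bullet> (h k - h j)) = 2 * (\<Sum>k\<in>UNIV. \<Sum>j\<in>UNIV. c k j \<bullet> h k)"
proof -
  have "(\<Sum>k\<in>UNIV. \<Sum>j\<in>UNIV. c k j \<bullet> h j) = (\<Sum>j\<in>UNIV. \<Sum>k\<in>UNIV. c k j \<bullet> h j)" by (rule sum.swap)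
  also have "\<dots> = - (\<Sum>j\<in>UNIV. \<Sum>k\<in>UNIV. c j k \<bullet> h j)" by (subst assms) (simp add: sum_negf)
  finally show ?thesis by (simp add: inner_diff_right sum_subtractf)
qed

text \<open>The factor is \<open>1 / pi\<close> because every unordered pair occurs twice in
  \<open>ham_H0\<close>. The diagonal terms are harmless since \<open>ker 0 = 0\<close>.\<close>

definition gradH0 :: "('n::finite \<Rightarrow> real) \<Rightarrow> (real^2)^'n \<Rightarrow> (real^2)^'n" where
  "gradH0 \<Gamma> z = (\<chi> k. (- (1 / pi)) *\<^sub>R (\<Sum>j\<in>UNIV. (\<Gamma> k * \<Gamma> j) *\<^sub>R ker (z $ k - z $ j)))"

definition hessH0 :: "('n::finite \<Rightarrow> real) \<Rightarrow> (real^2)^'n \<Rightarrow> (real^2)^'n \<Rightarrow> (real^2)^'n" where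
  "hessH0 \<Gamma> z h = (\<chi> k. (- (1 / pi)) *\<^sub>R (\<Sum>j\<in>UNIV. (\<Gamma> k * \<Gamma> j) *\<^sub>R ker' (z $ k - z $ j) (h $ k - h $ j)))"

lemma ker_antisym: "(\<Gamma> k * \<Gamma> j) *\<^sub>R ker (z $ k - z $ j) = - ((\<Gamma> j * \<Gamma> k) *\<^sub>R ker (z $ j - z $ k))"
  using ker_minus[of "z $ j - z $ k"] by (simp add: mult.commute)

lemma has_derivative_vec:
  fixes f :: "'i::finite \<Rightarrow> 'a::real_normed_vector \<Rightarrow> 'b::real_normed_vector"
  assumes "\<And>i. (f i has_derivative f' i) F"
  shows "((\<lambda>x. \<chi> i. f i x) has_derivative (\<lambda>h. \<chi> i. f' i h)) F"
proof -
  have eq: "(\<chi> i. g i) = (\<Sum>i\<in>UNIV. axis i (g i))" for g :: "'i \<Rightarrow> 'b"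
    by (simp add: vec_eq_iff axis_def if_distrib cong: if_cong)
  show ?thesis unfolding eq
    by (intro has_derivative_sum bounded_linear.has_derivative[OF bounded_linear_axis] assms)
qed

lemma GDERIV_ham_H0:
  fixes z :: "(real^2)^'n::finite"
  assumes z: "z \<in> config_space UNIV"
  shows "GDERIV (ham_H0 \<Gamma>) z :> gradH0 \<Gamma> z"
proof -
  have ne: "z $ j - z $ k \<noteq> 0" if "k \<noteq> j" for j k using z that by (auto simp: config_space_def)
  have 1: "((\<lambda>z. ln (norm (z $ j - z $ k))) has_derivative (\<lambda>h. ker (z $ j - z $ k) \<bullet> (h $ j - h $ k))) (at z)"
    if "k \<noteq> j" for j k
    by (rule has_derivative_compose[where f = "\<lambda>z. z $ j - z $ k" and g = "\<lambda>y. ln (norm y)",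
        OF _ ln_norm_has_derivative[OF ne[OF that]]])
       (auto intro!: bounded_linear_imp_has_derivative bounded_linear_sub bounded_linear_vec_nth)
  have "((\<lambda>z. - (1 / (2 * pi)) * (\<Sum>j\<in>UNIV. \<Sum>k\<in>UNIV - {j}. \<Gamma> j * \<Gamma> k * ln (norm (z $ j - z $ k)))) has_derivative
     (\<lambda>h. - (1 / (2 * pi)) * (\<Sum>j\<in>UNIV. \<Sum>k\<in>UNIV - {j}. \<Gamma> j * \<Gamma> k * (ker (z $ j - z $ k) \<bullet> (h $ j - h $ k))))) (at z)"
    by (intro has_derivative_mult_right has_derivative_sum 1) auto
  moreover have "(\<lambda>h. - (1 / (2 * pi)) * (\<Sum>j\<in>UNIV. \<Sum>k\<in>UNIV - {j}. \<Gamma> j * \<Gamma> k * (ker (z $ j - z $ k) \<bullet> (h $ j - h $ k)))) = (\<lambda>h. h \<bullet> gradH0 \<Gamma> z)"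
  proof
    fix h :: "(real^2)^'n"
    have "(\<Sum>k\<in>UNIV - {j}. \<Gamma> j * \<Gamma> k * (ker (z $ j - z $ k) \<bullet> (h $ j - h $ k))) =
      (\<Sum>k\<in>UNIV. ((\<Gamma> j * \<Gamma> k) *\<^sub>R ker (z $ j - z $ k)) \<bullet> (h $ j - h $ k))" for j
      by (rule sum.mono_neutral_cong_left) auto
    moreover have "(\<Sum>j\<in>UNIV. \<Sum>k\<in>UNIV. ((\<Gamma> j * \<Gamma> k) *\<^sub>R ker (z $ j - z $ k)) \<bullet> (h $ j - h $ k)) =
       2 * (\<Sum>j\<in>UNIV. \<Sum>k\<in>UNIV. ((\<Gamma> j * \<Gamma> k) *\<^sub>R ker (z $ j - z $ k)) \<bullet> h $ j)"
      by (rule antisym_sum_inner) (rule ker_antisym)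
    ultimately have "(\<Sum>j\<in>UNIV. \<Sum>k\<in>UNIV - {j}. \<Gamma> j * \<Gamma> k * (ker (z $ j - z $ k) \<bullet> (h $ j - h $ k))) =
       2 * (\<Sum>j\<in>UNIV. \<Sum>k\<in>UNIV. ((\<Gamma> j * \<Gamma> k) *\<^sub>R ker (z $ j - z $ k)) \<bullet> h $ j)"
      by (simp only:)
    then show "- (1 / (2 * pi)) * (\<Sum>j\<in>UNIV. \<Sum>k\<in>UNIV - {j}. \<Gamma> j * \<Gamma> k * (ker (z $ j - z $ k) \<bullet> (h $ j - h $ k))) = h \<bullet> gradH0 \<Gamma> z"
      by (simp add: gradH0_def inner_conf inner_sum_right sum_distrib_left inner_commute sum_negf)
  qed
  ultimately show ?thesis unfolding gderiv_def ham_H0_def by simp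
qed

lemma gradH0_has_derivative:
  assumes z: "z \<in> config_space UNIV"
  shows "(gradH0 \<Gamma> has_derivative hessH0 \<Gamma> z) (at z)"
  unfolding gradH0_def hessH0_def
proof (intro has_derivative_vec has_derivative_scaleR_right has_derivative_sum)
  fix k j
  show "((\<lambda>z. ker (z $ k - z $ j)) has_derivative (\<lambda>h. ker' (z $ k - z $ j) (h $ k - h $ j))) (at z)"
  proof (cases "k = j")
    case False
    then have "z $ k - z $ j \<noteq> 0" using z by (auto simp: config_space_def)
    then show ?thesis
      by (intro has_derivative_compose[where f = "\<lambda>z. z $ k - z $ j" and g = ker, OF _ ker_has_derivative])
         (auto intro!: bounded_linear_imp_has_derivative bounded_linear_sub bounded_linear_vec_nth)
  qed simp
qed

lemma hessian_ham_H0: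
  assumes z: "z \<in> config_space UNIV" shows "hessian (ham_H0 \<Gamma>) z = hessH0 \<Gamma> z"
proof -
  have "(grad (ham_H0 \<Gamma>) has_derivative hessH0 \<Gamma> z) (at z)"
    by (rule has_derivative_transform_within_open[OF gradH0_has_derivative[OF z] config_open[OF open_UNIV] z])
       (simp add: grad_eqI[OF GDERIV_ham_H0])
  then show ?thesis unfolding hessian_def by (metis frechet_derivative_at)
qed

lemma C1_map_gradH0: "C1_map (config_space UNIV) (gradH0 \<Gamma>)"
  unfolding gradH0_def
proof (intro C1_map_vec C1_map_linear_compose[OF bounded_linear_scaleR_right] C1_map_sum)
  fix k j :: 'a
  show "C1_map (config_space UNIV) (\<lambda>z. ker (z $ k - z $ j))"
  proof (cases "k = j")
    case False
    have "C1_map (config_space UNIV) (\<lambda>z::(real^2)^'a. z $ k - z $ j)"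
      by (intro C1_map_bounded_linear bounded_linear_sub bounded_linear_vec_nth)
    with False show ?thesis unfolding ker_def
      by (intro C1_map_scaleR C1_map_inverse C1_map_inner) (auto simp: config_space_def)
  qed simp
qed

text \<open>Action equals reaction: the pairwise forces cancel. Together with \<open>vort_MJ\<close>
  this conserves the centre of vorticity in the whole plane.\<close>

lemma sum_gradH0: "(\<Sum>k\<in>UNIV. gradH0 \<Gamma> z $ k) = 0"
proof -
  have "(\<Sum>k\<in>UNIV. \<Sum>j\<in>UNIV. (\<Gamma> k * \<Gamma> j) *\<^sub>R ker (z $ k - z $ j)) = 0"
    by (rule antisym_sum) (rule ker_antisym)
  then show ?thesis by (simp add: gradH0_def sum_negf scaleR_sum_right[symmetric])
qed

lemma hessH0_antisym:
  "(\<Gamma> k * \<Gamma> j) *\<^sub>R ker' (z $ k - z $ j) (h $ k - h $ j) = - ((\<Gamma> j * \<Gamma> k) *\<^sub>R ker' (z $ j - z $ k) (h $ j - h $ k))"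
  using ker'_minus[of "z $ j - z $ k" "h $ j - h $ k"] by (simp add: mult.commute)

lemma sum_hessH0: "(\<Sum>k\<in>UNIV. hessH0 \<Gamma> z h $ k) = 0"
proof -
  have "(\<Sum>k\<in>UNIV. \<Sum>j\<in>UNIV. (\<Gamma> k * \<Gamma> j) *\<^sub>R ker' (z $ k - z $ j) (h $ k - h $ j)) = 0"
    by (rule antisym_sum) (rule hessH0_antisym)
  then show ?thesis by (simp add: hessH0_def sum_negf scaleR_sum_right[symmetric])
qed

text \<open>Symmetrising over pairs exhibits the form as a sum of symmetric forms in the differences
  of positions.\<close>

lemma hessH0_sym: "hessH0 \<Gamma> z a \<bullet> b = hessH0 \<Gamma> z b \<bullet> a"
proof -
  have *: "hessH0 \<Gamma> z a \<bullet> b = - (1 / (2 * pi)) * (\<Sum>k\<in>UNIV. \<Sum>j\<in>UNIV.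
      ((\<Gamma> k * \<Gamma> j) *\<^sub>R ker' (z $ k - z $ j) (a $ k - a $ j)) \<bullet> (b $ k - b $ j))" for a b
    unfolding antisym_sum_inner[of "\<lambda>k j. (\<Gamma> k * \<Gamma> j) *\<^sub>R ker' (z $ k - z $ j) (a $ k - a $ j)" "\<lambda>k. b $ k", OF hessH0_antisym]
    by (simp add: hessH0_def inner_conf inner_sum_left sum_distrib_left sum_negf)
  show ?thesis unfolding * by (simp add: ker'_sym)
qed

lemma hessH0_const [simp]: "hessH0 \<Gamma> z (\<chi> k. c) = 0"
  by (simp add: hessH0_def vec_eq_iff)

text \<open>The gradient of the logarithm is homogeneous of degree -1; this fixes the time scale
  \<open>r\<^sup>2\<close> that goes with the length scale \<open>r\<close>.\<close>

lemma gradH0_rescale: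
  assumes "r > 0" shows "gradH0 \<Gamma> (\<chi> k. a + r *\<^sub>R (z $ k)) = (1 / r) *\<^sub>R gradH0 \<Gamma> z"
proof -
  have "ker (r *\<^sub>R y) = (1 / r) *\<^sub>R ker y" for y using assms by (simp add: ker_def field_simps)
  then have "ker ((a + r *\<^sub>R x) - (a + r *\<^sub>R y)) = (1 / r) *\<^sub>R ker (x - y)" for x y
    by (metis add_diff_cancel_left scaleR_diff_right)
  then show ?thesis by (simp add: gradH0_def vec_eq_iff scaleR_sum_right ac_simps)
qed

section \<open>The Hamiltonian of the domain\<close>

text \<open>\<open>g1\<close> stands for the gradient of \<open>g\<close> in the first argument.
  Symmetry of \<open>g\<close> merges the two occurrences of \<open>z $ k\<close>, whence the factor
  2; the self-interaction \<open>j = k\<close> is included.\<close>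

definition gradF :: "('n::finite \<Rightarrow> real) \<Rightarrow> ((real^2) \<times> (real^2) \<Rightarrow> real^2) \<Rightarrow> (real^2)^'n \<Rightarrow> (real^2)^'n" where
  "gradF \<Gamma> g1 z = (\<chi> k. (2 * \<Gamma> k) *\<^sub>R (\<Sum>j\<in>UNIV. \<Gamma> j *\<^sub>R g1 (z $ k, z $ j)))"

text \<open>By symmetry the gradient in the second argument at \<open>(x, y)\<close> is
  \<open>g1 (y, x)\<close>, so a single function describes the whole derivative.\<close>

definition partial_gradient :: "(real^2) set \<Rightarrow> (real^2 \<Rightarrow> real^2 \<Rightarrow> real) \<Rightarrow> ((real^2) \<times> (real^2) \<Rightarrow> real^2) \<Rightarrow> bool" where
  "partial_gradient \<Omega> g g1 \<longleftrightarrow> (\<forall>x\<in>\<Omega>. \<forall>y\<in>\<Omega>.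
     ((\<lambda>p. g (fst p) (snd p)) has_derivative (\<lambda>h. fst h \<bullet> g1 (x, y) + snd h \<bullet> g1 (y, x))) (at (x, y)))"

lemma C2_partial_gradient:
  assumes \<Omega>: "open \<Omega>" and sym: "\<And>x y. x \<in> \<Omega> \<Longrightarrow> y \<in> \<Omega> \<Longrightarrow> g x y = g y x"
    and C2: "C2_on (\<Omega> \<times> \<Omega>) (\<lambda>(x, y). g x y)"
  obtains g1 where "C1_map (\<Omega> \<times> \<Omega>) g1" "partial_gradient \<Omega> g g1"
proof -
  let ?g = "\<lambda>p. g (fst p) (snd p)"
  obtain f' f'' where f': "\<forall>p\<in>\<Omega> \<times> \<Omega>. (?g has_derivative blinfun_apply (f' p)) (at p)"
    and f'': "\<forall>p\<in>\<Omega> \<times> \<Omega>. (f' has_derivative blinfun_apply (f'' p)) (at p)" "continuous_on (\<Omega> \<times> \<Omega>) f''"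
    using C2 unfolding C2_on_def case_prod_unfold by blast
  \<comment> \<open>The Riesz representative of a functional restricted to the first factor. It
    depends linearly on the functional, so C^1 regularity is preserved.\<close>
  define L :: "(((real^2) \<times> (real^2)) \<Rightarrow>\<^sub>L real) \<Rightarrow> real^2" where "L \<phi> = (\<Sum>i\<in>Basis. \<phi> (i, 0) *\<^sub>R i)" for \<phi>
  have blL: "bounded_linear L" unfolding L_def
    by (intro bounded_linear_sum bounded_linear_compose[OF bounded_linear_scaleR_left] blinfun.bounded_linear_left)
  have L: "a \<bullet> L \<phi> = \<phi> (a, 0)" for a \<phi>
  proof -
    have lin: "linear (\<lambda>x. \<phi> (x, 0))"
      by (intro bounded_linear.linear bounded_linear_compose[OF blinfun.bounded_linear_right] bounded_linear_Pair
          bounded_linear_ident bounded_linear_zero)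
    have "\<phi> (a, 0) = \<phi> (\<Sum>i\<in>Basis. (a \<bullet> i) *\<^sub>R i, 0)" unfolding euclidean_representation ..
    also have "\<dots> = (\<Sum>i\<in>Basis. (a \<bullet> i) * \<phi> (i, 0))"
      unfolding linear_sum[OF lin] linear_scale[OF lin] by simp
    also have "\<dots> = a \<bullet> L \<phi>" by (simp add: L_def inner_sum_right mult.commute)
    finally show ?thesis by simp
  qed
  \<comment> \<open>Differentiates the symmetry relation, which holds on an open set.\<close>
  have swap: "f' (x, y) (0, b) = f' (y, x) (b, 0)" if xy: "x \<in> \<Omega>" "y \<in> \<Omega>" for x y b
  proof -
    have "((\<lambda>p. ?g (snd p, fst p)) has_derivative (\<lambda>h. f' (y, x) (snd h, fst h))) (at (x, y))"
      by (rule has_derivative_compose[where f = "\<lambda>p. (snd p, fst p)" and g = ?g])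
         (use xy f' in \<open>auto intro!: derivative_eq_intros\<close>)
    then have "(?g has_derivative (\<lambda>h. f' (y, x) (snd h, fst h))) (at (x, y))"
      by (rule has_derivative_transform_within_open[OF _ open_Times[OF \<Omega> \<Omega>]])
         (use xy sym in auto)
    then have "blinfun_apply (f' (x, y)) = (\<lambda>h. f' (y, x) (snd h, fst h))"
      using f' xy by (intro has_derivative_unique) auto
    then show ?thesis by simp
  qed
  show ?thesis
  proof
    show "C1_map (\<Omega> \<times> \<Omega>) (\<lambda>p. L (f' p))"
      by (rule C1_map_linear_compose[OF blL], rule C1_mapI[of _ _ f'']) (use f'' in auto)
    show "partial_gradient \<Omega> g (\<lambda>p. L (f' p))" unfolding partial_gradient_def
    proof (intro ballI)
      fix x y assume xy: "x \<in> \<Omega>" "y \<in> \<Omega>"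
      have "fst h \<bullet> L (f' (x, y)) + snd h \<bullet> L (f' (y, x)) = f' (x, y) h" for h
        unfolding L swap[OF xy, symmetric] by (simp add: blinfun.add_right[symmetric])
      then show "(?g has_derivative (\<lambda>h. fst h \<bullet> L (f' (x, y)) + snd h \<bullet> L (f' (y, x)))) (at (x, y))"
        using f' xy by simp
    qed
  qed
qed

lemma GDERIV_ham_F:
  fixes z :: "(real^2)^'n::finite"
  assumes g1: "partial_gradient \<Omega> g g1" and z: "\<And>k. z $ k \<in> \<Omega>"
  shows "GDERIV (ham_F \<Gamma> g) z :> gradF \<Gamma> g1 z"
proof -
  have 1: "((\<lambda>z. g (z $ j) (z $ k)) has_derivative (\<lambda>h. h $ j \<bullet> g1 (z $ j, z $ k) + h $ k \<bullet> g1 (z $ k, z $ j))) (at z)" for j k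
  proof -
    have "((\<lambda>z. (z $ j, z $ k)) has_derivative (\<lambda>h. (h $ j, h $ k))) (at z)"
      by (intro bounded_linear_imp_has_derivative bounded_linear_Pair bounded_linear_vec_nth)
    moreover have "((\<lambda>p. g (fst p) (snd p)) has_derivative
        (\<lambda>h. fst h \<bullet> g1 (z $ j, z $ k) + snd h \<bullet> g1 (z $ k, z $ j))) (at (z $ j, z $ k))"
      using g1 z unfolding partial_gradient_def by blast
    ultimately have "((\<lambda>z. g (fst (z $ j, z $ k)) (snd (z $ j, z $ k))) has_derivative
        (\<lambda>h. fst (h $ j, h $ k) \<bullet> g1 (z $ j, z $ k) + snd (h $ j, h $ k) \<bullet> g1 (z $ k, z $ j))) (at z)"
      by (rule has_derivative_compose)
    then show ?thesis by simp
  qed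
  have "(ham_F \<Gamma> g has_derivative (\<lambda>h. \<Sum>j\<in>UNIV. \<Sum>k\<in>UNIV. \<Gamma> j * \<Gamma> k *
      (h $ j \<bullet> g1 (z $ j, z $ k) + h $ k \<bullet> g1 (z $ k, z $ j)))) (at z)"
    unfolding ham_F_def by (intro has_derivative_sum has_derivative_mult_right 1)
  moreover have "(\<lambda>h. \<Sum>j\<in>UNIV. \<Sum>k\<in>UNIV. \<Gamma> j * \<Gamma> k *
      (h $ j \<bullet> g1 (z $ j, z $ k) + h $ k \<bullet> g1 (z $ k, z $ j))) = (\<lambda>h. h \<bullet> gradF \<Gamma> g1 z)"
  proof
    fix h :: "(real^2)^'n"
    have "(\<Sum>j\<in>UNIV. \<Sum>k\<in>UNIV. \<Gamma> j * \<Gamma> k * (h $ k \<bullet> g1 (z $ k, z $ j))) =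
        (\<Sum>k\<in>UNIV. \<Sum>j\<in>UNIV. \<Gamma> k * \<Gamma> j * (h $ k \<bullet> g1 (z $ k, z $ j)))"
      by (subst sum.swap) (simp add: mult.commute)
    then show "(\<Sum>j\<in>UNIV. \<Sum>k\<in>UNIV. \<Gamma> j * \<Gamma> k * (h $ j \<bullet> g1 (z $ j, z $ k) + h $ k \<bullet> g1 (z $ k, z $ j))) = h \<bullet> gradF \<Gamma> g1 z"
      by (simp add: distrib_left sum.distrib gradF_def inner_conf inner_sum_right sum_distrib_left ac_simps)
  qed
  ultimately show ?thesis unfolding gderiv_def by simp
qed

lemma C1_map_gradF:
  assumes "C1_map (\<Omega> \<times> \<Omega>) g1"
  shows "C1_map {z :: (real^2)^'n::finite. \<forall>k. z $ k \<in> \<Omega>} (gradF \<Gamma> g1)"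
  unfolding gradF_def
proof (intro C1_map_vec C1_map_linear_compose[OF bounded_linear_scaleR_right] C1_map_sum)
  fix k j :: 'n
  show "C1_map {z :: (real^2)^'n. \<forall>k. z $ k \<in> \<Omega>} (\<lambda>z. g1 (z $ k, z $ j))"
    by (rule C1_map_compose[OF C1_map_bounded_linear assms])
       (auto intro: bounded_linear_Pair bounded_linear_vec_nth)
qed

lemma open_vec_in: "open \<Omega> \<Longrightarrow> open {z :: 'a::topological_space^'n::finite. \<forall>k. z $ k \<in> \<Omega>}"
proof -
  assume "open \<Omega>"
  then have "open (\<Inter>k. (\<lambda>z :: 'a^'n. z $ k) -` \<Omega>)"
    by (intro open_INT ballI open_vimage continuous_intros) auto
  then show ?thesis by (simp add: vimage_def Collect_all_eq[symmetric])
qed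

text \<open>The double sum collapses to the derivative of \<open>g1\<close> along the diagonal, where \<open>2 *\<^sub>R g1 (x, x)\<close> is the gradient of \<open>h\<close>.\<close>
lemma sum_gradF_derivative:
  fixes g1 :: "(real^2) \<times> (real^2) \<Rightarrow> real^2" and \<Gamma> :: "'n::finite \<Rightarrow> real"
  assumes \<Omega>: "open \<Omega>" "a0 \<in> \<Omega>" and g1: "C1_map (\<Omega> \<times> \<Omega>) g1" "partial_gradient \<Omega> g g1"
  shows "((\<lambda>z. \<Sum>k\<in>UNIV. gradF \<Gamma> g1 z $ k) has_derivative
     (\<lambda>x. (\<Sum>k\<in>UNIV. \<Gamma> k) *\<^sub>R hessian (\<lambda>x. g x x) a0 (\<Sum>k\<in>UNIV. \<Gamma> k *\<^sub>R x $ k))) (at (\<chi> k. a0))"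
    and "GDERIV (\<lambda>x. g x x) a0 :> 0 \<Longrightarrow> g1 (a0, a0) = 0"
    and "bounded_linear (hessian (\<lambda>x. g x x) a0)"
proof -
  have gd: "GDERIV (\<lambda>x. g x x) x :> 2 *\<^sub>R g1 (x, x)" if "x \<in> \<Omega>" for x
  proof -
    have "((\<lambda>p. g (fst p) (snd p)) has_derivative (\<lambda>h. fst h \<bullet> g1 (x, x) + snd h \<bullet> g1 (x, x))) (at (x, x))"
      using g1(2) that unfolding partial_gradient_def by blast
    then have "((\<lambda>x. g (fst (x, x)) (snd (x, x))) has_derivative (\<lambda>h. fst (h, h) \<bullet> g1 (x, x) + snd (h, h) \<bullet> g1 (x, x))) (at x)"
      by (rule has_derivative_compose[where f = "\<lambda>x. (x, x)" and f' = "\<lambda>h. (h, h)" and g = "\<lambda>p. g (fst p) (snd p)", rotated])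
         (intro has_derivative_Pair has_derivative_ident)
    moreover have "h \<bullet> (2 *\<^sub>R v) = h \<bullet> v + h \<bullet> v" for h v :: "real^2"
      by (simp only: inner_scaleR_right mult_2)
    ultimately show ?thesis unfolding gderiv_def by simp
  qed
  show "g1 (a0, a0) = 0" if "GDERIV (\<lambda>x. g x x) a0 :> 0"
    using grad_eqI[OF that] grad_eqI[OF gd[OF \<Omega>(2)]] by simp
  obtain g1' where g1': "\<forall>p\<in>\<Omega> \<times> \<Omega>. (g1 has_derivative blinfun_apply (g1' p)) (at p)"
    using g1(1) unfolding C1_map_def by metis
  define B where "B = g1' (a0, a0)"
  have B: "(g1 has_derivative blinfun_apply B) (at (a0, a0))" using g1' \<Omega>(2) by (simp add: B_def)
  have "((\<lambda>x. 2 *\<^sub>R g1 (x, x)) has_derivative (\<lambda>v. 2 *\<^sub>R B (v, v))) (at a0)"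
    by (intro has_derivative_scaleR_right has_derivative_compose[where f = "\<lambda>x. (x, x)" and f' = "\<lambda>h. (h, h)" and g = g1, OF _ B])
       (auto intro!: derivative_eq_intros)
  then have hd: "(grad (\<lambda>x. g x x) has_derivative (\<lambda>v. 2 *\<^sub>R B (v, v))) (at a0)"
    by (rule has_derivative_transform_within_open[OF _ \<Omega>]) (simp add: grad_eqI[OF gd])
  have hess: "hessian (\<lambda>x. g x x) a0 = (\<lambda>v. 2 *\<^sub>R B (v, v))"
    unfolding hessian_def by (rule frechet_derivative_at[OF hd, symmetric])
  show "bounded_linear (hessian (\<lambda>x. g x x) a0)"
    unfolding hess using hd by (rule has_derivative_bounded_linear)
  define \<Gamma>t where "\<Gamma>t = (\<Sum>k\<in>UNIV. \<Gamma> k)"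
  have 1: "((\<lambda>z. g1 (z $ k, z $ j)) has_derivative (\<lambda>x. B (x $ k, x $ j))) (at (\<chi> k. a0))" for j k :: 'n
    by (rule has_derivative_compose[where f = "\<lambda>z. (z $ k, z $ j)" and f' = "\<lambda>x. (x $ k, x $ j)" and g = g1])
       (auto intro!: bounded_linear_imp_has_derivative bounded_linear_Pair bounded_linear_vec_nth B)
  have "((\<lambda>z. \<Sum>k\<in>UNIV. gradF \<Gamma> g1 z $ k) has_derivative
     (\<lambda>x. \<Sum>k\<in>UNIV. (2 * \<Gamma> k) *\<^sub>R (\<Sum>j\<in>UNIV. \<Gamma> j *\<^sub>R B (x $ k, x $ j)))) (at (\<chi> k. a0))"
    unfolding gradF_def by (simp, intro has_derivative_sum has_derivative_scaleR_right 1)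
  moreover have "(\<Sum>k\<in>UNIV. (2 * \<Gamma> k) *\<^sub>R (\<Sum>j\<in>UNIV. \<Gamma> j *\<^sub>R B (x $ k, x $ j))) =
      \<Gamma>t *\<^sub>R hessian (\<lambda>x. g x x) a0 (\<Sum>k\<in>UNIV. \<Gamma> k *\<^sub>R x $ k)" for x :: "(real^2)^'n"
  proof -
    let ?s = "\<Sum>k\<in>UNIV. \<Gamma> k *\<^sub>R x $ k"
    have linB: "linear (blinfun_apply B)" by (rule bounded_linear.linear[OF blinfun.bounded_linear_right])
    have "(\<Sum>j\<in>UNIV. \<Gamma> j *\<^sub>R B (x $ k, x $ j)) = B (\<Sum>j\<in>UNIV. \<Gamma> j *\<^sub>R (x $ k, x $ j))" for k
      by (simp only: linear_sum[OF linB] linear_scale[OF linB])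
    also have "\<dots> k = B (\<Gamma>t *\<^sub>R x $ k, ?s)" for k
      by (simp add: sum_prod scaleR_sum_left[symmetric] \<Gamma>t_def)
    finally have "(\<Sum>k\<in>UNIV. (2 * \<Gamma> k) *\<^sub>R (\<Sum>j\<in>UNIV. \<Gamma> j *\<^sub>R B (x $ k, x $ j))) =
        2 *\<^sub>R B (\<Sum>k\<in>UNIV. \<Gamma> k *\<^sub>R (\<Gamma>t *\<^sub>R x $ k, ?s))"
      by (simp only: linear_sum[OF linB] linear_scale[OF linB] scaleR_sum_right scaleR_scaleR)
    also have "(\<Sum>k\<in>UNIV. \<Gamma> k *\<^sub>R (\<Gamma>t *\<^sub>R x $ k, ?s)) = \<Gamma>t *\<^sub>R (?s, ?s)"
    proof -
      define s where "s = ?s"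
      have "(\<Sum>k\<in>UNIV. \<Gamma> k *\<^sub>R (\<Gamma>t *\<^sub>R x $ k, s)) = (\<Sum>k\<in>UNIV. (\<Gamma> k * \<Gamma>t) *\<^sub>R x $ k, \<Gamma>t *\<^sub>R s)"
        by (simp add: sum_prod scaleR_sum_left[symmetric] \<Gamma>t_def[symmetric])
      moreover have "(\<Sum>k\<in>UNIV. (\<Gamma> k * \<Gamma>t) *\<^sub>R x $ k) = \<Gamma>t *\<^sub>R s"
        by (simp add: s_def scaleR_sum_right mult.commute)
      ultimately show ?thesis by (simp add: s_def)
    qed
    finally show ?thesis by (simp only: hess blinfun.scaleR_right scaleR_scaleR mult.commute)
  qed
  ultimately show "((\<lambda>z. \<Sum>k\<in>UNIV. gradF \<Gamma> g1 z $ k) has_derivative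
     (\<lambda>x. (\<Sum>k\<in>UNIV. \<Gamma> k) *\<^sub>R hessian (\<lambda>x. g x x) a0 (\<Sum>k\<in>UNIV. \<Gamma> k *\<^sub>R x $ k))) (at (\<chi> k. a0))"
    unfolding \<Gamma>t_def[symmetric] by simp
qed

section \<open>Relative equilibria\<close>

lemma bounded_linear_vec_lambda:
  fixes f :: "'i::finite \<Rightarrow> 'a::real_normed_vector \<Rightarrow> 'b::real_normed_vector"
  assumes "\<And>i. bounded_linear (f i)" shows "bounded_linear (\<lambda>x. \<chi> i. f i x)"
proof -
  have "(\<lambda>x. \<chi> i. f i x) = (\<lambda>x. \<Sum>i\<in>UNIV. axis i (f i x))"
    by (simp add: fun_eq_iff vec_eq_iff axis_def if_distrib cong: if_cong)
  then show ?thesis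
    by (simp add: bounded_linear_sum bounded_linear_compose[OF bounded_linear_axis assms])
qed

locale vortex =
  fixes \<Gamma> :: "'n::finite \<Rightarrow> real"
  assumes \<Gamma>: "\<And>k. \<Gamma> k \<noteq> 0" and \<Gamma>t: "(\<Sum>k\<in>UNIV. \<Gamma> k) \<noteq> 0"
begin

definition "\<Gamma>t = (\<Sum>k\<in>UNIV. \<Gamma> k)"
text \<open>The inverse of \<open>M_mult \<Gamma>\<close> after \<open>J_mult\<close>: it turns
  gradients into Hamiltonian vector fields.\<close>

definition MJ :: "(real^2)^'n \<Rightarrow> (real^2)^'n" where "MJ w = (\<chi> k. (1 / \<Gamma> k) *\<^sub>R J (w $ k))"
definition vort :: "(real^2)^'n \<Rightarrow> real^2" where "vort w = (\<Sum>k\<in>UNIV. \<Gamma> k *\<^sub>R w $ k)"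
definition diag :: "real^2 \<Rightarrow> (real^2)^'n" where "diag c = (\<chi> k. c)"
text \<open>The projection onto configurations of vanishing vorticity moment along the translations;
  it exists because the total circulation is nonzero.\<close>

definition centred :: "(real^2)^'n \<Rightarrow> (real^2)^'n" where "centred w = w - diag ((1 / \<Gamma>t) *\<^sub>R vort w)"

text \<open>
  Adding \<open>l *\<^sub>R drift u\<close> to the vector field breaks the conservation of energy, so that \<open>l = 0\<close> on periodic
  solutions, but it keeps the centre of vorticity.
\<close>
definition drift :: "(real^2)^'n \<Rightarrow> (real^2)^'n" where "drift u = centred (\<chi> k. \<Gamma> k *\<^sub>R u $ k)"

lemma \<Gamma>t_nz: "\<Gamma>t \<noteq> 0" using \<Gamma>t by (simp add: \<Gamma>t_def)

lemma bounded_linear_MJ: "bounded_linear MJ" unfolding MJ_def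
  by (intro bounded_linear_vec_lambda bounded_linear_compose[OF bounded_linear_scaleR_right]
      bounded_linear_compose[OF bounded_linear_J] bounded_linear_vec_nth)
lemma bounded_linear_vort: "bounded_linear vort" unfolding vort_def
  by (intro bounded_linear_sum bounded_linear_compose[OF bounded_linear_scaleR_right] bounded_linear_vec_nth)
lemma bounded_linear_diag: "bounded_linear diag" unfolding diag_def
  by (intro bounded_linear_vec_lambda bounded_linear_ident)
lemma bounded_linear_centred: "bounded_linear centred" unfolding centred_def
  by (intro bounded_linear_sub bounded_linear_ident bounded_linear_compose[OF bounded_linear_diag]
      bounded_linear_compose[OF bounded_linear_scaleR_right] bounded_linear_vort)
lemma bounded_linear_drift: "bounded_linear drift" unfolding drift_def
  by (intro bounded_linear_compose[OF bounded_linear_centred] bounded_linear_vec_lambda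
      bounded_linear_compose[OF bounded_linear_scaleR_right] bounded_linear_vec_nth)

sublocale MJ: bounded_linear MJ by (rule bounded_linear_MJ)
sublocale vort: bounded_linear vort by (rule bounded_linear_vort)
sublocale diag: bounded_linear diag by (rule bounded_linear_diag)
sublocale centred: bounded_linear centred by (rule bounded_linear_centred)
sublocale drift: bounded_linear drift by (rule bounded_linear_drift)

text \<open>The centre of vorticity reacts only to the total force.\<close>

lemma vort_MJ: "vort (MJ w) = J (\<Sum>k\<in>UNIV. w $ k)"
  using \<Gamma> by (simp add: vort_def MJ_def linear_sum[OF bounded_linear.linear[OF bounded_linear_J]])
lemma vort_J_mult: "vort (J_mult w) = J (vort w)"
  by (simp add: vort_def J_mult_def linear_sum[OF bounded_linear.linear[OF bounded_linear_J]] J_linear)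
lemma vort_diag: "vort (diag c) = \<Gamma>t *\<^sub>R c"
  by (simp add: vort_def diag_def \<Gamma>t_def scaleR_sum_left)
lemma vort_centred [simp]: "vort (centred w) = 0"
  using \<Gamma>t_nz by (simp add: centred_def vort.diff vort_diag)
lemma vort_drift [simp]: "vort (drift w) = 0" by (simp add: drift_def)
lemma centred_eq: "vort w = 0 \<Longrightarrow> centred w = w" by (simp add: centred_def diag.zero)
lemma MJ_skew: "MJ v \<bullet> w = - (v \<bullet> MJ w)"
  by (simp add: MJ_def inner_conf J_inner sum_negf)
lemma MJ_self [simp]: "v \<bullet> MJ v = 0"
  by (simp add: MJ_def inner_conf)

end

section \<open>Dimension counts for spaces of functions\<close>

lemma sum_lt_3: "(\<Sum>i<3. f i) = f 0 + f 1 + f (2::nat)"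
  by (simp add: numeral_eq_Suc)

text \<open>In coordinates with respect to a basis, three independent elements define an injective,
  hence surjective, linear map of \<open>real^3\<close>.\<close>

lemma has_fun_dim_3_span:
  assumes S: "has_fun_dim S 3" and x: "x1 \<in> S" "x2 \<in> S" "x3 \<in> S" and w: "w \<in> S"
    and indep: "\<And>a b c. (\<And>t. a *\<^sub>R x1 t + b *\<^sub>R x2 t + c *\<^sub>R x3 t = 0) \<Longrightarrow> a = 0 \<and> b = 0 \<and> c = 0"
  shows "\<exists>a b c. \<forall>t. w t = a *\<^sub>R x1 t + b *\<^sub>R x2 t + c *\<^sub>R x3 t"
proof -
  obtain e where span: "\<forall>w\<in>S. \<exists>c. \<forall>t. w t = (\<Sum>i<3::nat. c i *\<^sub>R e i t)"
    using S unfolding has_fun_dim_def by blast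
  obtain c1 where c1: "\<forall>t. x1 t = (\<Sum>i<3. c1 i *\<^sub>R e i t)" using bspec[OF span x(1)] by blast
  obtain c2 where c2: "\<forall>t. x2 t = (\<Sum>i<3. c2 i *\<^sub>R e i t)" using bspec[OF span x(2)] by blast
  obtain c3 where c3: "\<forall>t. x3 t = (\<Sum>i<3. c3 i *\<^sub>R e i t)" using bspec[OF span x(3)] by blast
  obtain cw where cw: "\<forall>t. w t = (\<Sum>i<3. cw i *\<^sub>R e i t)" using bspec[OF span w] by blast
  note c = c1[rule_format] c2[rule_format] c3[rule_format] cw[rule_format]
  define co where "co a i = a $ 1 * c1 i + a $ 2 * c2 i + a $ 3 * c3 i" for a :: "real^3" and i :: nat
  define L where "L a = (vector [co a 0, co a 1, co a 2] :: real^3)" for a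
  have comb: "a $ 1 *\<^sub>R x1 t + a $ 2 *\<^sub>R x2 t + a $ 3 *\<^sub>R x3 t = (\<Sum>i<3. co a i *\<^sub>R e i t)" for a t
    by (simp add: c sum_lt_3 co_def algebra_simps)
  have "linear L"
    by (rule linearI) (auto simp: L_def vec_eq_iff forall_3 co_def algebra_simps)
  moreover have "inj L" unfolding linear_injective_0[OF \<open>linear L\<close>]
  proof (intro allI impI)
    fix a assume "L a = 0"
    then have "co a 0 = 0" "co a 1 = 0" "co a 2 = 0" by (auto simp: L_def vec_eq_iff forall_3)
    then have "a $ 1 *\<^sub>R x1 t + a $ 2 *\<^sub>R x2 t + a $ 3 *\<^sub>R x3 t = 0" for t
      unfolding comb by (simp add: sum_lt_3)
    then have "a $ 1 = 0 \<and> a $ 2 = 0 \<and> a $ 3 = 0" by (rule indep)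
    then show "a = 0" by (simp add: vec_eq_iff forall_3)
  qed
  ultimately have "surj L" by (rule linear_inj_imp_surj)
  then obtain a where "L a = vector [cw 0, cw 1, cw 2]" by (metis surjD)
  then have "co a 0 = cw 0" "co a 1 = cw 1" "co a 2 = cw 2" by (auto simp: L_def vec_eq_iff forall_3)
  then have "w t = a $ 1 *\<^sub>R x1 t + a $ 2 *\<^sub>R x2 t + a $ 3 *\<^sub>R x3 t" for t
    unfolding comb by (simp add: c(4) sum_lt_3)
  then show ?thesis by blast
qed

text \<open>Constant functions are determined by one value, and here the values inject into a plane.
  Used to exclude a single vortex.\<close>

lemma has_fun_dim_3_not_plane:
  fixes S :: "(real \<Rightarrow> 'a::real_vector) set" and f :: "'a \<Rightarrow> real^2"
  assumes S: "has_fun_dim S 3" and f: "linear f" "inj f" and const: "\<And>w t. w \<in> S \<Longrightarrow> w t = w 0"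
  shows False
proof -
  obtain e where e: "\<forall>i<3. e i \<in> S"
    "\<forall>c::nat \<Rightarrow> real. (\<forall>t. (\<Sum>i<3. c i *\<^sub>R e i t) = 0) \<longrightarrow> (\<forall>i<3. c i = 0)"
    using S unfolding has_fun_dim_def by blast
  define c :: "real^3 \<Rightarrow> nat \<Rightarrow> real" where "c a i = (if i = 0 then a $ 1 else if i = 1 then a $ 2 else a $ 3)" for a i
  define s where "s a = (\<Sum>i<3. c a i *\<^sub>R e i 0)" for a
  have s: "s (a + b) = s a + s b" "s (k *\<^sub>R a) = k *\<^sub>R s a" for a b k
    by (simp_all add: s_def sum_lt_3 c_def algebra_simps)
  \<comment> \<open>Padding the plane with a zero third coordinate gives an endomorphism of
    \<open>real^3\<close>, for which injectivity and the missed third axis contradict each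
    other.\<close>
  define L where "L a = (vector [f (s a) $ 1, f (s a) $ 2, 0] :: real^3)" for a
  have "linear L"
    by (rule linearI) (auto simp: L_def vec_eq_iff forall_3 s linear_add[OF f(1)] linear_scale[OF f(1)])
  moreover have "inj L" unfolding linear_injective_0[OF \<open>linear L\<close>]
  proof (intro allI impI)
    fix a assume "L a = 0"
    then have "f (s a) = 0" by (auto simp: L_def vec_eq_iff forall_3 forall_2)
    then have "s a = 0" using f by (metis inj_eq linear_0)
    have "(\<Sum>i<3. c a i *\<^sub>R e i t) = s a" for t
      unfolding s_def by (rule sum.cong) (use e(1) const in auto)
    then have "\<forall>i<3. c a i = 0" using e(2) \<open>s a = 0\<close> by simp
    then have "c a 0 = 0" "c a 1 = 0" "c a 2 = 0" by auto
    then show "a = 0" by (simp add: vec_eq_iff forall_3 c_def)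
  qed
  ultimately have "surj L" by (rule linear_inj_imp_surj)
  then obtain a where "L a = vector [0, 0, 1]" by (metis surjD)
  then show False by (simp add: L_def vec_eq_iff forall_3)
qed

section \<open>The rotating solution and its periodic linearisation\<close>

locale vortex_equilibrium = vortex \<Gamma> for \<Gamma> :: "'n::finite \<Rightarrow> real" +
  fixes \<omega> :: real and z :: "(real^2)^'n"
  assumes \<omega>: "\<bar>\<omega>\<bar> = 1" and nd: "nondegenerate_relative_equilibrium \<Gamma> \<omega> z"
begin

abbreviation Z :: "real \<Rightarrow> (real^2)^'n" where "Z \<equiv> rotating \<omega> z"

lemma Z_0 [simp]: "Z 0 = z" by (simp add: rotating_eq)

lemma Z_nth: "Z t $ k = cos (\<omega> * t) *\<^sub>R (z $ k) - sin (\<omega> * t) *\<^sub>R J (z $ k)"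
  by (simp add: rotating_eq)

lemma \<omega>_cases: "\<omega> = 1 \<or> \<omega> = -1" and \<omega>_sq: "\<omega> * \<omega> = 1"
  using \<omega> by (auto simp: abs_if split: if_splits)

lemma Z_periodic: "Z (t + 2 * pi) = Z t"
  using \<omega>_cases by (auto simp: vec_eq_iff Z_nth algebra_simps cos_add sin_add cos_diff sin_diff)

lemma Z_pi: "Z pi = - z"
  using \<omega>_cases by (auto simp: vec_eq_iff Z_nth)

lemma Z_config: "Z t \<in> config_space UNIV"
  using nd unfolding nondegenerate_relative_equilibrium_def relative_equilibrium_def HS0_solution_def vortex_solution_def
  by blast

lemma Z_eq: "Z t = cos (\<omega> * t) *\<^sub>R z - sin (\<omega> * t) *\<^sub>R J_mult z"
  by (rule vec_eq_iff[THEN iffD2]) (simp add: Z_nth J_mult_def)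

lemma Z_deriv: "(Z has_vector_derivative (- \<omega>) *\<^sub>R J_mult (Z t)) (at t)"
proof (rule has_vector_derivative_vec_iff[THEN iffD2], rule allI)
  fix k
  have "((\<lambda>t. cos (\<omega> * t) *\<^sub>R (z $ k) - sin (\<omega> * t) *\<^sub>R J (z $ k)) has_vector_derivative
    (- \<omega> * sin (\<omega> * t)) *\<^sub>R (z $ k) - (\<omega> * cos (\<omega> * t)) *\<^sub>R J (z $ k)) (at t)"
    by (auto intro!: derivative_eq_intros simp: has_real_derivative_iff_has_vector_derivative[symmetric] mult.commute)
  then show "((\<lambda>t. Z t $ k) has_vector_derivative (- \<omega> *\<^sub>R J_mult (Z t)) $ k) (at t)"
    unfolding Z_nth J_mult_def by (simp add: Z_nth J_linear algebra_simps)
qed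

lemma Z_cont: "continuous_on S Z"
  using Z_deriv has_vector_derivative_continuous continuous_at_imp_continuous_on by blast

lemma X0_Z: "MJ (gradH0 \<Gamma> (Z t)) = (- \<omega>) *\<^sub>R J_mult (Z t)"
proof (rule vec_eq_iff[THEN iffD2], rule allI)
  fix k
  have "HS0_solution \<Gamma> Z" using nd unfolding nondegenerate_relative_equilibrium_def relative_equilibrium_def by blast
  then obtain v where v: "((\<lambda>s. Z s $ k) has_vector_derivative v) (at t)"
      "\<Gamma> k *\<^sub>R v = J (partial_grad k (ham_H0 \<Gamma>) (Z t))"
    unfolding HS0_solution_def vortex_solution_def by blast
  have "((\<lambda>s. Z s $ k) has_vector_derivative (- \<omega> *\<^sub>R J_mult (Z t)) $ k) (at t)"
    using has_vector_derivative_vec_iff[THEN iffD1, OF Z_deriv] by blast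
  then have "v = (- \<omega> *\<^sub>R J_mult (Z t)) $ k" using v(1) vector_derivative_unique_at by blast
  moreover have "v = (1 / \<Gamma> k) *\<^sub>R J (gradH0 \<Gamma> (Z t) $ k)"
    using v(2) \<Gamma>[of k] unfolding partial_grad_eqI[OF GDERIV_ham_H0[OF Z_config]]
    by (metis divide_self scaleR_one scaleR_scaleR times_divide_eq_left mult_1)
  ultimately show "MJ (gradH0 \<Gamma> (Z t)) $ k = (- \<omega> *\<^sub>R J_mult (Z t)) $ k" by (simp add: MJ_def)
qed

lemma Z_deriv': "(Z has_vector_derivative MJ (gradH0 \<Gamma> (Z t))) (at t)"
  unfolding X0_Z by (rule Z_deriv)

text \<open>Cancelling \<open>J\<close> in the equation of motion shows that \<open>Z t\<close> is a
  critical point of \<open>ham_H0\<close> plus \<open>\<omega> / 2\<close> times the sum of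
  \<open>\<Gamma> k * (norm (x $ k))\<^sup>2\<close>.\<close>

lemma gradH0_Z: "gradH0 \<Gamma> (Z t) $ k = (- \<omega> * \<Gamma> k) *\<^sub>R (Z t $ k)"
proof -
  have "(1 / \<Gamma> k) *\<^sub>R J (gradH0 \<Gamma> (Z t) $ k) = - \<omega> *\<^sub>R J (Z t $ k)"
    using arg_cong[OF X0_Z, of "\<lambda>w. w $ k" t] by (simp add: MJ_def J_mult_def)
  then have "\<Gamma> k *\<^sub>R ((1 / \<Gamma> k) *\<^sub>R J (gradH0 \<Gamma> (Z t) $ k)) = \<Gamma> k *\<^sub>R (- \<omega> *\<^sub>R J (Z t $ k))" by simp
  then have "J (gradH0 \<Gamma> (Z t) $ k) = J ((- \<omega> * \<Gamma> k) *\<^sub>R (Z t $ k))"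
    using \<Gamma>[of k] by (simp add: J_linear mult.commute)
  then have "J (gradH0 \<Gamma> (Z t) $ k - (- \<omega> * \<Gamma> k) *\<^sub>R (Z t $ k)) = 0"
    unfolding matrix_vector_mult_diff_distrib by (simp only: diff_self)
  then show ?thesis unfolding J_eq_0_iff by (rule eq_iff_diff_eq_0[THEN iffD2])
qed

text \<open>The motion is a rotation about 0, but the total force vanishes, so the vorticity moment
  can only be 0.\<close>

lemma vort_Z [simp]: "vort (Z t) = 0"
proof -
  have "J (vort (Z t)) = vort (J_mult (Z t))" by (simp add: vort_J_mult)
  also have "\<dots> = (- \<omega>) *\<^sub>R vort ((- \<omega>) *\<^sub>R J_mult (Z t))" using \<omega>_sq by (simp only: vort.scaleR scaleR_scaleR minus_mult_minus scaleR_one)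
  also have "\<dots> = 0" unfolding X0_Z[symmetric] vort_MJ sum_gradH0 by simp
  finally show ?thesis by simp
qed

text \<open>The squares make this positive whatever the signs of the circulations, unlike the sum
  with weights \<open>\<Gamma> k\<close>. For this reason \<open>drift\<close> carries a factor
  \<open>\<Gamma> k\<close>: the energy then changes along it at a nonzero rate.\<close>

definition "\<kappa> = (\<Sum>k\<in>UNIV. (\<Gamma> k)\<^sup>2 * (z $ k \<bullet> z $ k))"

lemma gradH0_drift_Z: "gradH0 \<Gamma> (Z t) \<bullet> drift (Z t) = - \<omega> * \<kappa>"
proof -
  have n: "Z t $ k \<bullet> Z t $ k = z $ k \<bullet> z $ k" for k
  proof -
    have "Z t $ k \<bullet> Z t $ k = (cos (\<omega> * t) * cos (\<omega> * t)) * (z $ k \<bullet> z $ k) + (sin (\<omega> * t) * sin (\<omega> * t)) * (z $ k \<bullet> z $ k)"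
      unfolding Z_nth by (simp add: inner_diff_left inner_diff_right)
    also have "\<dots> = ((cos (\<omega> * t))\<^sup>2 + (sin (\<omega> * t))\<^sup>2) * (z $ k \<bullet> z $ k)"
      by (simp only: power2_eq_square distrib_right)
    finally show ?thesis by simp
  qed
  \<comment> \<open>The total force vanishes, so the centring inside \<open>drift\<close> does not
    contribute.\<close>
  have "gradH0 \<Gamma> (Z t) \<bullet> diag c = 0" for c
  proof -
    have "gradH0 \<Gamma> (Z t) \<bullet> diag c = (\<Sum>k\<in>UNIV. gradH0 \<Gamma> (Z t) $ k) \<bullet> c" by (simp add: inner_conf diag_def inner_sum_left)
    then show ?thesis by (simp add: sum_gradH0)
  qed
  then have "gradH0 \<Gamma> (Z t) \<bullet> drift (Z t) = gradH0 \<Gamma> (Z t) \<bullet> (\<chi> k. \<Gamma> k *\<^sub>R Z t $ k)"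
    by (simp add: drift_def centred_def inner_diff_right)
  also have "\<dots> = (\<Sum>k\<in>UNIV. - \<omega> * ((\<Gamma> k)\<^sup>2 * (z $ k \<bullet> z $ k)))"
    unfolding inner_conf by (simp add: gradH0_Z n power2_eq_square ac_simps)
  finally show ?thesis by (simp add: \<kappa>_def sum_distrib_left)
qed

lemma linearized_iff:
  "w \<in> linearized_periodic_solutions \<Gamma> \<omega> z \<longleftrightarrow>
     (\<forall>t. w (t + 2 * pi) = w t) \<and> (\<forall>t. (w has_vector_derivative MJ (hessH0 \<Gamma> (Z t) (w t))) (at t))"
proof -
  have "M_mult \<Gamma> v = J_mult x \<longleftrightarrow> v = MJ x" for v x :: "(real^2)^'n"
    using \<Gamma> by (auto simp: vec_eq_iff M_mult_def J_mult_def MJ_def field_simps)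
  then show ?thesis unfolding linearized_periodic_solutions_def hessian_ham_H0[OF Z_config] using \<omega> by simp
qed

lemma dim3: "has_fun_dim (linearized_periodic_solutions \<Gamma> \<omega> z) 3"
  using nd unfolding nondegenerate_relative_equilibrium_def by blast

text \<open>\<open>z = 0\<close> is only possible for \<open>N = 1\<close>, where the linearised equation has a two-dimensional solution space.\<close>
lemma z_nz: "z \<noteq> 0"
proof
  assume "z = 0"
  moreover have "z \<in> config_space UNIV" using Z_config[of 0] by simp
  ultimately have one: "j = k" for j k :: 'n by (auto simp: config_space_def)
  define k0 where "k0 = (undefined :: 'n)"
  show False
  proof (rule has_fun_dim_3_not_plane[OF dim3, of "\<lambda>w. w $ k0"])
    show "linear (\<lambda>w :: (real^2)^'n. w $ k0)" by (intro bounded_linear.linear bounded_linear_vec_nth)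
    show "inj (\<lambda>w :: (real^2)^'n. w $ k0)" using one by (auto simp: inj_def vec_eq_iff) metis
    fix w t assume "w \<in> linearized_periodic_solutions \<Gamma> \<omega> z"
    moreover have "hessH0 \<Gamma> y v = 0" for y v
    proof -
      have "v $ k - v $ j = 0" for k j using one[of k j] by simp
      then have "hessH0 \<Gamma> y v = (\<chi> k. 0)"
        unfolding hessH0_def by (simp only: ker'_0 scaleR_zero_right sum.neutral_const)
      then show ?thesis unfolding zero_vec_def[symmetric] .
    qed
    ultimately have "(w has_vector_derivative 0) (at t)" for t unfolding linearized_iff by (simp add: MJ.zero)
    then show "w t = w 0"
      using has_vector_derivative_zero_constant[of UNIV w] by (metis UNIV_I convex_UNIV)
  qed
qed

lemma \<kappa>_pos: "\<kappa> > 0"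
proof -
  obtain k where "z $ k \<noteq> 0" using z_nz by (auto simp: vec_eq_iff)
  then have "0 < (\<Gamma> k)\<^sup>2 * (z $ k \<bullet> z $ k)" using \<Gamma>[of k] by simp
  then show ?thesis unfolding \<kappa>_def by (intro sum_pos2[of _ k]) auto
qed

text \<open>The velocity of \<open>Z\<close> and the two translations are periodic solutions of the
  linearised system; being independent, they exhaust a space of dimension three.\<close>

lemma linearized_kernel:
  assumes w: "w \<in> linearized_periodic_solutions \<Gamma> \<omega> z"
  obtains a c where "\<And>t. w t = a *\<^sub>R J_mult (Z t) + diag c"
proof -
  let ?L = "linearized_periodic_solutions \<Gamma> \<omega> z"
  define x1 where "x1 t = MJ (gradH0 \<Gamma> (Z t))" for t
  have x1: "x1 \<in> ?L" unfolding linearized_iff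
  proof (intro conjI allI)
    show "x1 (t + 2 * pi) = x1 t" for t by (simp add: x1_def Z_periodic)
    fix t
    have "((\<lambda>t. gradH0 \<Gamma> (Z t)) has_derivative (\<lambda>h. hessH0 \<Gamma> (Z t) (h *\<^sub>R x1 t))) (at t)"
      by (rule has_derivative_compose[OF Z_deriv'[unfolded has_vector_derivative_def] gradH0_has_derivative[OF Z_config], folded x1_def])
    from bounded_linear.has_derivative[OF bounded_linear_MJ this]
    show "(x1 has_vector_derivative MJ (hessH0 \<Gamma> (Z t) (x1 t))) (at t)"
      unfolding has_vector_derivative_def x1_def
      using has_derivative_bounded_linear[OF gradH0_has_derivative[OF Z_config[of t], of \<Gamma>]]
      by (simp add: linear_simps MJ.scaleR)
  qed
  have x2: "(\<lambda>t. diag c) \<in> ?L" for c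
    unfolding linearized_iff diag_def by (simp add: MJ.zero)
  have "\<exists>a b d. \<forall>t. w t = a *\<^sub>R x1 t + b *\<^sub>R diag (axis 1 1) + d *\<^sub>R diag (axis 2 1)"
  proof (rule has_fun_dim_3_span[OF dim3 x1 x2 x2 w])
    fix a b c :: real
    assume *: "a *\<^sub>R x1 t + b *\<^sub>R diag (axis 1 1) + c *\<^sub>R diag (axis 2 1) = 0" for t
    \<comment> \<open>Half a period reverses the velocity and leaves translations alone, so
      comparing the two times separates the coefficient \<open>a\<close> from \<open>b\<close> and
      \<open>c\<close>.\<close>
    have x0: "x1 0 = - \<omega> *\<^sub>R J_mult z" "x1 pi = \<omega> *\<^sub>R J_mult z"
      unfolding x1_def X0_Z unfolding Z_pi by (auto simp: vec_eq_iff J_mult_def J_linear)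
    define X where "X = a *\<^sub>R (\<omega> *\<^sub>R J_mult z)"
    define C where "C = b *\<^sub>R diag (axis 1 1) + c *\<^sub>R diag (axis 2 1)"
    have "- X + C = a *\<^sub>R x1 0 + b *\<^sub>R diag (axis 1 1) + c *\<^sub>R diag (axis 2 1)"
      "X + C = a *\<^sub>R x1 pi + b *\<^sub>R diag (axis 1 1) + c *\<^sub>R diag (axis 2 1)"
      unfolding x0 X_def C_def by (simp_all add: add.assoc)
    then have 1: "- X + C = 0" "X + C = 0" by (simp_all only: *)
    have "X + X = (X + C) - (- X + C)" by simp
    also have "\<dots> = 0" by (simp only: 1 diff_self)
    finally have "a *\<^sub>R (\<omega> *\<^sub>R J_mult z) + a *\<^sub>R (\<omega> *\<^sub>R J_mult z) = 0" unfolding X_def .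
    then have "(2 * a * \<omega>) *\<^sub>R J_mult z = 0" by (simp only: scaleR_2[symmetric] scaleR_scaleR mult.assoc)
    moreover have "J_mult z \<noteq> 0"
    proof
      assume "J_mult z = 0"
      have "z $ k = 0" for k
      proof -
        have "J_mult z $ k = 0" using \<open>J_mult z = 0\<close> by simp
        then show ?thesis unfolding J_mult_def by simp
      qed
      then show False using z_nz by (metis vec_eq_iff zero_index)
    qed
    ultimately have "2 * a * \<omega> = 0" by (metis scaleR_eq_0_iff)
    then have "a = 0" using \<omega> by auto
    then have "b *\<^sub>R diag (axis 1 1) + c *\<^sub>R diag (axis 2 1) = 0" using 1(2) unfolding X_def C_def by simp
    then have "b *\<^sub>R axis 1 1 + c *\<^sub>R axis 2 1 = (0 :: real^2)" by (simp add: diag_def vec_eq_iff)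
    then show "a = 0 \<and> b = 0 \<and> c = 0" using \<open>a = 0\<close> by (simp add: vec_eq_iff forall_2 axis_def)
  qed
  then obtain a b d where *: "\<And>t. w t = a *\<^sub>R x1 t + b *\<^sub>R diag (axis 1 1) + d *\<^sub>R diag (axis 2 1)"
    by blast
  show ?thesis
  proof (rule that)
    show "w t = (- (a * \<omega>)) *\<^sub>R J_mult (Z t) + diag (b *\<^sub>R axis 1 1 + d *\<^sub>R axis 2 1)" for t
      unfolding * x1_def X0_Z by (simp add: diag.add diag.scaleR)
  qed
qed

end

section \<open>The rescaled system\<close>

type_synonym 'n config = "(real^2)^'n"
type_synonym 'n state = "'n config \<times> real \<times> (real^2)"

lemma integral_has_vector_derivative_Icc:
  fixes y :: "real \<Rightarrow> 'a::banach"
  assumes f: "continuous_on {0..T} f" and y: "\<And>t. t \<in> {0..T} \<Longrightarrow> y t = a + integral {0..t} f" and t: "t \<in> {0..T}"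
  shows "(y has_vector_derivative f t) (at t within {0..T})"
proof -
  have *: "((\<lambda>t. a + integral {0..t} f) has_vector_derivative 0 + f t) (at t within {0..T})"
    by (intro has_vector_derivative_add has_vector_derivative_const integral_has_vector_derivative f t)
  show ?thesis
    by (rule has_vector_derivative_transform[OF t y]) (use * in simp_all)
qed

lemma vector_derivative_zero_imp_eq:
  fixes f :: "real \<Rightarrow> 'a::banach"
  assumes "\<And>t. t \<in> {0..T} \<Longrightarrow> (f has_vector_derivative 0) (at t within {0..T})" "t \<in> {0..T}"
  shows "f t = f 0"
proof -
  obtain c where c: "\<And>t. t \<in> {0..T} \<Longrightarrow> f t = c"
    using has_vector_derivative_zero_constant[of "{0..T}" f] assms(1) by auto
  show ?thesis using c[OF assms(2)] c[of 0] assms(2) by simp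
qed

locale vortex_domain = vortex_equilibrium \<Gamma> \<omega> z for \<Gamma> :: "'n::finite \<Rightarrow> real" and \<omega> z +
  fixes \<Omega> :: "(real^2) set" and g :: "real^2 \<Rightarrow> real^2 \<Rightarrow> real" and g1 :: "(real^2) \<times> (real^2) \<Rightarrow> real^2" and a0 :: "real^2"
  assumes \<Omega>: "open \<Omega>" "a0 \<in> \<Omega>" and g1: "C1_map (\<Omega> \<times> \<Omega>) g1" "partial_gradient \<Omega> g g1"
    and crit: "nondegenerate_critical_point (\<lambda>x. g x x) a0"
begin

abbreviation "gF \<equiv> gradF \<Gamma> g1"
definition "c0 = diag a0"
definition "\<Omega>N = {x :: (real^2)^'n. \<forall>k. x $ k \<in> \<Omega>}"
definition total :: "(real^2)^'n \<Rightarrow> real^2" where "total x = (\<Sum>k\<in>UNIV. x $ k)"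
definition "Hs = hessian (\<lambda>x. g x x) a0"
definition D :: "(real^2)^'n \<Rightarrow> real^2" where "D x = \<Gamma>t *\<^sub>R Hs (vort x)"

lemma bounded_linear_total: "bounded_linear total"
  unfolding total_def by (intro bounded_linear_sum bounded_linear_vec_nth)

sublocale total: bounded_linear total by (rule bounded_linear_total)

lemma vort_MJ': "vort (MJ w) = J (total w)" by (simp add: vort_MJ total_def)
lemma total_gradH0 [simp]: "total (gradH0 \<Gamma> x) = 0" by (simp add: total_def sum_gradH0)
lemma total_hessH0 [simp]: "total (hessH0 \<Gamma> x h) = 0" by (simp add: total_def sum_hessH0)

lemma open_\<Omega>N: "open \<Omega>N" unfolding \<Omega>N_def by (rule open_vec_in[OF \<Omega>(1)])
lemma c0_in: "c0 \<in> \<Omega>N" using \<Omega>(2) by (simp add: c0_def diag_def \<Omega>N_def)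

lemma bounded_linear_Hs: "bounded_linear Hs"
  unfolding Hs_def by (rule sum_gradF_derivative(3)[OF \<Omega> g1])
lemma bij_Hs: "bij Hs" using crit by (simp add: nondegenerate_critical_point_def Hs_def)
lemma Hs_eq_0: "Hs x = 0 \<Longrightarrow> x = 0"
  using bij_is_inj[OF bij_Hs] linear_injective_0[OF bounded_linear.linear[OF bounded_linear_Hs]] by blast

lemma bounded_linear_D: "bounded_linear D" unfolding D_def
  by (intro bounded_linear_compose[OF bounded_linear_scaleR_right] bounded_linear_compose[OF bounded_linear_Hs] bounded_linear_vort)

sublocale D: bounded_linear D by (rule bounded_linear_D)

text \<open>With all vortices at \<open>a0\<close> every force is a multiple of
  \<open>g1 (a0, a0)\<close>, half the gradient of \<open>h\<close>.\<close>

lemma gF_c0 [simp]: "gF c0 = 0"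
proof -
  have "g1 (a0, a0) = 0"
    using sum_gradF_derivative(2)[OF \<Omega> g1] crit by (simp add: nondegenerate_critical_point_def)
  then show ?thesis by (simp add: gradF_def c0_def diag_def vec_eq_iff)
qed

lemma C1_gF: "C1_map \<Omega>N gF" unfolding \<Omega>N_def by (rule C1_map_gradF[OF g1(1)])

lemma gF_lipschitz:
  obtains B d where "B > 0" "d > 0" "ball c0 d \<subseteq> \<Omega>N" "\<forall>x\<in>ball c0 d. \<forall>y\<in>ball c0 d. norm (gF x - gF y) \<le> B * norm (x - y)"
proof -
  obtain f' where f': "\<And>x. x \<in> \<Omega>N \<Longrightarrow> (gF has_derivative blinfun_apply (f' x)) (at x)" "continuous_on \<Omega>N f'"
    using C1_gF by (rule C1_mapE) blast
  have c: "compact {c0}" "{c0} \<subseteq> \<Omega>N" using c0_in by auto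
  obtain d where d: "d > 0" "\<forall>x\<in>{c0}. ball x d \<subseteq> \<Omega>N"
    "\<forall>x\<in>{c0}. \<forall>y\<in>ball x d. \<forall>y'\<in>ball x d. norm (gF y - gF y' - f' x (y - y')) \<le> 1 * norm (y - y')"
    using strict_derivative_compact[OF c open_\<Omega>N f' zero_less_one] by metis
  have "norm (gF x - gF y) \<le> (1 + norm (f' c0)) * norm (x - y)" if "x \<in> ball c0 d" "y \<in> ball c0 d" for x y
  proof -
    have "norm (gF x - gF y) \<le> norm (gF x - gF y - f' c0 (x - y)) + norm (f' c0 (x - y))"
      using norm_triangle_sub[of "gF x - gF y" "f' c0 (x - y)"] by simp
    also have "\<dots> \<le> 1 * norm (x - y) + norm (f' c0) * norm (x - y)"
      using d(3) that by (intro add_mono norm_blinfun) auto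
    finally show ?thesis by (simp add: algebra_simps)
  qed
  then show ?thesis using d by (intro that[of "1 + norm (f' c0)" d]) (auto simp: add_pos_nonneg)
qed

text \<open>Strictness at \<open>c0\<close> is what is needed: after rescaling by \<open>r\<close>
  the remainder keeps a small Lipschitz constant, not merely a small size.\<close>

lemma total_gF_strict:
  assumes "e > 0"
  obtains d where "d > 0" "\<forall>x\<in>ball c0 d. \<forall>y\<in>ball c0 d. norm (total (gF x) - total (gF y) - D (x - y)) \<le> e * norm (x - y)"
proof -
  have "C1_map \<Omega>N (\<lambda>x. total (gF x))" by (rule C1_map_linear_compose[OF bounded_linear_total C1_gF])
  then obtain f' where f': "\<And>x. x \<in> \<Omega>N \<Longrightarrow> ((\<lambda>x. total (gF x)) has_derivative blinfun_apply (f' x)) (at x)" "continuous_on \<Omega>N f'"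
    by (rule C1_mapE) blast
  have c: "compact {c0}" "{c0} \<subseteq> \<Omega>N" using c0_in by auto
  have "((\<lambda>x. total (gF x)) has_derivative D) (at c0)"
    using sum_gradF_derivative(1)[OF \<Omega> g1, of \<Gamma>] unfolding total_def D_def \<Gamma>t_def Hs_def vort_def c0_def diag_def .
  then have D: "blinfun_apply (f' c0) = D" using f'(1)[OF c0_in] has_derivative_unique by blast
  obtain d where d: "d > 0" "\<forall>x\<in>{c0}. ball x d \<subseteq> \<Omega>N"
    "\<forall>x\<in>{c0}. \<forall>y\<in>ball x d. \<forall>y'\<in>ball x d. norm (total (gF y) - total (gF y') - f' x (y - y')) \<le> e * norm (y - y')"
    using strict_derivative_compact[OF c open_\<Omega>N f' assms] by metis
  then show ?thesis by (intro that[of d]) (auto simp: D)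
qed

text \<open>The gradient in \<open>u\<close> of the rescaled energy
  \<open>ham_H0 \<Gamma> u - ham_F \<Gamma> g (c0 + r *\<^sub>R u)\<close>; the factor
  \<open>r\<close> is the chain rule.\<close>

definition force :: "real \<Rightarrow> (real^2)^'n \<Rightarrow> (real^2)^'n" where
  "force r u = gradH0 \<Gamma> u - r *\<^sub>R gF (c0 + r *\<^sub>R u)"

definition rescaled_solution :: "real \<Rightarrow> (real \<Rightarrow> (real^2)^'n) \<Rightarrow> bool" where
  "rescaled_solution r u \<longleftrightarrow> (\<forall>t. u t \<in> config_space UNIV \<and> c0 + r *\<^sub>R u t \<in> \<Omega>N \<and>
     (u has_vector_derivative MJ (force r (u t))) (at t))"

lemma rescaled_eq: "rescaled a0 r u t = c0 + r *\<^sub>R u (t / r\<^sup>2)"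
  by (simp add: rescaled_def c0_def diag_def vec_eq_iff)

lemma config_affine:
  assumes "r > 0" shows "c0 + r *\<^sub>R x \<in> config_space \<Omega> \<longleftrightarrow> x \<in> config_space UNIV \<and> c0 + r *\<^sub>R x \<in> \<Omega>N"
  using assms by (auto simp: config_space_def \<Omega>N_def c0_def diag_def)

text \<open>Velocities scale by \<open>r / r\<^sup>2 = 1 / r\<close>, exactly as
  \<open>gradH0\<close> does by homogeneity, so the leading term loses its dependence on
  \<open>r\<close>. Both uniqueness and existence use this equivalence.\<close>

lemma HS_rescaled_iff:
  assumes r: "r > 0"
  shows "HS_solution \<Gamma> \<Omega> g (rescaled a0 r u) \<longleftrightarrow> rescaled_solution r u"
proof -
  let ?x = "rescaled a0 r u"
  have deriv_iff: "(?x has_vector_derivative w) (at t) \<longleftrightarrow> (u has_vector_derivative r *\<^sub>R w) (at (t / r\<^sup>2))" for t w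
  proof
    assume *: "(?x has_vector_derivative w) (at t)"
    have "((\<lambda>s. (1 / r) *\<^sub>R (?x (r\<^sup>2 * s) - c0)) has_vector_derivative (1 / r) *\<^sub>R (r\<^sup>2 *\<^sub>R w)) (at (t / r\<^sup>2))"
    proof -
      have "((\<lambda>s. r\<^sup>2 * s) has_vector_derivative r\<^sup>2) (at (t / r\<^sup>2))"
        by (auto intro!: derivative_eq_intros simp: has_real_derivative_iff_has_vector_derivative[symmetric])
      moreover have "(?x has_vector_derivative w) (at (r\<^sup>2 * (t / r\<^sup>2)))" using * r by simp
      ultimately have "((?x \<circ> (\<lambda>s. r\<^sup>2 * s)) has_vector_derivative r\<^sup>2 *\<^sub>R w) (at (t / r\<^sup>2))"
        by (rule vector_diff_chain_at)
      then have "((\<lambda>s. (?x \<circ> (\<lambda>s. r\<^sup>2 * s)) s - c0) has_vector_derivative r\<^sup>2 *\<^sub>R w - 0) (at (t / r\<^sup>2))"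
        by (intro has_vector_derivative_diff has_vector_derivative_const)
      then show ?thesis
        by (intro bounded_linear.has_vector_derivative[OF bounded_linear_scaleR_right]) (simp add: o_def)
    qed
    moreover have "(\<lambda>s. (1 / r) *\<^sub>R (?x (r\<^sup>2 * s) - c0)) = u" using r by (simp add: rescaled_eq fun_eq_iff)
    moreover have "(1 / r) *\<^sub>R (r\<^sup>2 *\<^sub>R w) = r *\<^sub>R w" using r by (simp add: power2_eq_square)
    ultimately show "(u has_vector_derivative r *\<^sub>R w) (at (t / r\<^sup>2))" by (simp only:)
  next
    assume *: "(u has_vector_derivative r *\<^sub>R w) (at (t / r\<^sup>2))"
    have "((\<lambda>t. t / r\<^sup>2) has_vector_derivative 1 / r\<^sup>2) (at t)"
      by (intro has_real_derivative_iff_has_vector_derivative[THEN iffD1] DERIV_cdivide DERIV_ident)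
    from vector_diff_chain_at[OF this *]
    have "((\<lambda>t. u (t / r\<^sup>2)) has_vector_derivative (1 / r\<^sup>2) *\<^sub>R (r *\<^sub>R w)) (at t)" by (simp add: o_def)
    then have "((\<lambda>t. c0 + r *\<^sub>R u (t / r\<^sup>2)) has_vector_derivative 0 + r *\<^sub>R ((1 / r\<^sup>2) *\<^sub>R (r *\<^sub>R w))) (at t)"
      by (intro has_vector_derivative_add has_vector_derivative_const
          bounded_linear.has_vector_derivative[OF bounded_linear_scaleR_right])
    moreover have "0 + r *\<^sub>R ((1 / r\<^sup>2) *\<^sub>R (r *\<^sub>R w)) = w" using r by (simp add: power2_eq_square)
    ultimately show "(?x has_vector_derivative w) (at t)" unfolding rescaled_eq[abs_def] by simp
  qed
  have point: "(?x t \<in> config_space \<Omega> \<and> (\<forall>k. \<exists>v. ((\<lambda>s. ?x s $ k) has_vector_derivative v) (at t) \<and>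
      \<Gamma> k *\<^sub>R v = J (partial_grad k (ham_H \<Gamma> g) (?x t)))) \<longleftrightarrow>
    (u (t / r\<^sup>2) \<in> config_space UNIV \<and> c0 + r *\<^sub>R u (t / r\<^sup>2) \<in> \<Omega>N \<and>
     (u has_vector_derivative MJ (force r (u (t / r\<^sup>2)))) (at (t / r\<^sup>2)))" for t
  proof (cases "?x t \<in> config_space \<Omega>")
    case True
    let ?s = "t / r\<^sup>2"
    have u: "u ?s \<in> config_space UNIV" "c0 + r *\<^sub>R u ?s \<in> \<Omega>N"
      using True config_affine[OF r] unfolding rescaled_eq by auto
    have "?x t \<in> config_space UNIV" using True by (simp add: config_space_def)
    moreover have "?x t $ k \<in> \<Omega>" for k using True by (simp add: config_space_def)
    ultimately have "GDERIV (ham_H \<Gamma> g) (?x t) :> gradH0 \<Gamma> (?x t) - gF (?x t)"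
      using has_derivative_diff[OF GDERIV_ham_H0[unfolded gderiv_def, of "?x t" \<Gamma>] GDERIV_ham_F[OF g1(2), unfolded gderiv_def, of "?x t" \<Gamma>]]
      unfolding gderiv_def ham_H_def by (simp add: inner_diff_right)
    then have pg: "partial_grad k (ham_H \<Gamma> g) (?x t) = (gradH0 \<Gamma> (?x t) - gF (?x t)) $ k" for k
      by (rule partial_grad_eqI)
    define w where "w = MJ (gradH0 \<Gamma> (?x t) - gF (?x t))"
    have "\<Gamma> k *\<^sub>R v = J (partial_grad k (ham_H \<Gamma> g) (?x t)) \<longleftrightarrow> v = w $ k" for k v
    proof -
      have "a *\<^sub>R v = x \<longleftrightarrow> v = (1 / a) *\<^sub>R x" if "a \<noteq> 0" for a and x :: "real^2" using that by auto
      then show ?thesis unfolding pg w_def MJ_def using \<Gamma>[of k] by simp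
    qed
    then have "(\<forall>k. \<exists>v. ((\<lambda>s. ?x s $ k) has_vector_derivative v) (at t) \<and>
      \<Gamma> k *\<^sub>R v = J (partial_grad k (ham_H \<Gamma> g) (?x t))) \<longleftrightarrow> (?x has_vector_derivative w) (at t)"
      using has_vector_derivative_vec_iff[of ?x w "at t"] by simp
    also have "\<dots> \<longleftrightarrow> (u has_vector_derivative r *\<^sub>R w) (at ?s)" by (rule deriv_iff)
    also have "r *\<^sub>R w = MJ (force r (u ?s))"
    proof -
      have "gradH0 \<Gamma> (?x t) = (1 / r) *\<^sub>R gradH0 \<Gamma> (u ?s)"
        using gradH0_rescale[OF r, of \<Gamma> a0 "u ?s"] by (simp add: rescaled_def)
      then show ?thesis unfolding w_def force_def MJ.scaleR[symmetric] rescaled_eq[symmetric]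
        using r by (simp add: scaleR_diff_right)
    qed
    finally show ?thesis using True u by blast
  next
    case False
    then show ?thesis using config_affine[OF r] unfolding rescaled_eq by blast
  qed
  have "HS_solution \<Gamma> \<Omega> g ?x \<longleftrightarrow> (\<forall>t. u (t / r\<^sup>2) \<in> config_space UNIV \<and> c0 + r *\<^sub>R u (t / r\<^sup>2) \<in> \<Omega>N \<and>
     (u has_vector_derivative MJ (force r (u (t / r\<^sup>2)))) (at (t / r\<^sup>2)))"
    unfolding HS_solution_def vortex_solution_def point ..
  also have "\<dots> \<longleftrightarrow> rescaled_solution r u"
    unfolding rescaled_solution_def
  proof (intro iffI allI)
    fix t assume *: "\<forall>t. u (t / r\<^sup>2) \<in> config_space UNIV \<and> c0 + r *\<^sub>R u (t / r\<^sup>2) \<in> \<Omega>N \<and>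
     (u has_vector_derivative MJ (force r (u (t / r\<^sup>2)))) (at (t / r\<^sup>2))"
    show "u t \<in> config_space UNIV \<and> c0 + r *\<^sub>R u t \<in> \<Omega>N \<and> (u has_vector_derivative MJ (force r (u t))) (at t)"
      using *[rule_format, of "r\<^sup>2 * t"] r by simp
  qed blast
  finally show ?thesis .
qed

text \<open>The components of the state are the configuration, the drift parameter \<open>l\<close> and the integrated total force.\<close>
definition F0 :: "'n state \<Rightarrow> 'n state" where
  "F0 y = (MJ (gradH0 \<Gamma> (fst y)) + fst (snd y) *\<^sub>R drift (fst y), 0, D (fst y))"

text \<open>What the rescaled field adds to its limit. The last component is, up to the factor
  \<open>1 / r\<close>, the remainder of the first-order expansion of the total force at
  \<open>c0\<close>, where the force itself vanishes.\<close>

definition \<rho> :: "real \<Rightarrow> 'n state \<Rightarrow> 'n state" where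
  "\<rho> r y = (- r *\<^sub>R MJ (gF (c0 + r *\<^sub>R fst y)), 0, (1 / r) *\<^sub>R total (gF (c0 + r *\<^sub>R fst y)) - D (fst y))"

definition \<iota> :: "'n config \<times> real \<Rightarrow> 'n state" where "\<iota> q = (fst q, snd q, 0)"

text \<open>
  The translation component of the periodicity of \<open>u\<close> degenerates as \<open>r \<rightarrow> 0\<close>. It is replaced by the vanishing
  of the integrated total force, whose limit \<open>D\<close> is nondegenerate. The last component fixes the phase.
\<close>
definition \<beta> :: "'n state \<times> ('n config \<times> real) \<Rightarrow> 'n config \<times> real" where
  "\<beta> p = (centred (fst (fst p) - fst (snd p)) + diag (snd (snd (fst p))), fst (snd p) \<bullet> J_mult z)"

definition "U = {y :: 'n state. fst y \<in> config_space UNIV}"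

lemma field_eq: "F0 y + \<rho> r y = (MJ (force r (fst y)) + fst (snd y) *\<^sub>R drift (fst y), 0, (1 / r) *\<^sub>R total (gF (c0 + r *\<^sub>R fst y)))"
  by (simp add: F0_def \<rho>_def force_def MJ.diff MJ.scaleR)

lemma bounded_linear_\<iota>: "bounded_linear \<iota>" unfolding \<iota>_def
  by (intro bounded_linear_Pair bounded_linear_fst bounded_linear_snd bounded_linear_zero)

lemma bounded_linear_\<beta>: "bounded_linear \<beta>" unfolding \<beta>_def
  by (intro bounded_linear_Pair bounded_linear_add bounded_linear_compose[OF bounded_linear_centred]
      bounded_linear_compose[OF bounded_linear_diag] bounded_linear_sub
      bounded_linear_compose[OF bounded_linear_inner_left]
      bounded_linear_compose[OF bounded_linear_fst] bounded_linear_compose[OF bounded_linear_snd]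
      bounded_linear_fst bounded_linear_snd)

lemma open_U: "open U"
proof -
  have eq: "U = fst -` config_space UNIV" by (auto simp: U_def)
  show ?thesis unfolding eq by (intro open_vimage_fst config_open open_UNIV)
qed

lemma C1_F0: "C1_map U F0"
  unfolding F0_def
proof (intro C1_map_Pair C1_map_add C1_map_linear_compose[OF bounded_linear_MJ] C1_map_scaleR C1_map_const
    C1_map_linear_compose[OF bounded_linear_drift] C1_map_linear_compose[OF bounded_linear_D])
  show "C1_map U (\<lambda>y. gradH0 \<Gamma> (fst y))"
    by (rule C1_map_compose[OF C1_map_bounded_linear[OF bounded_linear_fst] C1_map_gradH0]) (simp add: U_def)
qed (auto intro!: C1_map_bounded_linear bounded_linear_fst bounded_linear_compose[OF bounded_linear_fst] bounded_linear_snd)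

lemma \<rho>_0: "\<rho> r 0 = 0" by (simp add: \<rho>_def MJ.zero total.zero D.zero zero_prod_def)

text \<open>The force component is of order \<open>r\<^sup>2\<close>, one factor from the equation
  and one from the rescaled argument. In the last component the factor \<open>1 / r\<close> is
  compensated by the rescaling of the argument, and strict differentiability at \<open>c0\<close>
  supplies the small constant.\<close>

lemma \<rho>_lip:
  assumes e: "e > 0"
  shows "\<exists>r1>0. \<forall>r\<in>{0<..<r1}. \<forall>x\<in>ball 0 R. \<forall>y\<in>ball 0 R. norm (\<rho> r x - \<rho> r y) \<le> e * norm (x - y)"
proof -
  obtain B d where B: "B > 0" "d > 0" "\<forall>x\<in>ball c0 d. \<forall>y\<in>ball c0 d. norm (gF x - gF y) \<le> B * norm (x - y)"
    using gF_lipschitz by metis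
  obtain d' where d': "d' > 0"
    "\<forall>x\<in>ball c0 d'. \<forall>y\<in>ball c0 d'. norm (total (gF x) - total (gF y) - D (x - y)) \<le> e / 2 * norm (x - y)"
    using total_gF_strict[of "e/2"] e half_gt_zero by metis
  obtain M where M: "M > 0" "\<And>x. norm (MJ x) \<le> norm x * M" using MJ.pos_bounded by blast
  define R' where "R' = max R 1"
  \<comment> \<open>The quotient by \<open>R'\<close> keeps the rescaled points in both balls, and
    the last bound makes \<open>r * (B * M)\<close> at most \<open>e / 2\<close>; \<open>R'\<close>
    is positive even if \<open>R\<close> is not.\<close>
  define r1 where "r1 = min 1 (min (min d d' / R') (e / (2 * B * M)))"
  have r1: "r1 > 0" using B(1,2) d'(1) M(1) e by (simp add: r1_def R'_def)
  have "norm (\<rho> r x - \<rho> r y) \<le> e * norm (x - y)" if r: "r \<in> {0<..<r1}" and xy: "x \<in> ball 0 R" "y \<in> ball 0 R" for r x y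
  proof -
    have r': "0 < r" "r < 1" "r < min d d' / R'" "r < e / (2 * B * M)" using r by (auto simp: r1_def)
    have near: "c0 + r *\<^sub>R fst p \<in> ball c0 d \<inter> ball c0 d'" if "p \<in> ball 0 R" for p :: "'n state"
    proof -
      have "norm (fst p) \<le> norm p" by (simp add: norm_fst_le[of "fst p" "snd p", simplified])
      then have "norm (fst p) \<le> R'" using that by (simp add: R'_def)
      then have "norm (r *\<^sub>R fst p) \<le> r * R'" using r'(1) by (simp add: mult_left_mono)
      also have "\<dots> < min d d'" using r'(3) by (simp add: R'_def field_simps)
      finally show ?thesis by (simp add: dist_norm)
    qed
    define a b where "a = c0 + r *\<^sub>R fst x" and "b = c0 + r *\<^sub>R fst y"
    have ab: "a \<in> ball c0 d" "b \<in> ball c0 d" "a \<in> ball c0 d'" "b \<in> ball c0 d'"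
      using near xy by (auto simp: a_def b_def)
    have diff: "a - b = r *\<^sub>R (fst x - fst y)" by (simp add: a_def b_def scaleR_diff_right)
    have nd: "norm (a - b) \<le> r * norm (x - y)"
    proof -
      have "norm (fst x - fst y) \<le> norm (x - y)"
        using norm_fst_le[of "fst (x - y)" "snd (x - y)"] unfolding prod.collapse by simp
      then show ?thesis unfolding diff using r'(1) by (simp add: mult_left_mono)
    qed
    have "\<rho> r x - \<rho> r y = (- r *\<^sub>R MJ (gF a - gF b), 0, (1 / r) *\<^sub>R (total (gF a) - total (gF b) - D (a - b)))"
      using r'(1) unfolding diff D.scaleR
      by (simp add: \<rho>_def a_def[symmetric] b_def[symmetric] MJ.diff D.diff scaleR_diff_right algebra_simps)
    also have "norm \<dots> \<le> norm (- r *\<^sub>R MJ (gF a - gF b)) + norm ((0::real), (1 / r) *\<^sub>R (total (gF a) - total (gF b) - D (a - b)))"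
      by (rule norm_Pair_le)
    also have "\<dots> = r * norm (MJ (gF a - gF b)) + (1 / r) * norm (total (gF a) - total (gF b) - D (a - b))"
      using r'(1) by (simp add: norm_Pair)
    also have "r * norm (MJ (gF a - gF b)) \<le> e / 2 * norm (x - y)"
    proof -
      have "norm (MJ (gF a - gF b)) \<le> norm (gF a - gF b) * M" by (rule M(2))
      also have "\<dots> \<le> (B * norm (a - b)) * M" using B(3) ab M(1) by (intro mult_right_mono) auto
      also have "\<dots> \<le> (B * (r * norm (x - y))) * M" using nd B(1) M(1) by (intro mult_right_mono mult_left_mono) auto
      finally have "r * norm (MJ (gF a - gF b)) \<le> r * ((B * (r * norm (x - y))) * M)" using r'(1) by (intro mult_left_mono) auto
      also have "\<dots> = (r * (r * (B * M))) * norm (x - y)" by simp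
      also have "\<dots> \<le> e / 2 * norm (x - y)"
      proof (rule mult_right_mono)
        have "r * (B * M) \<le> e / 2" using r'(4) B(1) M(1) by (simp add: field_simps)
        moreover have "r * (r * (B * M)) \<le> 1 * (r * (B * M))" using r' B(1) M(1) by (intro mult_right_mono) auto
        ultimately show "r * (r * (B * M)) \<le> e / 2" by simp
      qed simp
      finally show ?thesis .
    qed
    also have "(1 / r) * norm (total (gF a) - total (gF b) - D (a - b)) \<le> e / 2 * norm (x - y)"
    proof -
      have "norm (total (gF a) - total (gF b) - D (a - b)) \<le> e / 2 * norm (a - b)" using d'(2) ab by blast
      also have "\<dots> \<le> e / 2 * (r * norm (x - y))" using nd e by (intro mult_left_mono) auto
      finally show ?thesis using r'(1) by (simp add: field_simps)
    qed
    finally show ?thesis by simp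
  qed
  then show ?thesis using r1 by blast
qed

lemma \<Omega>N_small:
  assumes "R > 0"
  obtains r1 where "r1 > 0" "\<forall>r\<in>{0<..<r1}. \<forall>x. norm x < R \<longrightarrow> c0 + r *\<^sub>R x \<in> \<Omega>N"
proof -
  obtain d where d: "d > 0" "ball c0 d \<subseteq> \<Omega>N" using open_\<Omega>N c0_in openE by blast
  have "c0 + r *\<^sub>R x \<in> \<Omega>N" if "r \<in> {0<..<d/R}" "norm x < R" for r x
  proof -
    have "norm (r *\<^sub>R x) \<le> r * R" using that by simp
    also have "\<dots> < d" using that assms by (simp add: field_simps)
    finally have "c0 + r *\<^sub>R x \<in> ball c0 d" by (simp add: dist_norm)
    then show ?thesis using d by blast
  qed
  then show ?thesis using d assms by (intro that[of "d/R"]) auto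
qed

lemma \<rho>_C1: "\<exists>r1>0. C1_map ({0<..<r1} \<times> ball 0 R) (\<lambda>(r, x). \<rho> r x)"
proof -
  define R' where "R' = max R 1"
  have R': "R' > 0" "R \<le> R'" by (auto simp: R'_def)
  obtain r1 where r1: "r1 > 0" "\<forall>r\<in>{0<..<r1}. \<forall>x. norm x < R' \<longrightarrow> c0 + r *\<^sub>R x \<in> \<Omega>N" using \<Omega>N_small[OF R'(1)] by metis
  let ?S = "{0<..<r1} \<times> ball (0 :: 'n state) R"
  have fs: "C1_map ?S (\<lambda>p. fst (snd p))" by (intro C1_map_bounded_linear bounded_linear_compose[OF bounded_linear_fst] bounded_linear_snd)
  have f: "C1_map ?S fst" by (intro C1_map_bounded_linear bounded_linear_fst)
  have 1: "C1_map ?S (\<lambda>p. gF (c0 + fst p *\<^sub>R fst (snd p)))"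
  proof (rule C1_map_compose[OF _ C1_gF])
    show "C1_map ?S (\<lambda>p. c0 + fst p *\<^sub>R fst (snd p))" by (intro C1_map_add C1_map_const C1_map_scaleR f fs)
    fix p assume p: "p \<in> ?S"
    have "norm (fst (snd p)) \<le> norm (snd p)" using norm_fst_le[of "fst (snd p)" "snd (snd p)"] by simp
    also have "\<dots> < R'" using p R' by (auto simp: mem_Times_iff)
    finally show "c0 + fst p *\<^sub>R fst (snd p) \<in> \<Omega>N" using r1(2) p by (auto simp: mem_Times_iff)
  qed
  have "C1_map ?S (\<lambda>p. (- fst p *\<^sub>R MJ (gF (c0 + fst p *\<^sub>R fst (snd p))), 0,
      inverse (fst p) *\<^sub>R total (gF (c0 + fst p *\<^sub>R fst (snd p))) - D (fst (snd p))))"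
    by (intro C1_map_Pair C1_map_const C1_map_diff C1_map_scaleR C1_map_uminus f C1_map_inverse
        C1_map_linear_compose[OF bounded_linear_MJ] C1_map_linear_compose[OF bounded_linear_total]
        C1_map_linear_compose[OF bounded_linear_D] 1 fs) auto
  then have "C1_map ?S (\<lambda>(r, x). \<rho> r x)" by (simp add: \<rho>_def case_prod_unfold inverse_eq_divide)
  then show ?thesis using r1(1) by blast
qed

end

lemma vector_derivative_continuous_on:
  assumes "\<And>t. t \<in> S \<Longrightarrow> (f has_vector_derivative f' t) (at t within S)"
  shows "continuous_on S f"
  unfolding continuous_on_eq_continuous_within
  by (intro ballI) (rule has_vector_derivative_continuous[OF assms])

lemma has_integral_const_eq:
  fixes f :: "real \<Rightarrow> 'a::banach"
  assumes "(f has_integral I) {0..b}" "b \<ge> 0" "\<And>t. t \<in> {0..b} \<Longrightarrow> f t = c"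
  shows "I = b *\<^sub>R c"
proof -
  have "I = integral {0..b} f" using assms(1) by (simp add: integral_unique)
  also have "\<dots> = integral {0..b} (\<lambda>_. c)" by (rule Henstock_Kurzweil_Integration.integral_cong) (rule assms(3))
  also have "\<dots> = b *\<^sub>R c" using assms(2) by simp
  finally show ?thesis .
qed

section \<open>Nondegeneracy at \<open>r = 0\<close> and the correspondence with periodic
  solutions\<close>

context vortex_domain
begin

definition y0 :: "real \<Rightarrow> 'n state" where "y0 t = (Z t, 0, 0)"

lemma y0_U: "y0 t \<in> U" using Z_config by (simp add: y0_def U_def)

text \<open>The centre of vorticity of \<open>Z\<close> sits at 0, so in the limit no force
  accumulates and the last component of \<open>y0\<close> can remain 0.\<close>

lemma D_Z [simp]: "D (Z t) = 0"
  by (simp add: D_def linear_0[OF bounded_linear.linear[OF bounded_linear_Hs]])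

lemma F0_y0: "F0 (y0 t) = (MJ (gradH0 \<Gamma> (Z t)), 0, 0)" by (simp add: F0_def y0_def)

lemma y0_deriv: "(y0 has_vector_derivative F0 (y0 t)) (at t)"
  unfolding F0_y0 unfolding y0_def[abs_def]
  by (intro has_vector_derivative_Pair Z_deriv' has_vector_derivative_const)

lemma y0_cont: "continuous_on S y0"
  by (rule vector_derivative_continuous_on) (rule has_vector_derivative_at_within[OF y0_deriv])

lemma F0_deriv:
  assumes "y \<in> U"
  shows "(F0 has_derivative (\<lambda>h. (MJ (hessH0 \<Gamma> (fst y) (fst h)) +
     (fst (snd y) *\<^sub>R drift (fst h) + fst (snd h) *\<^sub>R drift (fst y)), 0, D (fst h)))) (at y)"
  unfolding F0_def
proof (intro has_derivative_Pair has_derivative_add has_derivative_scaleR has_derivative_const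
    bounded_linear.has_derivative[OF bounded_linear_MJ] bounded_linear.has_derivative[OF bounded_linear_drift]
    bounded_linear.has_derivative[OF bounded_linear_D])
  show "((\<lambda>y. gradH0 \<Gamma> (fst y)) has_derivative (\<lambda>h. hessH0 \<Gamma> (fst y) (fst h))) (at y)"
    by (rule has_derivative_compose[OF has_derivative_fst[OF has_derivative_ident] gradH0_has_derivative])
       (use assms in \<open>simp add: U_def\<close>)
qed (auto intro!: derivative_intros)

text \<open>Uniqueness identifies \<open>hessH0\<close> with the operator-valued derivative whose
  continuity is part of \<open>C1_map_gradH0\<close>.\<close>

lemma continuous_on_hessH0:
  assumes "continuous_on S x" "continuous_on S h" "\<And>s. s \<in> S \<Longrightarrow> x s \<in> config_space UNIV"
  shows "continuous_on S (\<lambda>s. hessH0 \<Gamma> (x s) (h s))"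
proof -
  obtain f' where f': "\<And>x. x \<in> config_space UNIV \<Longrightarrow> (gradH0 \<Gamma> has_derivative blinfun_apply (f' x)) (at x)"
    "continuous_on (config_space UNIV) f'"
    using C1_map_gradH0 by (rule C1_mapE) blast
  have "hessH0 \<Gamma> x = blinfun_apply (f' x)" if "x \<in> config_space UNIV" for x
    using gradH0_has_derivative[OF that] f'(1)[OF that] by (rule has_derivative_unique)
  moreover have "continuous_on S (\<lambda>s. f' (x s) (h s))"
    by (intro continuous_intros continuous_on_compose2[OF f'(2)] assms) (use assms in auto)
  ultimately show ?thesis using assms(3) by (simp cong: continuous_on_cong)
qed

lemma vort_J_mult_Z: "vort (J_mult (Z t)) = 0" by (simp add: vort_J_mult)

lemma J_mult_inner: "J_mult x \<bullet> J_mult y = x \<bullet> y" "x \<bullet> J_mult x = 0"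
  by (simp_all add: inner_conf J_mult_def)

text \<open>As a function of the time shift the phase crosses 0 transversally at
  \<open>t = 0\<close>, so the phase condition cuts the orbit.\<close>

lemma Z_inner_J: "Z t \<bullet> J_mult z = - sin (\<omega> * t) * (z \<bullet> z)"
  by (simp add: Z_eq inner_diff_left J_mult_inner)

text \<open>The vorticity moment is constant along linearised solutions, so the integrated force is
  a multiple of \<open>Hs\<close> applied to it, and the boundary condition forces both to vanish.
  Pairing with the energy gradient removes \<open>l\<close>. What is left is a periodic solution of
  the linearised system, where the vorticity moment excludes translations and the phase condition
  excludes the time shift.\<close>

lemma linear_nondegenerate:
  assumes A: "\<And>x. x \<in> U \<Longrightarrow> (F0 has_derivative blinfun_apply (A x)) (at x)" "continuous_on U A"
    and w: "continuous_on {0..2*pi} w"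
      "\<And>t. t \<in> {0..2*pi} \<Longrightarrow> w t = \<iota> q + integral {0..t} (\<lambda>s. A (y0 s) (w s))" "\<beta> (w (2*pi), q) = 0"
  shows "q = 0"
proof -
  define I where "I = {0..2*pi}"
  define v where "v t = fst (w t)" for t
  define m where "m t = fst (snd (w t))" for t
  define \<sigma> where "\<sigma> t = snd (snd (w t))" for t
  have A_eq: "A (y0 t) h = (MJ (hessH0 \<Gamma> (Z t) (fst h)) + fst (snd h) *\<^sub>R drift (Z t), 0, D (fst h))" for t h
    using fun_cong[OF has_derivative_unique[OF A(1)[OF y0_U] F0_deriv[OF y0_U]], of t h] by (simp add: y0_def)
  have cont: "continuous_on I (\<lambda>s. A (y0 s) (w s))"
    by (intro continuous_intros continuous_on_compose2[OF A(2)])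
       (use w(1) y0_U y0_cont in \<open>auto simp: I_def\<close>)
  have w': "(w has_vector_derivative (MJ (hessH0 \<Gamma> (Z t) (v t)) + m t *\<^sub>R drift (Z t), 0, D (v t))) (at t within I)" if "t \<in> I" for t
    using integral_has_vector_derivative_Icc[OF cont[unfolded I_def] w(2)] that unfolding A_eq v_def m_def I_def by blast
  have v': "(v has_vector_derivative MJ (hessH0 \<Gamma> (Z t) (v t)) + m t *\<^sub>R drift (Z t)) (at t within I)" if "t \<in> I" for t
    using bounded_linear.has_vector_derivative[OF bounded_linear_fst w'[OF that]] by (simp add: v_def[abs_def])
  have m': "(m has_vector_derivative 0) (at t within I)" if "t \<in> I" for t
    using bounded_linear.has_vector_derivative[OF bounded_linear_compose[OF bounded_linear_fst bounded_linear_snd] w'[OF that]]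
    by (simp add: m_def[abs_def])
  have \<sigma>': "(\<sigma> has_vector_derivative D (v t)) (at t within I)" if "t \<in> I" for t
    using bounded_linear.has_vector_derivative[OF bounded_linear_compose[OF bounded_linear_snd bounded_linear_snd] w'[OF that]]
    by (simp add: \<sigma>_def[abs_def])
  have w0: "v 0 = fst q" "m 0 = snd q" "\<sigma> 0 = 0" using w(2)[of 0] by (simp_all add: v_def m_def \<sigma>_def \<iota>_def)
  have m: "m t = snd q" if "t \<in> I" for t
    using vector_derivative_zero_imp_eq[of "2*pi" m t] m' that w0 by (simp add: I_def)
  have vv: "vort (v t) = vort (fst q)" if "t \<in> I" for t
  proof -
    have "((\<lambda>t. vort (v t)) has_vector_derivative 0) (at t within I)" if "t \<in> I" for t
      using bounded_linear.has_vector_derivative[OF bounded_linear_vort v'[OF that]]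
      by (simp add: vort.add vort.scaleR vort_MJ')
    then show ?thesis using vector_derivative_zero_imp_eq[of "2*pi" "\<lambda>t. vort (v t)" t] that w0 by (simp add: I_def)
  qed
  have I: "0 \<in> I" "2 * pi \<in> I" by (auto simp: I_def)
  have b1: "centred (v (2*pi) - fst q) + diag (\<sigma> (2*pi)) = 0" and b2: "fst q \<bullet> J_mult z = 0"
    using w(3) by (simp_all add: \<beta>_def v_def \<sigma>_def zero_prod_def)
  \<comment> \<open>Since \<open>centred\<close> lands in the kernel of \<open>vort\<close>,
    applying \<open>vort\<close> isolates the \<open>diag\<close> part of the boundary
    condition.\<close>
  have "vort (centred (v (2*pi) - fst q) + diag (\<sigma> (2*pi))) = 0" unfolding b1 by (rule vort.zero)
  then have \<sigma>T: "\<sigma> (2*pi) = 0" using \<Gamma>t_nz by (simp add: vort.add vort_diag)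
  have "centred (v (2*pi) - fst q) = v (2*pi) - fst q" by (rule centred_eq) (simp add: vort.diff vv[OF I(2)])
  then have vT: "v (2*pi) = fst q" using b1 \<sigma>T by (simp add: diag.zero)
  have "vort (fst q) = 0"
  proof -
    have "((\<lambda>t. D (v t)) has_integral \<sigma> (2*pi) - \<sigma> 0) {0..2*pi}"
      by (rule fundamental_theorem_of_calculus) (use \<sigma>' in \<open>auto simp: I_def\<close>)
    then have "\<sigma> (2*pi) - \<sigma> 0 = (2 * pi) *\<^sub>R (\<Gamma>t *\<^sub>R Hs (vort (fst q)))"
      by (rule has_integral_const_eq) (use vv in \<open>auto simp: I_def D_def\<close>)
    then have "(2 * pi) *\<^sub>R (\<Gamma>t *\<^sub>R Hs (vort (fst q))) = 0" using \<sigma>T w0(3) by simp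
    then have "Hs (vort (fst q)) = 0" using \<Gamma>t_nz by simp
    then show ?thesis by (rule Hs_eq_0)
  qed
  have "snd q = 0"
  proof -
    \<comment> \<open>The linearised energy. Symmetry of the Hessian and skewness of
      \<open>MJ\<close> cancel everything but the drift, so it grows at the constant rate
      \<open>snd q * (- \<omega> * \<kappa>)\<close>, while periodicity returns it to its initial
      value.\<close>
    define \<phi> where "\<phi> t = gradH0 \<Gamma> (Z t) \<bullet> v t" for t
    have \<phi>': "(\<phi> has_vector_derivative snd q * (- \<omega> * \<kappa>)) (at t within I)" if t: "t \<in> I" for t
    proof -
      let ?H = "hessH0 \<Gamma> (Z t)"
      have "((\<lambda>t. gradH0 \<Gamma> (Z t)) has_derivative (\<lambda>h. ?H (h *\<^sub>R MJ (gradH0 \<Gamma> (Z t))))) (at t within I)"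
        by (rule has_derivative_compose[OF has_derivative_at_withinI[OF Z_deriv'[unfolded has_vector_derivative_def]] gradH0_has_derivative[OF Z_config]])
      from has_derivative_inner[OF this v'[OF t, unfolded has_vector_derivative_def]]
      have "(\<phi> has_derivative (\<lambda>h. gradH0 \<Gamma> (Z t) \<bullet> (h *\<^sub>R (MJ (?H (v t)) + m t *\<^sub>R drift (Z t)))
          + ?H (h *\<^sub>R MJ (gradH0 \<Gamma> (Z t))) \<bullet> v t)) (at t within I)" unfolding \<phi>_def[abs_def] .
      moreover have "gradH0 \<Gamma> (Z t) \<bullet> (h *\<^sub>R (MJ (?H (v t)) + m t *\<^sub>R drift (Z t)))
          + ?H (h *\<^sub>R MJ (gradH0 \<Gamma> (Z t))) \<bullet> v t = h *\<^sub>R (snd q * (- \<omega> * \<kappa>))" for h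
      proof -
        have "?H (h *\<^sub>R MJ (gradH0 \<Gamma> (Z t))) \<bullet> v t = h * (?H (v t) \<bullet> MJ (gradH0 \<Gamma> (Z t)))"
          using hessH0_sym[of \<Gamma> "Z t" "h *\<^sub>R MJ (gradH0 \<Gamma> (Z t))" "v t"] by simp
        also have "?H (v t) \<bullet> MJ (gradH0 \<Gamma> (Z t)) = - (gradH0 \<Gamma> (Z t) \<bullet> MJ (?H (v t)))"
          using MJ_skew[of "?H (v t)" "gradH0 \<Gamma> (Z t)"] by (simp add: inner_commute)
        finally show ?thesis using gradH0_drift_Z[of t] m[OF t] by (simp add: inner_add_right algebra_simps)
      qed
      ultimately show ?thesis unfolding has_vector_derivative_def by simp
    qed
    have "((\<lambda>t. snd q * (- \<omega> * \<kappa>)) has_integral \<phi> (2*pi) - \<phi> 0) {0..2*pi}"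
      by (rule fundamental_theorem_of_calculus) (use \<phi>' in \<open>auto simp: I_def\<close>)
    then have "\<phi> (2*pi) - \<phi> 0 = (2 * pi) *\<^sub>R (snd q * (- \<omega> * \<kappa>))"
      by (rule has_integral_const_eq) auto
    moreover have "\<phi> (2*pi) = \<phi> 0" using Z_periodic[of 0] by (simp add: \<phi>_def vT w0)
    ultimately have "snd q * (- \<omega> * \<kappa>) = 0" by simp
    then show ?thesis using \<kappa>_pos \<omega> by auto
  qed
  then have v'': "(v has_vector_derivative MJ (hessH0 \<Gamma> (Z t) (v t))) (at t within I)" if "t \<in> I" for t
    using v'[OF that] m[OF that] by simp
  have vcont: "continuous_on I v" using w(1) unfolding v_def I_def by (intro continuous_intros)
  have "continuous_on {0..2*pi} (\<lambda>t. MJ (hessH0 \<Gamma> (Z t) (v t)))"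
    by (intro bounded_linear.continuous_on[OF bounded_linear_MJ] continuous_on_hessH0 Z_cont Z_config vcont[unfolded I_def])
  from bcontfun_clip[OF _ this]
  have "(\<lambda>t. MJ (hessH0 \<Gamma> (Z (clip (2*pi) t)) (v (clip (2*pi) t)))) \<in> bcontfun" by simp
  moreover define V where "V = Bcontfun (\<lambda>t. MJ (hessH0 \<Gamma> (Z (clip (2*pi) t)) (v (clip (2*pi) t))))"
  ultimately have V: "apply_bcontfun V t = MJ (hessH0 \<Gamma> (Z (clip (2*pi) t)) (v (clip (2*pi) t)))" for t
    by (simp add: Bcontfun_inverse)
  have VI: "apply_bcontfun V t = MJ (hessH0 \<Gamma> (Z t) (v t))" if "t \<in> I" for t using that by (simp add: V I_def)
  have Vint: "integral {0..t} V = v t - fst q" if "t \<in> I" for t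
  proof -
    have "(V has_integral v t - v 0) {0..t}"
    proof (rule fundamental_theorem_of_calculus)
      fix x assume "x \<in> {0..t}"
      then have x: "x \<in> I" using that by (auto simp: I_def)
      show "(v has_vector_derivative apply_bcontfun V x) (at x within {0..t})"
        using v''[OF x] unfolding VI[OF x] by (rule has_vector_derivative_within_subset) (use that in \<open>auto simp: I_def\<close>)
    qed (use that in \<open>simp add: I_def\<close>)
    then show ?thesis using w0 by (simp add: integral_unique)
  qed
  have VT: "integral {0..2*pi} V = 0" using Vint[OF I(2)] vT by simp
  \<comment> \<open>Extends \<open>v\<close> periodically to the line. The extension solves the
    equation weakly, and since the right-hand side is continuous, it is a classical
    solution.\<close>
  define u where "u = h1_fun (h1_prim (fst q, V))"
  have u_I: "u t = v t" if "t \<in> I" for t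
    unfolding u_def h1_fun_h1_prim using periodic_prim_eq[of t "fst q" V] Vint[OF that] VT that by (simp add: I_def)
  have u_per: "u (t + 2 * pi) = u t" for t unfolding u_def by (rule h1_fun_periodic)
  have wI: "wrap t \<in> I" for t using wrap_bounds[of t] by (simp add: I_def)
  have "has_weak_deriv u (\<lambda>t. apply_bcontfun V (wrap t))"
    using has_weak_deriv_periodic_prim[of "fst q" V] unfolding u_def h1_fun_h1_prim VT by simp
  moreover have "apply_bcontfun V (wrap t) = MJ (hessH0 \<Gamma> (Z t) (u t))" for t
    using VI[OF wI] u_I[OF wI] periodic_wrap[of Z t, OF Z_periodic] periodic_wrap[of u t, OF u_per] by metis
  ultimately have uw: "has_weak_deriv u (\<lambda>t. MJ (hessH0 \<Gamma> (Z t) (u t)))" by simp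
  have "continuous_on UNIV (\<lambda>t. MJ (hessH0 \<Gamma> (Z t) (u t)))"
    by (intro bounded_linear.continuous_on[OF bounded_linear_MJ] continuous_on_hessH0 Z_cont Z_config
        has_weak_deriv_continuous[OF uw])
  then have "u \<in> linearized_periodic_solutions \<Gamma> \<omega> z"
    unfolding linearized_iff using u_per has_weak_deriv_vector_derivative[OF uw] by blast
  then obtain a c where "\<And>t. u t = a *\<^sub>R J_mult (Z t) + diag c" using linearized_kernel by blast
  then have p: "fst q = a *\<^sub>R J_mult z + diag c" using u_I[OF I(1)] w0 by (metis Z_0)
  have "\<Gamma>t *\<^sub>R c = 0"
    using \<open>vort (fst q) = 0\<close> vort_J_mult_Z[of 0] unfolding p by (simp add: vort.add vort.scaleR vort_diag)
  then have c: "c = 0" using \<Gamma>t_nz by simp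
  have "a * (z \<bullet> z) = 0" using b2 unfolding p c by (simp add: diag.zero J_mult_inner)
  then have "a = 0" using z_nz by simp
  then have "fst q = 0" unfolding p c by (simp add: diag.zero)
  then show "q = 0" using \<open>snd q = 0\<close> by (simp add: prod_eq_iff)
qed

lemma continuous_on_force:
  assumes "continuous_on S x" "\<And>s. s \<in> S \<Longrightarrow> x s \<in> config_space UNIV \<and> c0 + r *\<^sub>R x s \<in> \<Omega>N"
  shows "continuous_on S (\<lambda>s. MJ (force r (x s)))" "continuous_on S (\<lambda>s. gF (c0 + r *\<^sub>R x s))"
proof -
  show g: "continuous_on S (\<lambda>s. gF (c0 + r *\<^sub>R x s))"
    by (rule continuous_on_compose2[OF C1_map_continuous_on[OF C1_gF]]) (use assms in \<open>auto intro!: continuous_intros\<close>)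
  show "continuous_on S (\<lambda>s. MJ (force r (x s)))"
    unfolding force_def
    by (intro bounded_linear.continuous_on[OF bounded_linear_MJ] continuous_intros g
        continuous_on_compose2[OF C1_map_continuous_on[OF C1_map_gradH0]] assms(1)) (use assms(2) in auto)
qed

text \<open>\<open>\<zeta>\<close> integrates the total force divided by \<open>r\<close>, and the
  vorticity moment moves by \<open>- r\<close> times the rotated total force; the drift leaves it
  unchanged. Hence the weight \<open>r\<^sup>2\<close>.\<close>

lemma vort_conservation:
  assumes "\<And>t. t \<in> {0..b} \<Longrightarrow> (u has_vector_derivative MJ (force r (u t)) + l *\<^sub>R drift (u t)) (at t within {0..b})"
    and "\<And>t. t \<in> {0..b} \<Longrightarrow> (\<zeta> has_vector_derivative (1 / r) *\<^sub>R total (gF (c0 + r *\<^sub>R u t))) (at t within {0..b})"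
    and "\<zeta> 0 = 0" "r > 0" "b \<ge> 0"
  shows "vort (u b - u 0) = - (r\<^sup>2 *\<^sub>R J (\<zeta> b))"
proof -
  have "((\<lambda>t. vort (u t) + r\<^sup>2 *\<^sub>R J (\<zeta> t)) has_vector_derivative 0) (at t within {0..b})" if "t \<in> {0..b}" for t
  proof -
    have "((\<lambda>t. vort (u t) + r\<^sup>2 *\<^sub>R J (\<zeta> t)) has_vector_derivative
       vort (MJ (force r (u t)) + l *\<^sub>R drift (u t)) + r\<^sup>2 *\<^sub>R J ((1 / r) *\<^sub>R total (gF (c0 + r *\<^sub>R u t)))) (at t within {0..b})"
      by (intro has_vector_derivative_add bounded_linear.has_vector_derivative[OF bounded_linear_vort]
          bounded_linear.has_vector_derivative[OF bounded_linear_scaleR_right]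
          bounded_linear.has_vector_derivative[OF bounded_linear_J] assms that)
    moreover have "r\<^sup>2 *\<^sub>R J ((1 / r) *\<^sub>R total (gF (c0 + r *\<^sub>R u t))) = r *\<^sub>R J (total (gF (c0 + r *\<^sub>R u t)))"
      using \<open>r > 0\<close> by (simp add: J_linear power2_eq_square)
    moreover have "vort (MJ (force r (u t)) + l *\<^sub>R drift (u t)) = - (r *\<^sub>R J (total (gF (c0 + r *\<^sub>R u t))))"
      by (simp add: vort.add vort.scaleR vort_MJ' force_def total.diff total.scaleR J_linear)
    ultimately show ?thesis by (simp only: add.left_inverse)
  qed
  from vector_derivative_zero_imp_eq[OF this, of b] assms(3,5)
  have "vort (u b) + r\<^sup>2 *\<^sub>R J (\<zeta> b) = vort (u 0)" by (simp add: J_linear)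
  then show ?thesis by (simp add: vort.diff algebra_simps)
qed

text \<open>The boundary condition forces the integrated force to vanish; by
  \<open>vort_conservation\<close> the centre then returns as well, so the whole configuration is
  periodic. Its energy returns to its initial value although its rate of change is \<open>l\<close>
  times a nonvanishing function, so \<open>l = 0\<close>.\<close>

lemma periodic_of_solution:
  assumes r: "r > 0" and y: "continuous_on {0..2*pi} y" "\<beta> (y (2*pi), q) = 0"
      "\<And>t. t \<in> {0..2*pi} \<Longrightarrow> y t = \<iota> q + integral {0..t} (\<lambda>s. F0 (y s) + \<rho> r (y s))"
    and dom: "\<And>t. t \<in> {0..2*pi} \<Longrightarrow> fst (y t) \<in> config_space UNIV \<and> c0 + r *\<^sub>R fst (y t) \<in> \<Omega>N"
    and nz: "\<And>t. t \<in> {0..2*pi} \<Longrightarrow> force r (fst (y t)) \<bullet> drift (fst (y t)) \<noteq> 0"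
  shows "fst (y (2*pi)) = fst q" "\<And>t. t \<in> {0..2*pi} \<Longrightarrow> fst (snd (y t)) = 0"
proof -
  define I where "I = {0..2*pi}"
  define u where "u t = fst (y t)" for t
  define l where "l t = fst (snd (y t))" for t
  define \<zeta> where "\<zeta> t = snd (snd (y t))" for t
  have uc: "continuous_on I u" "continuous_on I l" using y(1) unfolding u_def l_def I_def by (auto intro!: continuous_intros)
  have "continuous_on I (\<lambda>s. F0 (y s) + \<rho> r (y s))"
    unfolding field_eq u_def[symmetric] l_def[symmetric]
    by (intro continuous_intros continuous_on_force(1) bounded_linear.continuous_on[OF bounded_linear_drift]
        bounded_linear.continuous_on[OF bounded_linear_total] continuous_on_force(2) uc)
       (use dom in \<open>auto simp: u_def I_def\<close>)
  from integral_has_vector_derivative_Icc[OF this[unfolded I_def] y(3)]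
  have y': "(y has_vector_derivative (MJ (force r (u t)) + l t *\<^sub>R drift (u t), 0, (1 / r) *\<^sub>R total (gF (c0 + r *\<^sub>R u t)))) (at t within I)"
    if "t \<in> I" for t using that unfolding field_eq u_def l_def I_def by blast
  have l': "(l has_vector_derivative 0) (at t within I)" if "t \<in> I" for t
    using bounded_linear.has_vector_derivative[OF bounded_linear_compose[OF bounded_linear_fst bounded_linear_snd] y'[OF that]]
    by (simp add: l_def[abs_def])
  have y00: "u 0 = fst q" "l 0 = snd q" "\<zeta> 0 = 0" using y(3)[of 0] by (simp_all add: u_def l_def \<zeta>_def \<iota>_def)
  have l: "l t = snd q" if "t \<in> I" for t
    using vector_derivative_zero_imp_eq[of "2*pi" l t] l' that y00 by (simp add: I_def)
  have u': "(u has_vector_derivative MJ (force r (u t)) + snd q *\<^sub>R drift (u t)) (at t within I)" if "t \<in> I" for t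
    using bounded_linear.has_vector_derivative[OF bounded_linear_fst y'[OF that]] l[OF that] by (simp add: u_def[abs_def])
  have \<zeta>': "(\<zeta> has_vector_derivative (1 / r) *\<^sub>R total (gF (c0 + r *\<^sub>R u t))) (at t within I)" if "t \<in> I" for t
    using bounded_linear.has_vector_derivative[OF bounded_linear_compose[OF bounded_linear_snd bounded_linear_snd] y'[OF that]]
    by (simp add: \<zeta>_def[abs_def])
  have I: "0 \<in> I" "2 * pi \<in> I" by (auto simp: I_def)
  have vc: "vort (u (2*pi) - u 0) = - (r\<^sup>2 *\<^sub>R J (\<zeta> (2*pi)))"
    by (rule vort_conservation[OF u'[unfolded I_def] \<zeta>'[unfolded I_def] y00(3) r]) auto
  have b1: "centred (u (2*pi) - fst q) + diag (\<zeta> (2*pi)) = 0"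
    using y(2) by (simp add: \<beta>_def u_def \<zeta>_def zero_prod_def)
  have "vort (centred (u (2*pi) - fst q) + diag (\<zeta> (2*pi))) = 0" unfolding b1 by (rule vort.zero)
  then have \<zeta>T: "\<zeta> (2*pi) = 0" using \<Gamma>t_nz by (simp add: vort.add vort_diag)
  have "centred (u (2*pi) - fst q) = u (2*pi) - fst q"
    by (rule centred_eq) (use vc \<zeta>T y00 in \<open>simp add: J_linear\<close>)
  then have uT: "u (2*pi) = fst q" using b1 \<zeta>T by (simp add: diag.zero)
  then show "fst (y (2*pi)) = fst q" by (simp add: u_def)
  define E where "E t = ham_H0 \<Gamma> (u t) - ham_F \<Gamma> g (c0 + r *\<^sub>R u t)" for t
  have E': "(E has_derivative (\<lambda>h. h * (snd q * (force r (u t) \<bullet> drift (u t))))) (at t within I)" if t: "t \<in> I" for t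
  proof -
    define v where "v = MJ (force r (u t)) + snd q *\<^sub>R drift (u t)"
    have du: "(u has_derivative (\<lambda>h. h *\<^sub>R v)) (at t within I)"
      using u'[OF t] unfolding has_vector_derivative_def v_def .
    have cu: "u t \<in> config_space UNIV" "c0 + r *\<^sub>R u t \<in> \<Omega>N" using dom t by (auto simp: u_def I_def)
    have 1: "((\<lambda>t. ham_H0 \<Gamma> (u t)) has_derivative (\<lambda>h. (h *\<^sub>R v) \<bullet> gradH0 \<Gamma> (u t))) (at t within I)"
      by (rule has_derivative_compose[OF du GDERIV_ham_H0[OF cu(1), unfolded gderiv_def]])
    have "((\<lambda>t. c0 + r *\<^sub>R u t) has_derivative (\<lambda>h. 0 + r *\<^sub>R (h *\<^sub>R v))) (at t within I)"
      by (intro has_derivative_add has_derivative_const has_derivative_scaleR_right du)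
    then have 2: "((\<lambda>t. ham_F \<Gamma> g (c0 + r *\<^sub>R u t)) has_derivative
        (\<lambda>h. (0 + r *\<^sub>R (h *\<^sub>R v)) \<bullet> gF (c0 + r *\<^sub>R u t))) (at t within I)"
      by (rule has_derivative_compose) (rule GDERIV_ham_F[OF g1(2), unfolded gderiv_def], use cu(2) in \<open>simp add: \<Omega>N_def\<close>)
    have "(h *\<^sub>R v) \<bullet> gradH0 \<Gamma> (u t) - (0 + r *\<^sub>R (h *\<^sub>R v)) \<bullet> gF (c0 + r *\<^sub>R u t) = h * (v \<bullet> force r (u t))" for h
      by (simp add: force_def inner_diff_right algebra_simps)
    moreover have "v \<bullet> force r (u t) = snd q * (force r (u t) \<bullet> drift (u t))"
      unfolding v_def inner_commute[of _ "force r (u t)"] by (simp add: inner_add_right)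
    ultimately show ?thesis using has_derivative_diff[OF 1 2] unfolding E_def by simp
  qed
  have "snd q = 0"
  proof -
    \<comment> \<open>The mean value theorem makes it sufficient that the rate is nonzero at each
      time; its sign is irrelevant.\<close>
    obtain t where "t \<in> {0<..<2*pi}" "E (2*pi) - E 0 = (2 * pi - 0) * (snd q * (force r (u t) \<bullet> drift (u t)))"
      using mvt_simple[of 0 "2*pi" E "\<lambda>t h. h * (snd q * (force r (u t) \<bullet> drift (u t)))"] E' by (auto simp: I_def)
    moreover have "E (2*pi) = E 0" using uT y00 by (simp add: E_def)
    ultimately show ?thesis using nz[of t] by (auto simp: u_def)
  qed
  then show "fst (snd (y t)) = 0" if "t \<in> {0..2*pi}" for t using l[of t] that by (simp add: l_def I_def)
qed

text \<open>The converse, for uniqueness: periodicity of the vorticity moment makes the integrated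
  force vanish through \<open>vort_conservation\<close>, so the replaced boundary condition holds
  with \<open>l = 0\<close>.\<close>

lemma solution_of_periodic:
  assumes r: "r > 0" and w: "rescaled_solution r w" "\<And>t. w (t + 2 * pi) = w t" "w 0 \<bullet> J_mult z = 0"
  defines "y \<equiv> \<lambda>t. (w t, 0, integral {0..t} (\<lambda>s. (1 / r) *\<^sub>R total (gF (c0 + r *\<^sub>R w s))))"
  shows "continuous_on {0..2*pi} y" "\<beta> (y (2*pi), (w 0, 0)) = 0"
    "\<And>t. t \<in> {0..2*pi} \<Longrightarrow> y t = \<iota> (w 0, 0) + integral {0..t} (\<lambda>s. F0 (y s) + \<rho> r (y s))"
proof -
  define \<zeta> where "\<zeta> t = integral {0..t} (\<lambda>s. (1 / r) *\<^sub>R total (gF (c0 + r *\<^sub>R w s)))" for t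
  have w': "(w has_vector_derivative MJ (force r (w t)) + 0 *\<^sub>R drift (w t)) (at t within S)" for t S
    using w(1) unfolding rescaled_solution_def by (auto intro: has_vector_derivative_at_within)
  have wc: "continuous_on S w" for S by (rule vector_derivative_continuous_on[OF w'])
  have fc: "continuous_on S (\<lambda>s. (1 / r) *\<^sub>R total (gF (c0 + r *\<^sub>R w s)))" for S
    by (intro continuous_intros bounded_linear.continuous_on[OF bounded_linear_total] continuous_on_force(2) wc)
       (use w(1) in \<open>auto simp: rescaled_solution_def\<close>)
  have \<zeta>': "(\<zeta> has_vector_derivative (1 / r) *\<^sub>R total (gF (c0 + r *\<^sub>R w t))) (at t within {0..b})" if "t \<in> {0..b}" for t b
    unfolding \<zeta>_def by (rule integral_has_vector_derivative[OF fc that])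
  have y': "(y has_vector_derivative F0 (y t) + \<rho> r (y t)) (at t within {0..b})" if "t \<in> {0..b}" for t b
    unfolding field_eq unfolding y_def \<zeta>_def[symmetric] fst_conv snd_conv
    by (intro has_vector_derivative_Pair w' has_vector_derivative_const \<zeta>' that)
  show "continuous_on {0..2*pi} y"
    by (rule vector_derivative_continuous_on[OF y'])
  have "vort (w (2*pi) - w 0) = - (r\<^sup>2 *\<^sub>R J (\<zeta> (2*pi)))"
    by (rule vort_conservation[OF w' \<zeta>' _ r]) (auto simp: \<zeta>_def)
  then have "J (\<zeta> (2*pi)) = 0" using w(2)[of 0] r by (simp add: vort.zero)
  then have "\<zeta> (2*pi) = 0" by simp
  then show "\<beta> (y (2*pi), (w 0, 0)) = 0"
    using w(2)[of 0] w(3) unfolding y_def \<zeta>_def[symmetric] by (simp add: \<beta>_def centred.zero diag.zero zero_prod_def)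
  fix t assume t: "t \<in> {0..2*pi}"
  have "((\<lambda>s. F0 (y s) + \<rho> r (y s)) has_integral y t - y 0) {0..t}"
    by (rule fundamental_theorem_of_calculus) (use t y' in auto)
  moreover have "y 0 = \<iota> (w 0, 0)" by (simp add: y_def \<iota>_def)
  ultimately show "y t = \<iota> (w 0, 0) + integral {0..t} (\<lambda>s. F0 (y s) + \<rho> r (y s))" by (simp add: integral_unique)
qed

end

section \<open>The family of periodic solutions\<close>

lemma h1_fun_shift [simp]: "h1_fun (h1_shift \<theta> u) t = h1_fun u (t + \<theta>)"
  by (simp add: h1_shift.rep_eq)

lemma h1_shift_shift: "h1_shift a (h1_shift b u) = h1_shift (a + b) u"
  by (rule h1_eqI) (simp add: add.assoc)

lemma h1_shift_0: "h1_shift 0 u = u"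
  by (rule h1_eqI) simp

section \<open>Uniform estimates near the orbit\<close>

context vortex_domain
begin

lemma norm_J_mult: "norm (J_mult x) = norm x"
  by (simp add: norm_eq_sqrt_inner J_mult_inner)

definition "m = 2 * norm z"

lemma norm_Z_le: "norm (Z t) \<le> m"
proof -
  have "norm (Z t) \<le> \<bar>cos (\<omega> * t)\<bar> * norm z + \<bar>sin (\<omega> * t)\<bar> * norm z"
    unfolding Z_eq by (rule order_trans[OF norm_triangle_ineq4]) (simp add: norm_J_mult)
  also have "\<dots> \<le> 1 * norm z + 1 * norm z"
    by (intro add_mono mult_right_mono) auto
  finally show ?thesis by (simp add: m_def)
qed

lemma m_pos: "m > 0" using z_nz by (simp add: m_def)

lemma norm_Z_diff_le: "norm (Z a - Z b) \<le> m * norm (a - b)"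
proof (rule differentiable_bound[where S = UNIV and f' = "\<lambda>t h. h *\<^sub>R ((- \<omega>) *\<^sub>R J_mult (Z t))"])
  show "(Z has_derivative (\<lambda>h. h *\<^sub>R ((- \<omega>) *\<^sub>R J_mult (Z t)))) (at t within UNIV)" for t
    using Z_deriv[of t] by (simp add: has_vector_derivative_def)
  show "onorm (\<lambda>h. h *\<^sub>R ((- \<omega>) *\<^sub>R J_mult (Z t))) \<le> m" for t
    by (rule onorm_le) (use \<omega> norm_Z_le[of t] in \<open>simp add: norm_J_mult abs_mult mult.commute[of m] mult_left_mono\<close>)
qed auto

text \<open>\<open>D\<close> vanishes along \<open>Z\<close>, and the deviation from
  \<open>D\<close> is the last component of \<open>\<rho>\<close>. Uniqueness needs this to keep the
  integrated force inside the shooting neighbourhood.\<close>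

lemma total_force_small:
  assumes e: "e > 0"
  shows "\<exists>\<delta>>0. \<exists>r1>0. \<forall>r\<in>{0<..<r1}. \<forall>x t. norm (x - Z t) \<le> \<delta> \<longrightarrow> norm ((1 / r) *\<^sub>R total (gF (c0 + r *\<^sub>R x))) \<le> e"
proof -
  obtain K where K: "K > 0" "\<And>x. norm (D x) \<le> norm x * K" using D.pos_bounded by blast
  define R where "R = m + 2"
  have R: "R > 0" using m_pos by (simp add: R_def)
  obtain r1 where r1: "r1 > 0"
    "\<forall>r\<in>{0<..<r1}. \<forall>x\<in>ball 0 R. \<forall>y\<in>ball 0 R. norm (\<rho> r x - \<rho> r y) \<le> e / (2 * R) * norm (x - y)"
    using \<rho>_lip[of "e / (2 * R)" R] e R by auto
  define \<delta> where "\<delta> = min 1 (e / (2 * K))"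
  have \<delta>: "\<delta> > 0" using e K(1) by (simp add: \<delta>_def)
  have "norm ((1 / r) *\<^sub>R total (gF (c0 + r *\<^sub>R x))) \<le> e" if r: "r \<in> {0<..<r1}" and x: "norm (x - Z t) \<le> \<delta>" for r x t
  proof -
    have nx: "norm x < R"
      using x norm_triangle_sub[of x "Z t"] norm_Z_le[of t] by (simp add: R_def \<delta>_def)
    define y where "y = (x, 0::real, 0::real^2)"
    have ny: "norm y = norm x" by (simp add: y_def norm_Pair)
    have "y \<in> ball 0 R" "0 \<in> ball (0 :: 'n state) R" using ny nx R by auto
    then have "norm (\<rho> r y - \<rho> r 0) \<le> e / (2 * R) * norm (y - 0)" using r1(2) r by blast
    also have "\<dots> \<le> e / (2 * R) * R" using e R ny nx by (intro mult_left_mono) auto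
    finally have 1: "norm (\<rho> r y) \<le> e / 2" using R by (simp add: \<rho>_0)
    have "(1 / r) *\<^sub>R total (gF (c0 + r *\<^sub>R x)) = snd (snd (\<rho> r y)) + D (x - Z t)"
      by (simp add: \<rho>_def y_def D.diff)
    then have "norm ((1 / r) *\<^sub>R total (gF (c0 + r *\<^sub>R x))) \<le> norm (snd (snd (\<rho> r y))) + norm (D (x - Z t))"
      by (simp only: norm_triangle_ineq)
    also have "norm (snd (snd (\<rho> r y))) \<le> norm (\<rho> r y)"
      using norm_snd_le[of "snd (\<rho> r y)" "fst (\<rho> r y)"] norm_snd_le[of "snd (snd (\<rho> r y))" "fst (snd (\<rho> r y))"] by simp
    also have "norm (D (x - Z t)) \<le> \<delta> * K" using K(2)[of "x - Z t"] x K(1) mult_right_mono[of "norm (x - Z t)" \<delta> K] by linarith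
    also have "\<delta> * K \<le> e / 2" using K(1) by (simp add: \<delta>_def min_def field_simps)
    finally show ?thesis using 1 by linarith
  qed
  then show ?thesis using \<delta> r1(1) by blast
qed

text \<open>On the orbit the whole-plane part is \<open>- \<omega> * \<kappa>\<close>. By
  compactness it stays above \<open>\<kappa> / 2\<close> in absolute value nearby, and the
  contribution of \<open>gF\<close> is smaller than that for small \<open>r\<close>.\<close>

lemma energy_nonzero:
  "\<exists>\<delta>>0. \<exists>r1>0. \<forall>r\<in>{0<..<r1}. \<forall>t\<in>{0..2*pi}. \<forall>x. norm (x - Z t) \<le> \<delta> \<longrightarrow> force r x \<bullet> drift x \<noteq> 0"
proof -
  define \<phi> where "\<phi> x = gradH0 \<Gamma> x \<bullet> drift x" for x
  have \<phi>c: "continuous_on (config_space UNIV) \<phi>"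
    unfolding \<phi>_def by (intro continuous_intros C1_map_continuous_on[OF C1_map_gradH0]
        bounded_linear.continuous_on[OF bounded_linear_drift])
  have K: "compact (Z ` {0..2*pi})" "Z ` {0..2*pi} \<subseteq> config_space UNIV"
    using Z_config by (auto intro: compact_continuous_image Z_cont)
  have "\<kappa> / 2 > 0" using \<kappa>_pos by simp
  obtain d where d: "d > 0" "\<And>x y. x \<in> Z ` {0..2*pi} \<Longrightarrow> dist x y < d \<Longrightarrow> y \<in> config_space UNIV \<and> dist (\<phi> x) (\<phi> y) < \<kappa> / 2"
    using uniform_nbhd_compact[OF K config_open[OF open_UNIV] \<phi>c \<open>\<kappa> / 2 > 0\<close>] by blast
  obtain B d2 where B: "B > 0" "d2 > 0" "\<forall>x\<in>ball c0 d2. \<forall>y\<in>ball c0 d2. norm (gF x - gF y) \<le> B * norm (x - y)"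
    using gF_lipschitz by metis
  obtain Kd where Kd: "Kd > 0" "\<And>x. norm (drift x) \<le> norm x * Kd" using drift.pos_bounded by blast
  define R where "R = m + 1"
  have R: "R > 0" using m_pos by (simp add: R_def)
  define C where "C = B * R * (R * Kd)"
  have C: "C > 0" using B R Kd by (simp add: C_def)
  define \<delta> where "\<delta> = min 1 (d / 2)"
  define r1 where "r1 = min 1 (min (d2 / R) (\<kappa> / (2 * C)))"
  have pos: "\<delta> > 0" "r1 > 0" using d B R C \<kappa>_pos by (auto simp: \<delta>_def r1_def)
  have "force r x \<bullet> drift x \<noteq> 0" if r: "r \<in> {0<..<r1}" and t: "t \<in> {0..2*pi}" and x: "norm (x - Z t) \<le> \<delta>" for r t x
  proof -
    have nx: "norm x \<le> R" using x norm_triangle_sub[of x "Z t"] norm_Z_le[of t] by (simp add: R_def \<delta>_def)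
    have "dist (Z t) x < d" using x d(1) by (simp add: dist_norm norm_minus_commute \<delta>_def)
    then have "\<bar>\<phi> (Z t) - \<phi> x\<bar> < \<kappa> / 2" using d(2)[of "Z t" x] t by (simp add: dist_real_def)
    moreover have "\<bar>\<phi> (Z t)\<bar> = \<kappa>" using \<kappa>_pos \<omega> unfolding \<phi>_def gradH0_drift_Z by (simp add: abs_mult)
    ultimately have 1: "\<bar>\<phi> x\<bar> > \<kappa> / 2" by linarith
    have r': "0 < r" "r < 1" "r < d2 / R" "r < \<kappa> / (2 * C)" using r by (auto simp: r1_def)
    have rx: "norm (r *\<^sub>R x) \<le> r * R" using nx r' by simp
    also have "\<dots> < d2" using r' R by (simp add: field_simps)
    finally have "c0 + r *\<^sub>R x \<in> ball c0 d2" "c0 \<in> ball c0 d2" using B(2) by (simp_all add: dist_norm)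
    then have "norm (gF (c0 + r *\<^sub>R x) - gF c0) \<le> B * norm ((c0 + r *\<^sub>R x) - c0)"
      using B(3) by blast
    then have "norm (gF (c0 + r *\<^sub>R x)) \<le> B * norm (r *\<^sub>R x)" by simp
    also have "\<dots> \<le> B * (r * R)" using rx B(1) by (intro mult_left_mono) auto
    also have "\<dots> \<le> B * (1 * R)" using r' B(1) R by (intro mult_left_mono mult_right_mono) auto
    finally have gb: "norm (gF (c0 + r *\<^sub>R x)) \<le> B * R" by simp
    have db: "norm (drift x) \<le> R * Kd"
      using Kd nx by (meson mult_right_mono order_trans less_imp_le)
    have "\<bar>gF (c0 + r *\<^sub>R x) \<bullet> drift x\<bar> \<le> norm (gF (c0 + r *\<^sub>R x)) * norm (drift x)" by (rule Cauchy_Schwarz_ineq2)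
    also have "\<dots> \<le> C" unfolding C_def using gb db B R by (intro mult_mono) auto
    finally have "r * \<bar>gF (c0 + r *\<^sub>R x) \<bullet> drift x\<bar> \<le> r * C" using r' by (intro mult_left_mono) auto
    also have "\<dots> < \<kappa> / 2" using r' C by (simp add: field_simps)
    finally have "\<bar>r * (gF (c0 + r *\<^sub>R x) \<bullet> drift x)\<bar> < \<kappa> / 2" using r' by (simp add: abs_mult)
    moreover have "force r x \<bullet> drift x = \<phi> x - r * (gF (c0 + r *\<^sub>R x) \<bullet> drift x)"
      by (simp add: force_def \<phi>_def inner_diff_left)
    ultimately show ?thesis using 1 by linarith
  qed
  then show ?thesis using pos by blast
qed

text \<open>By the intermediate value theorem, applied to the phase as a function of the time shift.\<close>
lemma phase_fix:
  assumes e: "e > 0"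
  shows "\<exists>\<delta>>0. \<forall>v \<theta>. continuous_on UNIV v \<longrightarrow> (\<forall>t. norm (v (t + \<theta>) - Z t) \<le> \<delta>) \<longrightarrow>
     (\<exists>\<theta>'. (\<forall>t. norm (v (t + \<theta>') - Z t) \<le> e) \<and> v \<theta>' \<bullet> J_mult z = 0)"
proof -
  \<comment> \<open>A shift by at most \<open>\<tau>\<close> moves \<open>Z\<close> by at most
    \<open>e / 2\<close>, and \<open>\<tau> \<le> 1 < pi\<close> keeps \<open>sin \<tau>\<close>
    positive.\<close>
  define \<tau> where "\<tau> = min 1 (e / (2 * m))"
  have \<tau>: "0 < \<tau>" "\<tau> \<le> 1" using e m_pos by (auto simp: \<tau>_def)
  have mt: "m * \<tau> \<le> e / 2" using m_pos by (simp add: \<tau>_def min_def field_simps)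
  define s where "s = sin \<tau> * (z \<bullet> z)"
  have s: "s > 0" unfolding s_def using \<tau> pi_gt3 z_nz by (intro mult_pos_pos sin_gt_zero) auto
  \<comment> \<open>The second bound keeps the phase error at most \<open>s\<close>, the size of the
    phase of \<open>Z\<close> at the times \<open>\<tau>\<close> and \<open>-\<tau>\<close>, so the
    phase has opposite weak signs at the two ends.\<close>
  define \<delta> where "\<delta> = min (e / 2) (s / norm z)"
  have \<delta>: "\<delta> > 0" using e s z_nz by (simp add: \<delta>_def)
  have "\<exists>\<theta>'. (\<forall>t. norm (v (t + \<theta>') - Z t) \<le> e) \<and> v \<theta>' \<bullet> J_mult z = 0"
    if v: "continuous_on UNIV v" and near: "\<And>t. norm (v (t + \<theta>) - Z t) \<le> \<delta>" for v \<theta>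
  proof -
    define \<phi> where "\<phi> a = v (a + \<theta>) \<bullet> J_mult z" for a
    have \<phi>c: "continuous_on {-\<tau>..\<tau>} \<phi>"
      unfolding \<phi>_def by (intro continuous_intros continuous_on_compose2[OF v]) auto
    have \<phi>: "\<bar>\<phi> a + sin (\<omega> * a) * (z \<bullet> z)\<bar> \<le> s" for a
    proof -
      have "\<phi> a + sin (\<omega> * a) * (z \<bullet> z) = (v (a + \<theta>) - Z a) \<bullet> J_mult z"
        by (simp add: \<phi>_def inner_diff_left Z_inner_J)
      also have "\<bar>\<dots>\<bar> \<le> norm (v (a + \<theta>) - Z a) * norm (J_mult z)" by (rule Cauchy_Schwarz_ineq2)
      also have "\<dots> \<le> \<delta> * norm z" unfolding norm_J_mult by (intro mult_right_mono near) auto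
      also have "\<dots> \<le> s" using z_nz by (simp add: \<delta>_def min_def field_simps)
      finally show ?thesis .
    qed
    have "\<exists>a. -\<tau> \<le> a \<and> a \<le> \<tau> \<and> \<phi> a = 0"
    \<comment> \<open>The direction of rotation decides whether the phase decreases or increases
      through 0.\<close>
    proof (cases "\<omega> = 1")
      case True
      then show ?thesis using \<phi>[of \<tau>] \<phi>[of "-\<tau>"] \<tau> by (intro IVT2'[OF _ _ _ \<phi>c]) (auto simp: s_def)
    next
      case False
      then have "\<omega> = -1" using \<omega>_cases by blast
      then show ?thesis using \<phi>[of \<tau>] \<phi>[of "-\<tau>"] \<tau> by (intro IVT'[OF _ _ _ \<phi>c]) (auto simp: s_def)
    qed
    then obtain a where "-\<tau> \<le> a" "a \<le> \<tau>" "\<phi> a = 0" by blast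
    then have a: "\<bar>a\<bar> \<le> \<tau>" "\<phi> a = 0" by linarith+
    have "norm (v (t + (a + \<theta>)) - Z t) \<le> e" for t
    proof -
      have "norm (v (t + (a + \<theta>)) - Z t) \<le> norm (v ((t + a) + \<theta>) - Z (t + a)) + norm (Z (t + a) - Z t)"
        using norm_triangle_ineq[of "v ((t + a) + \<theta>) - Z (t + a)" "Z (t + a) - Z t"] by (simp add: add.assoc)
      also have "\<dots> \<le> e / 2 + m * \<tau>"
      proof (rule add_mono)
        show "norm (v ((t + a) + \<theta>) - Z (t + a)) \<le> e / 2" using near[of "t + a"] by (simp add: \<delta>_def)
        have "norm (Z (t + a) - Z t) \<le> m * \<bar>a\<bar>" using norm_Z_diff_le[of "t + a" t] by simp
        also have "\<dots> \<le> m * \<tau>" using a m_pos by (intro mult_left_mono) auto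
        finally show "norm (Z (t + a) - Z t) \<le> m * \<tau>" .
      qed
      finally show ?thesis using mt by simp
    qed
    then show ?thesis using a(2) unfolding \<phi>_def by blast
  qed
  then show ?thesis using \<delta> by blast
qed

lemma rescaled_solution_shift:
  assumes "rescaled_solution r w" shows "rescaled_solution r (\<lambda>t. w (t + \<theta>))"
  unfolding rescaled_solution_def
proof (intro allI conjI)
  fix t
  have "((\<lambda>t. t + \<theta>) has_vector_derivative 1) (at t)" by (auto intro!: derivative_eq_intros)
  moreover have "(w has_vector_derivative MJ (force r (w (t + \<theta>)))) (at (t + \<theta>))"
    using assms by (simp add: rescaled_solution_def)
  ultimately have "(w \<circ> (\<lambda>t. t + \<theta>) has_vector_derivative 1 *\<^sub>R MJ (force r (w (t + \<theta>)))) (at t)"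
    by (rule vector_diff_chain_at)
  then show "((\<lambda>t. w (t + \<theta>)) has_vector_derivative MJ (force r (w (t + \<theta>)))) (at t)" by (simp add: o_def)
qed (use assms in \<open>auto simp: rescaled_solution_def\<close>)

lemma is_periodic_rescaled:
  fixes w :: "real \<Rightarrow> (real^2)^'n"
  assumes "r > 0" "\<And>t. w (t + 2 * pi) = w t" shows "is_periodic (rescaled a0 r w)"
  unfolding is_periodic_def
proof (intro exI[of _ "2 * pi * r\<^sup>2"] conjI allI)
  fix t
  have "(t + 2 * pi * r\<^sup>2) / r\<^sup>2 = t / r\<^sup>2 + 2 * pi" using assms(1) by (simp add: field_simps)
  then show "rescaled a0 r w (t + 2 * pi * r\<^sup>2) = rescaled a0 r w t" by (simp add: rescaled_eq assms(2))
qed (use assms(1) in simp)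

theorem periodic_family:
  "\<exists>r0>0. \<exists>u :: real \<Rightarrow> ((real^2)^'n) h1per.
    (u C1_differentiable_on {0<..<r0} \<and>
     (u \<longlongrightarrow> rotating_h1 \<omega> z) (at_right 0) \<and>
     (\<forall>r\<in>{0<..<r0}. HS_solution \<Gamma> \<Omega> g (rescaled a0 r (h1_fun (u r))) \<and>
                     is_periodic (rescaled a0 r (h1_fun (u r))))) \<and>
    (\<exists>\<U>. open \<U> \<and>
         (\<forall>\<theta>. h1_shift \<theta> ` \<U> = \<U>) \<and>
         range (\<lambda>\<theta>. h1_shift \<theta> (rotating_h1 \<omega> z)) \<subseteq> \<U> \<and>
         (\<forall>v\<in>\<U>. \<forall>r\<in>{0<..<r0}. HS_solution \<Gamma> \<Omega> g (rescaled a0 r (h1_fun v)) \<longrightarrow>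
            (\<exists>\<theta>. v = h1_shift \<theta> (u r))))"
proof -
  obtain A where A: "\<forall>x\<in>U. (F0 has_derivative blinfun_apply (A x)) (at x)" "continuous_on U A"
    using C1_F0 unfolding C1_map_def by blast
  interpret sh: shooting "2 * pi" y0 "(z, 0)" \<iota> \<beta> U F0 A \<rho>
  proof (rule shooting.intro)
    show "y0 t = \<iota> (z, 0) + integral {0..t} (\<lambda>s. F0 (y0 s))" if "t \<in> {0..2*pi}" for t
    proof -
      have "((\<lambda>s. F0 (y0 s)) has_integral y0 t - y0 0) {0..t}"
        by (rule fundamental_theorem_of_calculus) (use that in \<open>auto intro: has_vector_derivative_at_within y0_deriv\<close>)
      then show ?thesis by (simp add: integral_unique y0_def \<iota>_def)
    qed
    show "\<beta> (y0 (2 * pi), (z, 0)) = 0"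
      using Z_periodic[of 0] by (simp add: \<beta>_def y0_def centred.zero diag.zero J_mult_inner zero_prod_def)
    show "q = 0" if "continuous_on {0..2*pi} w"
      "\<And>t. t \<in> {0..2*pi} \<Longrightarrow> w t = \<iota> q + integral {0..t} (\<lambda>s. blinfun_apply (A (y0 s)) (w s))" "\<beta> (w (2*pi), q) = 0" for w q
      by (rule linear_nondegenerate[OF _ A(2) that]) (use A(1) in blast)
  qed (use y0_U A in \<open>auto intro: bounded_linear_\<iota> bounded_linear_\<beta> open_U y0_cont \<rho>_0 \<rho>_lip \<rho>_C1\<close>)

  \<comment> \<open>Construction of the family\<close>
  obtain r1 \<delta> Y P where r1: "r1 > 0" and \<delta>: "\<delta> > 0"
    and Y: "\<forall>r\<in>{0<..<r1}. sh.solves r (apply_bcontfun (Y r)) (P r) \<and> (\<forall>t. apply_bcontfun (Y r) t \<in> U \<and>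
       apply_bcontfun (sh.field_op r (Y r)) t = F0 (apply_bcontfun (Y r) t) + \<rho> r (apply_bcontfun (Y r) t))"
    and Y_unique: "\<forall>r\<in>{0<..<r1}. \<forall>y q. sh.solves r y q \<longrightarrow> (\<forall>t\<in>{0..2*pi}. norm (y t - y0 t) \<le> \<delta>) \<longrightarrow>
       q = P r \<and> (\<forall>t\<in>{0..2*pi}. y t = apply_bcontfun (Y r) t)"
    and Ylim: "(Y \<longlongrightarrow> sh.y0c) (at_right 0)" and Plim: "(P \<longlongrightarrow> (z, 0)) (at_right 0)"
    and PC1: "C1_map {0<..<r1} P" and NC1: "C1_map {0<..<r1} (\<lambda>r. sh.field_op r (Y r))"
    and Nlim: "((\<lambda>r. sh.field_op r (Y r)) \<longlongrightarrow> bcf_comp F0 sh.y0c) (at_right 0)"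
    using sh.shooting_family .
  obtain \<delta>2 r2 where \<delta>2: "\<delta>2 > 0" "r2 > 0"
    "\<forall>r\<in>{0<..<r2}. \<forall>t\<in>{0..2*pi}. \<forall>x. norm (x - Z t) \<le> \<delta>2 \<longrightarrow> force r x \<bullet> drift x \<noteq> 0"
    using energy_nonzero by blast
  have "\<delta> / 16 > 0" using \<delta> by simp
  then obtain \<delta>3 r3 where \<delta>3: "\<delta>3 > 0" "r3 > 0"
    "\<forall>r\<in>{0<..<r3}. \<forall>x t. norm (x - Z t) \<le> \<delta>3 \<longrightarrow> norm ((1 / r) *\<^sub>R total (gF (c0 + r *\<^sub>R x))) \<le> \<delta> / 16"
    using total_force_small by blast
  \<comment> \<open>The configuration gets one half of the uniqueness radius. The integrated force
    gets the other half: its rate is at most \<open>\<delta> / 16\<close> and the period is shorter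
    than 8.\<close>
  define e where "e = min (\<delta> / 2) \<delta>3"
  have "e > 0" using \<delta> \<delta>3 by (simp add: e_def)
  then obtain \<delta>1 where \<delta>1: "\<delta>1 > 0" "\<forall>v \<theta>. continuous_on UNIV v \<longrightarrow> (\<forall>t. norm (v (t + \<theta>) - Z t) \<le> \<delta>1) \<longrightarrow>
     (\<exists>\<theta>'. (\<forall>t. norm (v (t + \<theta>') - Z t) \<le> e) \<and> v \<theta>' \<bullet> J_mult z = 0)"
    using phase_fix by metis
  define R where "R = m + 1"
  have R: "R > 0" using m_pos by (simp add: R_def)
  obtain r4 where r4: "r4 > 0" "\<forall>r\<in>{0<..<r4}. \<forall>x. norm x < R \<longrightarrow> c0 + r *\<^sub>R x \<in> \<Omega>N" using \<Omega>N_small[OF R] by metis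
  \<comment> \<open>The bound 1 keeps the configuration in the ball where the rescaled points stay
    in the domain; \<open>\<delta>2\<close> keeps the energy rate nonzero.\<close>
  have "min 1 \<delta>2 > 0" using \<delta>2 by simp
  from tendstoD[OF Ylim this] obtain r5 where r5: "r5 > 0" "\<forall>r>0. r < r5 \<longrightarrow> dist (Y r) sh.y0c < min 1 \<delta>2"
    unfolding eventually_at_right_field by blast
  define r0 where "r0 = Min {r1, r2, r3, r4, r5}"
  have r0: "r0 > 0" using r1 \<delta>2(2) \<delta>3(2) r4(1) r5(1) by (simp add: r0_def)
  have r_in: "r \<in> {0<..<r1}" "r \<in> {0<..<r2}" "r \<in> {0<..<r3}" "r \<in> {0<..<r4}" "0 < r" "r < r5" if "r \<in> {0<..<r0}" for r
    using that by (auto simp: r0_def)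
  define pr where "pr = bcf_blin (const_bcontfun fst_blinfun :: real \<Rightarrow>\<^sub>C ('n state \<Rightarrow>\<^sub>L 'n config))"
  have pr: "apply_bcontfun (pr v) t = fst (apply_bcontfun v t)" for v t by (simp add: pr_def)
  have pr_fun: "apply_bcontfun (pr v) = (\<lambda>t. fst (apply_bcontfun v t))" for v by (rule ext) (rule pr)
  have bl_pr: "bounded_linear pr" unfolding pr_def by (rule bounded_bilinear.bounded_linear_right[OF bounded_bilinear_bcf_blin])
  define V where "V r = pr (sh.field_op r (Y r))" for r
  \<comment> \<open>Rebuilt from initial value and velocity. Periodicity makes the velocity
    mean-free, so the correction inside \<open>h1_prim\<close> vanishes and \<open>u r\<close>
    agrees with the shooting solution on one period.\<close>
  define u where "u r = h1_prim (fst (P r), V r)" for r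
  define x where "x r t = fst (apply_bcontfun (Y r) t)" for r t
  have x_near: "norm (x r t - Z t) \<le> \<delta>2 \<and> norm (x r t) < R" if r: "r \<in> {0<..<r0}" and t: "t \<in> {0..2*pi}" for r t
  proof -
    have "dist (apply_bcontfun (Y r) t) (apply_bcontfun sh.y0c t) < min 1 \<delta>2"
      by (rule dist_fun_lt_imp_dist_val_lt) (use r5(2) r_in[OF r] in auto)
    then have "norm (apply_bcontfun (Y r) t - y0 t) < min 1 \<delta>2" using t by (simp add: dist_norm)
    moreover have "norm (x r t - Z t) \<le> norm (apply_bcontfun (Y r) t - y0 t)"
      using norm_fst_le[of "fst (apply_bcontfun (Y r) t - y0 t)" "snd (apply_bcontfun (Y r) t - y0 t)"]
      unfolding prod.collapse by (simp add: x_def y0_def)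
    ultimately show ?thesis
      using norm_triangle_sub[of "x r t" "Z t"] norm_Z_le[of t] by (simp add: R_def)
  qed
  have x_dom: "x r t \<in> config_space UNIV \<and> c0 + r *\<^sub>R x r t \<in> \<Omega>N" if r: "r \<in> {0<..<r0}" and t: "t \<in> {0..2*pi}" for r t
  proof -
    have "apply_bcontfun (Y r) t \<in> U" using Y r_in(1)[OF r] by blast
    then show ?thesis using r4(2) r_in(4)[OF r] x_near[OF r t] by (auto simp: U_def x_def)
  qed
  have sol: "sh.solves r (apply_bcontfun (Y r)) (P r)" if "r \<in> {0<..<r0}" for r using Y r_in(1)[OF that] by blast
  have Y_eq: "apply_bcontfun (Y r) t = \<iota> (P r) + integral {0..t} (\<lambda>s. F0 (apply_bcontfun (Y r) s) + \<rho> r (apply_bcontfun (Y r) s))"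
    if "r \<in> {0<..<r0}" "t \<in> {0..2*pi}" for r t
    using sol[OF that(1)] that(2) unfolding sh.solves_def by blast
  have field_fun: "apply_bcontfun (sh.field_op r (Y r)) = (\<lambda>s. F0 (apply_bcontfun (Y r) s) + \<rho> r (apply_bcontfun (Y r) s))"
    if "r \<in> {0<..<r0}" for r using Y r_in(1)[OF that] by blast
  have per: "fst (apply_bcontfun (Y r) (2*pi)) = fst (P r)" "t \<in> {0..2*pi} \<Longrightarrow> fst (snd (apply_bcontfun (Y r) t)) = 0"
    if r: "r \<in> {0<..<r0}" for r t
  proof -
    have b: "\<beta> (apply_bcontfun (Y r) (2*pi), P r) = 0" using sol[OF r] unfolding sh.solves_def by blast
    have nz: "force r (fst (apply_bcontfun (Y r) t)) \<bullet> drift (fst (apply_bcontfun (Y r) t)) \<noteq> 0" if "t \<in> {0..2*pi}" for t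
      using \<delta>2(3) r_in(2)[OF r] that x_near[OF r that] unfolding x_def by blast
    note * = periodic_of_solution[OF r_in(5)[OF r] continuous_on_apply_bcontfun b Y_eq[OF r] x_dom[OF r, unfolded x_def] nz]
    show "fst (apply_bcontfun (Y r) (2*pi)) = fst (P r)" by (rule *(1))
    show "fst (snd (apply_bcontfun (Y r) t)) = 0" if "t \<in> {0..2*pi}" by (rule *(2)[OF _ _ _ that])
  qed
  have V_eq: "apply_bcontfun (V r) t = MJ (force r (x r t))" if "r \<in> {0<..<r0}" "t \<in> {0..2*pi}" for r t
    unfolding V_def pr field_fun[OF that(1)] field_eq by (simp add: x_def per(2)[OF that])
  have V_int: "integral {0..t} (V r) = x r t - fst (P r)" if r: "r \<in> {0<..<r0}" and t: "t \<in> {0..2*pi}" for r t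
  proof -
    have "integral {0..t} (V r) = fst (integral {0..t} (sh.field_op r (Y r)))"
      using integral_linear[OF integrable_continuous_interval[OF continuous_on_apply_bcontfun] bounded_linear_fst, of 0 t "sh.field_op r (Y r)"]
      by (simp add: V_def pr_fun o_def)
    then show ?thesis using Y_eq[OF r t] unfolding field_fun[OF r] by (simp add: x_def \<iota>_def)
  qed
  have V_mean: "integral {0..2*pi} (V r) = 0" if "r \<in> {0<..<r0}" for r
    using V_int[OF that, of "2*pi"] per(1)[OF that] by (simp add: x_def)
  have u_x: "h1_fun (u r) t = x r t" if "r \<in> {0<..<r0}" "t \<in> {0..2*pi}" for r t
    unfolding u_def h1_fun_h1_prim periodic_prim_eq[OF that(2)] V_int[OF that] V_mean[OF that(1)] by simp
  have u_sol: "rescaled_solution r (h1_fun (u r))" if r: "r \<in> {0<..<r0}" for r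
  proof -
    have wI: "wrap t \<in> {0..2*pi}" for t using wrap_bounds[of t] by simp
    have xw: "x r (wrap t) = h1_fun (u r) t" for t
      using u_x[OF r wI[of t]] periodic_wrap[of "h1_fun (u r)" t, OF h1_fun_periodic] by simp
    have dom: "h1_fun (u r) t \<in> config_space UNIV \<and> c0 + r *\<^sub>R h1_fun (u r) t \<in> \<Omega>N" for t
      using x_dom[OF r wI[of t]] unfolding xw .
    have "has_weak_deriv (h1_fun (u r)) (\<lambda>t. apply_bcontfun (V r) (wrap t))"
      using has_weak_deriv_periodic_prim[of "fst (P r)" "V r"] V_mean[OF r] unfolding u_def h1_fun_h1_prim by simp
    \<comment> \<open>Wrapped time can be replaced by time itself since the velocity depends only on
      the periodic function; its right-hand side is therefore continuous across multiples of the
      period.\<close>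
    then have w: "has_weak_deriv (h1_fun (u r)) (\<lambda>t. MJ (force r (h1_fun (u r) t)))" unfolding V_eq[OF r wI] xw .
    have "continuous_on UNIV (\<lambda>t. MJ (force r (h1_fun (u r) t)))"
      by (intro continuous_on_force(1) h1_fun_continuous dom)
    then show ?thesis unfolding rescaled_solution_def using dom has_weak_deriv_vector_derivative[OF w] by blast
  qed
  have "C1_map {0<..<r0} u"
  proof (rule C1_map_subset)
    show "C1_map {0<..<r1} u"
      unfolding u_def V_def
      by (intro C1_map_linear_compose[OF bounded_linear_h1_prim] C1_map_Pair C1_map_linear_compose[OF bounded_linear_fst] PC1
          C1_map_linear_compose[OF bl_pr] NC1)
  qed (use r_in(1) in blast)
  then have uC1: "u C1_differentiable_on {0<..<r0}" by (rule C1_map_imp_C1_differentiable_on)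
  have Z_h1: "h1_fun (rotating_h1 \<omega> z) = Z" by (rule h1_fun_rotating_h1[OF \<omega>])
  have ulim: "(u \<longlongrightarrow> rotating_h1 \<omega> z) (at_right 0)"
  proof -
    have "(u \<longlongrightarrow> h1_prim (fst (z, 0::real), pr (bcf_comp F0 sh.y0c))) (at_right 0)"
      unfolding u_def V_def
      by (intro bounded_linear.tendsto[OF bounded_linear_h1_prim] tendsto_Pair tendsto_fst Plim
          bounded_linear.tendsto[OF bl_pr] Nlim)
    moreover have "h1_prim (fst (z, 0::real), pr (bcf_comp F0 sh.y0c)) = rotating_h1 \<omega> z"
    proof (rule h1_prim_eqI)
      have int: "integral {0..t} (pr (bcf_comp F0 sh.y0c)) = Z t - z" if "t \<in> {0..2*pi}" for t
      proof -
        have "((\<lambda>s. apply_bcontfun (pr (bcf_comp F0 sh.y0c)) s) has_integral Z t - Z 0) {0..t}"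
        proof (rule fundamental_theorem_of_calculus)
          fix s assume "s \<in> {0..t}"
          then have "apply_bcontfun (pr (bcf_comp F0 sh.y0c)) s = MJ (gradH0 \<Gamma> (Z s))"
            using that by (simp add: pr sh.F0y0 F0_y0)
          then show "(Z has_vector_derivative apply_bcontfun (pr (bcf_comp F0 sh.y0c)) s) (at s within {0..t})"
            by (simp only: has_vector_derivative_at_within[OF Z_deriv'])
        qed (use that in simp)
        then show ?thesis by (simp add: integral_unique)
      qed
      show "h1_fun (rotating_h1 \<omega> z) t = fst (z, 0::real) + integral {0..t} (pr (bcf_comp F0 sh.y0c))" if "t \<in> {0..2*pi}" for t
        using int[OF that] by (simp add: Z_h1)
      show "integral {0..2*pi} (pr (bcf_comp F0 sh.y0c)) = 0" using int[of "2*pi"] Z_periodic[of 0] by simp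
    qed
    ultimately show ?thesis by simp
  qed
  have usol: "HS_solution \<Gamma> \<Omega> g (rescaled a0 r (h1_fun (u r))) \<and> is_periodic (rescaled a0 r (h1_fun (u r)))"
    if "r \<in> {0<..<r0}" for r
    using HS_rescaled_iff[OF r_in(5)[OF that]] u_sol[OF that] is_periodic_rescaled[OF r_in(5)[OF that], of "h1_fun (u r)"]
      h1_fun_periodic by blast

  \<comment> \<open>The invariant neighbourhood and local uniqueness\<close>
  define \<U> where "\<U> = {w :: ('n config) h1per. \<exists>\<theta> d. d < \<delta>1 \<and> (\<forall>t. norm (h1_fun w (t + \<theta>) - Z t) \<le> d)}"
  have openU: "open \<U>"
  proof -
    obtain C where C: "C > 0" "\<And>(w :: ('n config) h1per) t. norm (h1_fun w t) \<le> C * norm w"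
      using h1_sup_bound[where 'a = "'n config"] by blast
    show ?thesis unfolding open_contains_ball
    proof
      fix w assume "w \<in> \<U>"
      then obtain \<theta> d where d: "d < \<delta>1" "\<And>t. norm (h1_fun w (t + \<theta>) - Z t) \<le> d" by (auto simp: \<U>_def)
      \<comment> \<open>The supremum bound turns H^1 distance into uniform distance; half of the
        margin between \<open>d\<close> and \<open>\<delta>1\<close> is spent, so the inequality
        stays strict.\<close>
      define \<epsilon> where "\<epsilon> = (\<delta>1 - d) / (2 * C)"
      have "w' \<in> \<U>" if w': "w' \<in> ball w \<epsilon>" for w'
      proof -
        have "norm (h1_fun w' (t + \<theta>) - Z t) \<le> d + C * \<epsilon>" for t
        proof -
          have "norm (h1_fun w' (t + \<theta>) - Z t) \<le> norm (h1_fun w (t + \<theta>) - Z t) + norm (h1_fun (w' - w) (t + \<theta>))"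
            using norm_triangle_ineq[of "h1_fun w (t + \<theta>) - Z t" "h1_fun (w' - w) (t + \<theta>)"] by simp
          also have "\<dots> \<le> d + C * norm (w' - w)" by (intro add_mono d(2) C(2))
          also have "\<dots> \<le> d + C * \<epsilon>" using w' C(1) by (intro add_left_mono mult_left_mono) (auto simp: dist_norm norm_minus_commute)
          finally show ?thesis .
        qed
        moreover have "d + C * \<epsilon> < \<delta>1" using d(1) C(1) by (simp add: \<epsilon>_def field_simps)
        ultimately show ?thesis unfolding \<U>_def by blast
      qed
      then show "\<exists>\<epsilon>>0. ball w \<epsilon> \<subseteq> \<U>" using d(1) C(1) by (intro exI[of _ \<epsilon>]) (auto simp: \<epsilon>_def)
    qed
  qed
  have shift_in: "h1_shift \<theta> w \<in> \<U>" if w: "w \<in> \<U>" for \<theta> w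
  proof -
    obtain \<theta>' d where d: "d < \<delta>1" "\<And>t. norm (h1_fun w (t + \<theta>') - Z t) \<le> d" using w by (auto simp: \<U>_def)
    have "norm (h1_fun (h1_shift \<theta> w) (t + (\<theta>' - \<theta>)) - Z t) \<le> d" for t using d(2)[of t] by (simp add: algebra_simps)
    then show ?thesis using d(1) unfolding \<U>_def by blast
  qed
  have shiftU: "h1_shift \<theta> ` \<U> = \<U>" for \<theta>
  proof
    show "h1_shift \<theta> ` \<U> \<subseteq> \<U>" using shift_in by blast
    show "\<U> \<subseteq> h1_shift \<theta> ` \<U>"
    proof
      fix w assume "w \<in> \<U>"
      then have "h1_shift (- \<theta>) w \<in> \<U>" by (rule shift_in)
      moreover have "w = h1_shift \<theta> (h1_shift (- \<theta>) w)" by (simp add: h1_shift_shift h1_shift_0)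
      ultimately show "w \<in> h1_shift \<theta> ` \<U>" by blast
    qed
  qed
  have "rotating_h1 \<omega> z \<in> \<U>"
    unfolding \<U>_def using \<delta>1(1) by (intro CollectI exI[of _ 0]) (simp add: Z_h1)
  then have orbit: "range (\<lambda>\<theta>. h1_shift \<theta> (rotating_h1 \<omega> z)) \<subseteq> \<U>" using shift_in by blast
  have unique: "\<exists>\<theta>. v = h1_shift \<theta> (u r)"
    if v: "v \<in> \<U>" and r: "r \<in> {0<..<r0}" and HS: "HS_solution \<Gamma> \<Omega> g (rescaled a0 r (h1_fun v))" for v r
  proof -
    obtain \<theta> d where d: "d < \<delta>1" "\<And>t. norm (h1_fun v (t + \<theta>) - Z t) \<le> d" using v by (auto simp: \<U>_def)
    then have "\<forall>t. norm (h1_fun v (t + \<theta>) - Z t) \<le> \<delta>1" by (meson less_imp_le order_trans)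
    \<comment> \<open>Membership in the neighbourhood only gives closeness up to some shift; this
      shift is corrected so that the phase condition holds exactly.\<close>
    then obtain \<theta>' where \<theta>': "\<forall>t. norm (h1_fun v (t + \<theta>') - Z t) \<le> e" "h1_fun v \<theta>' \<bullet> J_mult z = 0"
      using \<delta>1(2) h1_fun_continuous by blast
    define w where "w t = h1_fun v (t + \<theta>')" for t
    have w_sol: "rescaled_solution r w"
      unfolding w_def using HS HS_rescaled_iff[OF r_in(5)[OF r]] by (intro rescaled_solution_shift) blast
    have w_per: "w (t + 2 * pi) = w t" for t
      unfolding w_def using h1_fun_periodic[of v "t + \<theta>'"] by (simp add: algebra_simps)
    have w_ph: "w 0 \<bullet> J_mult z = 0" using \<theta>'(2) by (simp add: w_def)
    define y where "y t = (w t, 0::real, integral {0..t} (\<lambda>s. (1 / r) *\<^sub>R total (gF (c0 + r *\<^sub>R w s))))" for t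
    note y = solution_of_periodic[OF r_in(5)[OF r] w_sol w_per w_ph, folded y_def]
    have y_sol: "sh.solves r y (w 0, 0)" unfolding sh.solves_def using y by blast
    have w_near: "norm (w t - Z t) \<le> \<delta> / 2" "norm (w t - Z t) \<le> \<delta>3" for t using \<theta>'(1) by (auto simp: w_def e_def)
    have y_near: "norm (y t - y0 t) \<le> \<delta>" if t: "t \<in> {0..2*pi}" for t
    proof -
      have "norm (integral {0..t} (\<lambda>s. (1 / r) *\<^sub>R total (gF (c0 + r *\<^sub>R w s)))) \<le> \<delta> / 16 * (t - 0)"
      proof (rule integral_bound)
        have "continuous_on {0..t} w" unfolding w_def
          by (intro continuous_on_compose2[OF h1_fun_continuous[of UNIV]] continuous_intros) auto
        then show "continuous_on {0..t} (\<lambda>s. (1 / r) *\<^sub>R total (gF (c0 + r *\<^sub>R w s)))"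
          by (intro continuous_intros bounded_linear.continuous_on[OF bounded_linear_total] continuous_on_force(2))
             (use w_sol in \<open>auto simp: rescaled_solution_def\<close>)
        show "norm ((1 / r) *\<^sub>R total (gF (c0 + r *\<^sub>R w s))) \<le> \<delta> / 16" for s
          using \<delta>3(3) r_in(3)[OF r] w_near(2) by blast
      qed (use t in simp)
      also have "\<dots> \<le> \<delta> / 16 * 8" using t pi_less_4 \<delta> by (intro mult_left_mono) auto
      finally have \<zeta>: "norm (integral {0..t} (\<lambda>s. (1 / r) *\<^sub>R total (gF (c0 + r *\<^sub>R w s)))) \<le> \<delta> / 2" by simp
      have "norm (y t - y0 t) \<le> norm (w t - Z t) + norm (0::real, integral {0..t} (\<lambda>s. (1 / r) *\<^sub>R total (gF (c0 + r *\<^sub>R w s))))"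
        unfolding y_def y0_def by (simp only: diff_Pair diff_zero norm_Pair_le)
      also have "\<dots> \<le> \<delta> / 2 + \<delta> / 2" using w_near(1)[of t] \<zeta> by (intro add_mono) (simp_all add: norm_Pair)
      finally show ?thesis by simp
    qed
    have "\<forall>t\<in>{0..2*pi}. y t = apply_bcontfun (Y r) t" using Y_unique r_in(1)[OF r] y_sol y_near by blast
    then have "w t = x r t" if "t \<in> {0..2*pi}" for t using that by (metis x_def y_def fst_conv)
    \<comment> \<open>Agreement on one period suffices for periodic functions; the shift is then
      inverted.\<close>
    then have "h1_shift \<theta>' v = u r" by (intro h1_eqI_period) (simp add: u_x[OF r] w_def)
    then have "v = h1_shift (- \<theta>') (u r)" by (metis h1_shift_shift h1_shift_0 add.left_inverse)
    then show ?thesis by blast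
  qed
  have existence: "u C1_differentiable_on {0<..<r0} \<and> (u \<longlongrightarrow> rotating_h1 \<omega> z) (at_right 0) \<and>
     (\<forall>r\<in>{0<..<r0}. HS_solution \<Gamma> \<Omega> g (rescaled a0 r (h1_fun (u r))) \<and> is_periodic (rescaled a0 r (h1_fun (u r))))"
    using uC1 ulim usol by blast
  have uniqueness: "open \<U> \<and> (\<forall>\<theta>. h1_shift \<theta> ` \<U> = \<U>) \<and>
         range (\<lambda>\<theta>. h1_shift \<theta> (rotating_h1 \<omega> z)) \<subseteq> \<U> \<and>
         (\<forall>v\<in>\<U>. \<forall>r\<in>{0<..<r0}. HS_solution \<Gamma> \<Omega> g (rescaled a0 r (h1_fun v)) \<longrightarrow> (\<exists>\<theta>. v = h1_shift \<theta> (u r)))"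
    using openU shiftU orbit unique by (intro conjI ballI allI impI)
  show ?thesis using r0 existence uniqueness by (intro exI[of _ r0] conjI exI[of _ u]) blast+
qed

end

theorem theorem2p1:
  fixes \<Omega> :: "(real^2) set"
    and g :: "real^2 \<Rightarrow> real^2 \<Rightarrow> real"
    and \<Gamma> :: "'n::finite \<Rightarrow> real"
    and \<omega> :: real
    and z :: "(real^2)^'n"
    and a0 :: "real^2"
  assumes "smooth_domain \<Omega>"
    and "\<And>x y. x \<in> \<Omega> \<Longrightarrow> y \<in> \<Omega> \<Longrightarrow> g x y = g y x"
    and "C2_on (\<Omega> \<times> \<Omega>) (\<lambda>(x, y). g x y)"
    and "\<And>k. \<Gamma> k \<noteq> 0"
    and "\<bar>\<omega>\<bar> = 1"
    and "nondegenerate_relative_equilibrium \<Gamma> \<omega> z"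
    and "a0 \<in> \<Omega>"
    and "nondegenerate_critical_point (\<lambda>x. g x x) a0"
    and "(\<Sum>k\<in>UNIV. \<Gamma> k) \<noteq> 0"
  shows "\<exists>r0>0. \<exists>u :: real \<Rightarrow> ((real^2)^'n) h1per.
    (u C1_differentiable_on {0<..<r0} \<and>
     (u \<longlongrightarrow> rotating_h1 \<omega> z) (at_right 0) \<and>
     (\<forall>r\<in>{0<..<r0}. HS_solution \<Gamma> \<Omega> g (rescaled a0 r (h1_fun (u r))) \<and>
                     is_periodic (rescaled a0 r (h1_fun (u r))))) \<and>
    (\<exists>\<U>. open \<U> \<and>
         (\<forall>\<theta>. h1_shift \<theta> ` \<U> = \<U>) \<and>
         range (\<lambda>\<theta>. h1_shift \<theta> (rotating_h1 \<omega> z)) \<subseteq> \<U> \<and>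
         (\<forall>v\<in>\<U>. \<forall>r\<in>{0<..<r0}. HS_solution \<Gamma> \<Omega> g (rescaled a0 r (h1_fun v)) \<longrightarrow>
            (\<exists>\<theta>. v = h1_shift \<theta> (u r))))"
proof -
  have \<Omega>: "open \<Omega>" using assms(1) by (simp add: smooth_domain_def)
  obtain g1 where g1: "C1_map (\<Omega> \<times> \<Omega>) g1" "partial_gradient \<Omega> g g1"
    using C2_partial_gradient[OF \<Omega> assms(2,3)] .
  interpret vortex_domain \<Gamma> \<omega> z \<Omega> g g1 a0
    by unfold_locales (fact assms \<Omega> g1)+
  show ?thesis by (rule periodic_family)
qed

end
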